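(* Let $T^-<0<T^+$ and let $u\in C^0((T^-,T^+);H^4_+)$ be the unique solution of the CMDNLS equation $$i\partial_tu+\partial_x^2u+u(\mathbb{H}-i)\partial_x(|u|^2)=0$$ with initial datum $u(0)=u_0\in H^4_+$. If $u_0,\partial_xu_0,\partial_x^2u_0\in L^2_1$, then $$u(t),\ \partial_xu(t),\ \partial_x^2u(t)\in L^2_1,\qquad\forall t\in(T^-,T^+).$$
   Context: All functions are complex valued on $\mathbb{R}$. $\mathbb{H}f(x)=\mathrm{P.V.}\frac1\pi\int_{\mathbb{R}}\frac{f(y)}{x-y}\,dy$ is the Hilbert transform. $\hat f(\xi)=\int_{\mathbb{R}} f(x)e^{-ix\xi}\,dx$. $H^\sigma_+=\{f\in H^\sigma(\mathbb{R};\mathbb{C}):\mathrm{supp}\,\hat f\subset[0,+\infty)\}$. $L^2_1=\{f:\int_{\mathbb{R}}|f(x)|^2(1+x^2)\,dx<\infty\}$. *)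

theory Defs
  imports "HOL-Analysis.Analysis"
begin

text \<open>
  Elements of $L^2(\mathbb R;\mathbb C)$ and of its subspaces are represented by Borel
  functions. All notions below depend only on the class of a function modulo Lebesgue null sets.
\<close>

definition L2 :: "(real \<Rightarrow> complex) set" where
  "L2 = {f \<in> borel_measurable borel. integrable lborel (\<lambda>x. (cmod (f x))\<^sup>2)}"

definition L2_norm :: "(real \<Rightarrow> complex) \<Rightarrow> real" where
  "L2_norm f = sqrt (LINT x|lborel. (cmod (f x))\<^sup>2)"

definition L2_1 :: "(real \<Rightarrow> complex) set" where
  "L2_1 = {f \<in> borel_measurable borel. integrable lborel (\<lambda>x. (cmod (f x))\<^sup>2 * (1 + x\<^sup>2))}"

definition test_function :: "(real \<Rightarrow> real) \<Rightarrow> bool" where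
  "test_function \<phi> \<longleftrightarrow>
     (\<forall>k x. (deriv ^^ k) \<phi> differentiable at x) \<and> bounded {x. \<phi> x \<noteq> 0}"

definition locally_integrable :: "(real \<Rightarrow> complex) \<Rightarrow> bool" where
  "locally_integrable f \<longleftrightarrow> (\<forall>a b. set_integrable lborel {a..b} f)"

definition has_weak_deriv :: "nat \<Rightarrow> (real \<Rightarrow> complex) \<Rightarrow> (real \<Rightarrow> complex) \<Rightarrow> bool" where
  "has_weak_deriv k f g \<longleftrightarrow>
     locally_integrable f \<and> locally_integrable g \<and>
     (\<forall>\<phi>. test_function \<phi> \<longrightarrow>
        (LINT x|lborel. f x * of_real ((deriv ^^ k) \<phi> x)) =
        (- 1) ^ k * (LINT x|lborel. g x * of_real (\<phi> x)))"

text \<open>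
  A representative of the $k$-th weak derivative, which is unique up to null sets. The value is
  unspecified if there is no weak derivative.
\<close>

definition weak_deriv :: "nat \<Rightarrow> (real \<Rightarrow> complex) \<Rightarrow> (real \<Rightarrow> complex)" where
  "weak_deriv k f = (SOME g. has_weak_deriv k f g)"

definition Sobolev :: "nat \<Rightarrow> (real \<Rightarrow> complex) set" where
  "Sobolev k = {f \<in> L2. \<forall>j\<le>k. \<exists>g\<in>L2. has_weak_deriv j f g}"

definition Sobolev_norm :: "nat \<Rightarrow> (real \<Rightarrow> complex) \<Rightarrow> real" where
  "Sobolev_norm k f = sqrt (\<Sum>j\<le>k. (L2_norm (weak_deriv j f))\<^sup>2)"

text \<open>
  The Fourier transform on $L^2$ (Plancherel): the $L^2$ limit, as $R \to \infty$, of the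
  integrals over $[-R,R]$. It is determined up to null sets.
\<close>

definition is_Fourier_L2 :: "(real \<Rightarrow> complex) \<Rightarrow> (real \<Rightarrow> complex) \<Rightarrow> bool" where
  "is_Fourier_L2 f F \<longleftrightarrow> F \<in> L2 \<and>
     ((\<lambda>R. L2_norm (\<lambda>\<xi>. (LINT x:{-R..R}|lborel. f x * exp (- \<i> * of_real (x * \<xi>))) - F \<xi>))
        \<longlongrightarrow> 0) at_top"

definition Fourier_L2 :: "(real \<Rightarrow> complex) \<Rightarrow> (real \<Rightarrow> complex)" where
  "Fourier_L2 f = (SOME F. is_Fourier_L2 f F)"

text \<open>The support of a function modulo null sets, i.e. its support as a distribution.\<close>

definition ess_support :: "(real \<Rightarrow> complex) \<Rightarrow> real set" where
  "ess_support F = - \<Union> {U. open U \<and> (AE \<xi> in lborel. \<xi> \<in> U \<longrightarrow> F \<xi> = 0)}"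

definition Sobolev_plus :: "nat \<Rightarrow> (real \<Rightarrow> complex) set" where
  "Sobolev_plus k = {f \<in> Sobolev k. ess_support (Fourier_L2 f) \<subseteq> {0..}}"

definition Hilbert_transform :: "(real \<Rightarrow> complex) \<Rightarrow> real \<Rightarrow> complex" where
  "Hilbert_transform f x =
     of_real (1 / pi) *
     Lim (at_right 0) (\<lambda>\<epsilon>. LINT y:{y. \<epsilon> < \<bar>x - y\<bar>}|lborel. f y / of_real (x - y))"

definition C0_Sobolev_plus :: "nat \<Rightarrow> real set \<Rightarrow> (real \<Rightarrow> real \<Rightarrow> complex) \<Rightarrow> bool" where
  "C0_Sobolev_plus k I u \<longleftrightarrow>
     (\<forall>t\<in>I. u t \<in> Sobolev_plus k) \<and>
     (\<forall>t\<in>I. ((\<lambda>s. Sobolev_norm k (\<lambda>x. u s x - u t x)) \<longlongrightarrow> 0) (at t within I))"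

text \<open>The derivative at time $t$ of a curve $u$ with values in $L^2$.\<close>

definition has_time_deriv ::
    "real set \<Rightarrow> (real \<Rightarrow> real \<Rightarrow> complex) \<Rightarrow> real \<Rightarrow> (real \<Rightarrow> complex) \<Rightarrow> bool" where
  "has_time_deriv I u t v \<longleftrightarrow> v \<in> L2 \<and>
     ((\<lambda>s. L2_norm (\<lambda>x. (u s x - u t x) / of_real (s - t) - v x)) \<longlongrightarrow> 0) (at t within I)"

text \<open>
  For $u(t) \in H^4$ each term of the equation lies in $L^2$, and the equation is an identity
  in $L^2$ at every time.
\<close>

definition CMDNLS_equation :: "real set \<Rightarrow> (real \<Rightarrow> real \<Rightarrow> complex) \<Rightarrow> bool" where
  "CMDNLS_equation I u \<longleftrightarrow>
     (\<forall>t\<in>I. \<exists>v. has_time_deriv I u t v \<and>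
        (let D = weak_deriv 1 (\<lambda>x. of_real ((cmod (u t x))\<^sup>2)) in
         AE x in lborel.
           \<i> * v x + weak_deriv 2 (u t) x + u t x * (Hilbert_transform D x - \<i> * D x) = 0))"

end

theory Submission
  imports Defs
begin

text \<open>
  Write $p_j$ for the $j$-th space derivative of $u$, and the equation as
  $u_t = i p_2 + i u G$ with $G = (H - i) (|u|^2)_x$. Since $u \in H^4$, the potential $G$ and its
  first two derivatives are bounded. Consider the energies $E_j = \int |p_j|^2 w$ for the
  truncated weights $w = (1 + x^2) / (1 + \epsilon x^2)$, which satisfy $|w'| \le 2 \sqrt w$
  uniformly in $\epsilon$. The energy $E_1$ is controlled by $E_0 + E_2$ and $\|p_1\|$ through an
  integration by parts. In the time derivative of $E_0 + E_2$ the dispersive term leaves only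
  $\int p_3 \bar p_2 w'$, bounded by $\|p_3\|^2 + E_2$, because $i \int |p_3|^2 w$ has no real
  part. Gronwall's inequality bounds $E_0 + E_2$ by constants that do not depend on $\epsilon$, and
  $\epsilon \to 0$ gives the claim.
\<close>

section \<open>Square integrable functions\<close>

text \<open>Truncating the weight lets the argument start: under a bounded weight every energy of an
  H^4 function is finite and can be differentiated in time before any decay is known. The bound on
  w' splits each term containing w' into a weighted square, which Gronwall absorbs, and an
  unweighted one, which is bounded by Sobolev norms on compact time intervals. E_0 and E_2 are
  summed because neither rate closes alone: p_2 enters the rate of E_0, while (u G)'' brings p_0 and
  p_1 into that of E_2. Four derivatives are what the bounds on G cost here: the Hilbert transform
  is estimated in the sup norm by an H^1 norm, so G'' takes four derivatives of |u|^2. This estimate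
  is made on the real line, by symmetrising the principal value, without Fourier multipliers. All
  rates are bounded in absolute value, so both time directions are covered. The earlier sections
  pass from classes modulo null sets to absolutely continuous representatives, for which products
  and integration by parts are available.\<close>

lemma borel_measurable_cnj [measurable (raw)]:
  "f \<in> borel_measurable M \<Longrightarrow> (\<lambda>x. cnj (f x)) \<in> borel_measurable M"
  by (rule measurable_compose[OF _ borel_measurable_continuous_onI]) (auto intro: continuous_intros)

lemma L2_measurable [measurable_dest]: "f \<in> L2 \<Longrightarrow> f \<in> borel_measurable borel"
  by (simp add: L2_def)

lemma L2_integrable_square: "f \<in> L2 \<Longrightarrow> integrable lborel (\<lambda>x. (cmod (f x))\<^sup>2)"
  by (simp add: L2_def)

lemma L2I_bound:
  assumes "f \<in> borel_measurable borel" "integrable lborel b" "\<And>x. (cmod (f x))\<^sup>2 \<le> b x"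
  shows "f \<in> L2"
proof -
  have "integrable lborel (\<lambda>x. (cmod (f x))\<^sup>2)"
    by (rule Bochner_Integration.integrable_bound[OF assms(2)])
       (use assms in \<open>auto intro!: AE_I2 order_trans[OF assms(3)]\<close>)
  with assms(1) show ?thesis by (simp add: L2_def)
qed

lemma L2_add: assumes "f \<in> L2" "g \<in> L2" shows "(\<lambda>x. f x + g x) \<in> L2"
proof (rule L2I_bound)
  note [measurable] = L2_measurable[OF assms(1)] L2_measurable[OF assms(2)]
  show "(\<lambda>x. f x + g x) \<in> borel_measurable borel" by measurable
  show "integrable lborel (\<lambda>x. 2 * (cmod (f x))\<^sup>2 + 2 * (cmod (g x))\<^sup>2)"
    using assms[THEN L2_integrable_square] by auto
  fix x
  have "(cmod (f x + g x))\<^sup>2 \<le> (cmod (f x) + cmod (g x))\<^sup>2"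
    by (intro power_mono norm_triangle_ineq) auto
  also have "\<dots> \<le> 2 * (cmod (f x))\<^sup>2 + 2 * (cmod (g x))\<^sup>2"
    using sum_squares_bound[of "cmod (f x)" "cmod (g x)"] by (simp add: power2_sum)
  finally show "(cmod (f x + g x))\<^sup>2 \<le> \<dots>" .
qed

lemma L2_bounded_mult:
  assumes "f \<in> L2" and [measurable]: "g \<in> borel_measurable borel" and "\<And>x. cmod (g x) \<le> K"
  shows "(\<lambda>x. g x * f x) \<in> L2"
proof (rule L2I_bound)
  note [measurable] = L2_measurable[OF assms(1)]
  show "(\<lambda>x. g x * f x) \<in> borel_measurable borel" by measurable
  show "integrable lborel (\<lambda>x. K\<^sup>2 * (cmod (f x))\<^sup>2)"
    using assms(1)[THEN L2_integrable_square] by auto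
  show "(cmod (g x * f x))\<^sup>2 \<le> K\<^sup>2 * (cmod (f x))\<^sup>2" for x
    by (simp add: norm_mult power_mult_distrib) (intro mult_right_mono power_mono assms, auto)
qed

lemma L2_cmult: "f \<in> L2 \<Longrightarrow> (\<lambda>x. c * f x) \<in> L2"
  by (rule L2_bounded_mult[where K="cmod c"]) auto

lemma L2_diff: assumes "f \<in> L2" "g \<in> L2" shows "(\<lambda>x. f x - g x) \<in> L2"
  using L2_add[OF assms(1) L2_cmult[OF assms(2), of "-1"]] by simp

lemma L2_cnj: "f \<in> L2 \<Longrightarrow> (\<lambda>x. cnj (f x)) \<in> L2"
  by (auto simp: L2_def intro: borel_measurable_cnj)

lemma L2_divide: "f \<in> L2 \<Longrightarrow> (\<lambda>x. f x / c) \<in> L2"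
  using L2_cmult[of f "1 / c"] by simp

lemma L2_cong_AE:
  assumes "f \<in> L2" "g \<in> borel_measurable borel" "AE x in lborel. f x = g x"
  shows "g \<in> L2"
proof -
  note [measurable] = L2_measurable[OF assms(1)] assms(2)
  have "integrable lborel (\<lambda>x. (cmod (g x))\<^sup>2) \<longleftrightarrow> integrable lborel (\<lambda>x. (cmod (f x))\<^sup>2)"
    by (rule integrable_cong_AE) (use assms(3) in auto)
  with assms show ?thesis by (simp add: L2_def)
qed

lemma L2_norm_cong_AE:
  assumes [measurable]: "f \<in> borel_measurable borel" "g \<in> borel_measurable borel"
    and "AE x in lborel. f x = g x"
  shows "L2_norm f = L2_norm g"
  unfolding L2_norm_def by (rule arg_cong[of _ _ sqrt], rule integral_cong_AE) (use assms(3) in auto)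

lemma L2_norm_nonneg [simp]: "0 \<le> L2_norm f"
  by (simp add: L2_norm_def)

lemma L2_norm_square: "(L2_norm f)\<^sup>2 = (LINT x|lborel. (cmod (f x))\<^sup>2)"
  by (simp add: L2_norm_def)

lemma L2_norm_cnj [simp]: "L2_norm (\<lambda>x. cnj (f x)) = L2_norm f"
  by (simp add: L2_norm_def)

lemma L2_norm_cmult: "L2_norm (\<lambda>x. c * f x) = cmod c * L2_norm f"
  by (simp add: L2_norm_def norm_mult power_mult_distrib real_sqrt_mult)

lemma L2_norm_minus_commute: "L2_norm (\<lambda>x. f x - g x) = L2_norm (\<lambda>x. g x - f x)"
  by (simp add: L2_norm_def norm_minus_commute)

lemma L2_mult_abs_integrable:
  assumes "f \<in> L2" "g \<in> L2"
  shows "integrable lborel (\<lambda>x. cmod (f x) * cmod (g x))"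
proof (rule Bochner_Integration.integrable_bound)
  note [measurable] = L2_measurable[OF assms(1)] L2_measurable[OF assms(2)]
  show "integrable lborel (\<lambda>x. (cmod (f x))\<^sup>2 + (cmod (g x))\<^sup>2)"
    using assms[THEN L2_integrable_square] by auto
  show "(\<lambda>x. cmod (f x) * cmod (g x)) \<in> borel_measurable lborel" by measurable
  show "AE x in lborel. norm (cmod (f x) * cmod (g x)) \<le> norm ((cmod (f x))\<^sup>2 + (cmod (g x))\<^sup>2)"
  proof (rule AE_I2)
    fix x
    have "cmod (f x) * cmod (g x) * 2 \<le> (cmod (f x))\<^sup>2 + (cmod (g x))\<^sup>2"
      using sum_squares_bound[of "cmod (f x)" "cmod (g x)"] by (simp add: mult_ac)
    moreover have "0 \<le> cmod (f x) * cmod (g x)" by simp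
    ultimately have "cmod (f x) * cmod (g x) \<le> (cmod (f x))\<^sup>2 + (cmod (g x))\<^sup>2" by linarith
    then show "norm (cmod (f x) * cmod (g x)) \<le> norm ((cmod (f x))\<^sup>2 + (cmod (g x))\<^sup>2)"
      by (simp add: abs_mult)
  qed
qed

lemma L2_mult_integrable:
  assumes "f \<in> L2" "g \<in> L2"
  shows "integrable lborel (\<lambda>x. f x * g x)"
proof (rule Bochner_Integration.integrable_bound[OF L2_mult_abs_integrable[OF assms]])
  note [measurable] = L2_measurable[OF assms(1)] L2_measurable[OF assms(2)]
  show "(\<lambda>x. f x * g x) \<in> borel_measurable lborel" by measurable
qed (auto simp: norm_mult)

lemma L2_Cauchy_Schwarz:
  assumes "f \<in> L2" "g \<in> L2"
  shows "(LINT x|lborel. cmod (f x) * cmod (g x)) \<le> L2_norm f * L2_norm g"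
proof -
  define A where "A = (LINT x|lborel. (cmod (f x))\<^sup>2)"
  define B where "B = (LINT x|lborel. cmod (f x) * cmod (g x))"
  define C where "C = (LINT x|lborel. (cmod (g x))\<^sup>2)"
  have nn: "A \<ge> 0" "B \<ge> 0" "C \<ge> 0" by (auto simp: A_def B_def C_def)
  note i = L2_mult_abs_integrable[OF assms] assms[THEN L2_integrable_square]
  \<comment> \<open>A quadratic polynomial in \<open>l\<close> that is never negative; the two cases
    below choose the \<open>l\<close> that exposes its discriminant.\<close>
  have key: "0 \<le> A - 2 * l * B + l\<^sup>2 * C" for l
  proof -
    have "0 \<le> (LINT x|lborel. (cmod (f x) - l * cmod (g x))\<^sup>2)" by simp
    also have "\<dots> = (LINT x|lborel. (cmod (f x))\<^sup>2 - (2 * l) * (cmod (f x) * cmod (g x)) + l\<^sup>2 * (cmod (g x))\<^sup>2)"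
      by (rule Bochner_Integration.integral_cong) (auto simp: power2_eq_square algebra_simps)
    also have "\<dots> = A - 2 * l * B + l\<^sup>2 * C"
      using i by (simp add: A_def B_def C_def)
    finally show ?thesis .
  qed
  have "B\<^sup>2 \<le> A * C"
  proof (cases "C = 0")
    case True
    have "B = 0"
    proof (rule ccontr)
      assume "B \<noteq> 0"
      with nn have "B > 0" by simp
      \<comment> \<open>For C = 0 the polynomial is linear in \<open>l\<close>, and this choice
        gives it the value -1.\<close>
      from key[of "(A + 1) / (2 * B)"] True \<open>B > 0\<close> show False by simp
    qed
    with nn show ?thesis by simp
  next
    case False
    with nn have "C > 0" by simp
    \<comment> \<open>The minimiser of the quadratic.\<close>
    from key[of "B / C"] \<open>C > 0\<close> show ?thesis
      by (simp add: power2_eq_square field_simps)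
  qed
  then have "B \<le> sqrt (A * C)" by (rule real_le_rsqrt)
  then show ?thesis by (simp add: A_def B_def C_def L2_norm_def real_sqrt_mult)
qed

lemma L2_integral_mult_le:
  assumes "f \<in> L2" "g \<in> L2"
  shows "cmod (LINT x|lborel. f x * g x) \<le> L2_norm f * L2_norm g"
proof -
  have "cmod (LINT x|lborel. f x * g x) \<le> (LINT x|lborel. cmod (f x * g x))"
    by (rule integral_norm_bound)
  also have "\<dots> \<le> L2_norm f * L2_norm g"
    using L2_Cauchy_Schwarz[OF assms] by (simp add: norm_mult)
  finally show ?thesis .
qed

lemma L2_norm_triangle:
  assumes "f \<in> L2" "g \<in> L2"
  shows "L2_norm (\<lambda>x. f x + g x) \<le> L2_norm f + L2_norm g"
proof -
  note i = L2_mult_abs_integrable[OF assms] assms[THEN L2_integrable_square]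
  have "(L2_norm (\<lambda>x. f x + g x))\<^sup>2 = (LINT x|lborel. (cmod (f x + g x))\<^sup>2)"
    by (rule L2_norm_square)
  also have "\<dots> \<le> (LINT x|lborel. (cmod (f x))\<^sup>2 + 2 * (cmod (f x) * cmod (g x)) + (cmod (g x))\<^sup>2)"
  proof (rule integral_mono)
    show "integrable lborel (\<lambda>x. (cmod (f x + g x))\<^sup>2)"
      using L2_add[OF assms] by (rule L2_integrable_square)
    show "integrable lborel (\<lambda>x. (cmod (f x))\<^sup>2 + 2 * (cmod (f x) * cmod (g x)) + (cmod (g x))\<^sup>2)"
      using i by auto
    fix x
    have "(cmod (f x + g x))\<^sup>2 \<le> (cmod (f x) + cmod (g x))\<^sup>2"
      by (intro power_mono norm_triangle_ineq) auto
    also have "\<dots> = (cmod (f x))\<^sup>2 + 2 * (cmod (f x) * cmod (g x)) + (cmod (g x))\<^sup>2"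
      by (simp add: power2_eq_square algebra_simps)
    finally show "(cmod (f x + g x))\<^sup>2 \<le> \<dots>" .
  qed
  also have "\<dots> = (L2_norm f)\<^sup>2 + 2 * (LINT x|lborel. cmod (f x) * cmod (g x)) + (L2_norm g)\<^sup>2"
    using i by (simp add: L2_norm_square)
  also have "\<dots> \<le> (L2_norm f + L2_norm g)\<^sup>2"
    using L2_Cauchy_Schwarz[OF assms] by (simp add: power2_sum)
  finally show ?thesis by (rule power2_le_imp_le) simp
qed

lemma L2_norm_diff_le:
  assumes "f \<in> L2" "g \<in> L2"
  shows "\<bar>L2_norm f - L2_norm g\<bar> \<le> L2_norm (\<lambda>x. f x - g x)"
  using L2_norm_triangle[OF L2_diff[OF assms] assms(2)]
    L2_norm_triangle[OF L2_diff[OF assms(2,1)] assms(1)] L2_norm_minus_commute[of f g]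
  by simp

lemma L2_norm_bounded_mult:
  assumes "f \<in> L2" and [measurable]: "g \<in> borel_measurable borel" and "\<And>x. cmod (g x) \<le> K"
  shows "L2_norm (\<lambda>x. g x * f x) \<le> K * L2_norm f"
proof -
  have K: "K \<ge> 0" using assms(3)[of 0] norm_ge_zero order_trans by blast
  have "(LINT x|lborel. (cmod (g x * f x))\<^sup>2) \<le> (LINT x|lborel. K\<^sup>2 * (cmod (f x))\<^sup>2)"
  proof (rule integral_mono)
    show "integrable lborel (\<lambda>x. (cmod (g x * f x))\<^sup>2)"
      using L2_bounded_mult[OF assms] by (rule L2_integrable_square)
    show "integrable lborel (\<lambda>x. K\<^sup>2 * (cmod (f x))\<^sup>2)"
      using assms(1)[THEN L2_integrable_square] by auto
    show "(cmod (g x * f x))\<^sup>2 \<le> K\<^sup>2 * (cmod (f x))\<^sup>2" for x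
      by (simp add: norm_mult power_mult_distrib) (intro mult_right_mono power_mono assms, auto)
  qed
  also have "\<dots> = (K * L2_norm f)\<^sup>2"
    by (simp add: power_mult_distrib L2_norm_square)
  finally have "(L2_norm (\<lambda>x. g x * f x))\<^sup>2 \<le> (K * L2_norm f)\<^sup>2" by (simp add: L2_norm_square)
  then show ?thesis by (rule power2_le_imp_le) (use K in simp)
qed

lemma L2_norm_zero_tendsto:
  assumes "((\<lambda>s. L2_norm (\<lambda>x. f s x - g x)) \<longlongrightarrow> 0) F" "\<forall>\<^sub>F s in F. f s \<in> L2" "g \<in> L2"
  shows "((\<lambda>s. L2_norm (f s)) \<longlongrightarrow> L2_norm g) F"
proof (rule Lim_transform2[OF tendsto_const], rule Lim_null_comparison[OF _ assms(1)])
  show "\<forall>\<^sub>F s in F. norm (L2_norm g - L2_norm (f s)) \<le> L2_norm (\<lambda>x. f s x - g x)"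
    using assms(2) by eventually_elim (use L2_norm_diff_le[OF assms(3)] in \<open>simp add: L2_norm_minus_commute[of g]\<close>)
qed

text \<open>Both factors may move. The difference of the products splits into (f s - f0) g s and f0
  (g s - g0), and the norms of \<open>g s\<close> stay bounded because they converge.\<close>

lemma L2_tendsto_integral_mult:
  assumes f: "((\<lambda>s. L2_norm (\<lambda>x. f s x - f0 x)) \<longlongrightarrow> 0) F" "\<forall>\<^sub>F s in F. f s \<in> L2" "f0 \<in> L2"
    and g: "((\<lambda>s. L2_norm (\<lambda>x. g s x - g0 x)) \<longlongrightarrow> 0) F" "\<forall>\<^sub>F s in F. g s \<in> L2" "g0 \<in> L2"
  shows "((\<lambda>s. LINT x|lborel. f s x * g s x) \<longlongrightarrow> (LINT x|lborel. f0 x * g0 x)) F"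
proof (rule LIM_zero_cancel, rule Lim_null_comparison)
  show "((\<lambda>s. L2_norm (\<lambda>x. f s x - f0 x) * L2_norm (g s) + L2_norm f0 * L2_norm (\<lambda>x. g s x - g0 x)) \<longlongrightarrow> 0) F"
    using tendsto_add[OF tendsto_mult[OF f(1) L2_norm_zero_tendsto[OF g]] tendsto_mult[OF tendsto_const g(1)]]
    by simp
  show "\<forall>\<^sub>F s in F. norm ((LINT x|lborel. f s x * g s x) - (LINT x|lborel. f0 x * g0 x))
     \<le> L2_norm (\<lambda>x. f s x - f0 x) * L2_norm (g s) + L2_norm f0 * L2_norm (\<lambda>x. g s x - g0 x)"
    using f(2) g(2)
  proof eventually_elim
    case (elim s)
    have "(LINT x|lborel. f s x * g s x) - (LINT x|lborel. f0 x * g0 x) =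
      (LINT x|lborel. f s x * g s x - f0 x * g0 x)"
      by (simp add: L2_mult_integrable f g elim)
    also have "\<dots> = (LINT x|lborel. (f s x - f0 x) * g s x + f0 x * (g s x - g0 x))"
      by (simp add: algebra_simps)
    also have "\<dots> = (LINT x|lborel. (f s x - f0 x) * g s x) + (LINT x|lborel. f0 x * (g s x - g0 x))"
      by (intro Bochner_Integration.integral_add L2_mult_integrable L2_diff f g elim)
    finally show ?case
      using norm_triangle_ineq[of "(LINT x|lborel. (f s x - f0 x) * g s x)" "(LINT x|lborel. f0 x * (g s x - g0 x))"]
        L2_integral_mult_le[OF L2_diff[OF elim(1) f(3)] elim(2)]
        L2_integral_mult_le[OF f(3) L2_diff[OF elim(2) g(3)]]
      by simp
  qed
qed

section \<open>Test functions\<close>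

text \<open>The recursion strips the innermost derivative, so closure properties follow by induction
  on \<open>k\<close> with the function generalised; \<open>times_differentiable_iff\<close> returns
  to the iterates used in \<open>test_function\<close>.\<close>

primrec times_differentiable :: "nat \<Rightarrow> (real \<Rightarrow> real) \<Rightarrow> bool" where
  "times_differentiable 0 f \<longleftrightarrow> (\<forall>x. f differentiable at x)"
| "times_differentiable (Suc k) f \<longleftrightarrow> (\<forall>x. f differentiable at x) \<and> times_differentiable k (deriv f)"

lemma times_differentiable_iff:
  "times_differentiable k f \<longleftrightarrow> (\<forall>j\<le>k. \<forall>x. (deriv ^^ j) f differentiable at x)"
proof (induction k arbitrary: f)
  case (Suc k)
  have *: "(\<forall>j\<le>Suc k. P j) \<longleftrightarrow> P 0 \<and> (\<forall>j\<le>k. P (Suc j))" for P :: "nat \<Rightarrow> bool"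
    by (metis Suc_le_mono le0 not0_implies_Suc)
  have "(\<forall>j\<le>Suc k. \<forall>x. (deriv ^^ j) f differentiable at x) \<longleftrightarrow>
    (\<forall>x. f differentiable at x) \<and> (\<forall>j\<le>k. \<forall>x. (deriv ^^ Suc j) f differentiable at x)"
    by (subst *) simp
  then show ?case using Suc.IH[of "deriv f"] by (simp add: funpow_swap1)
qed auto

lemma test_function_iff:
  "test_function \<phi> \<longleftrightarrow> (\<forall>k. times_differentiable k \<phi>) \<and> bounded {x. \<phi> x \<noteq> 0}"
  unfolding test_function_def times_differentiable_iff by auto

lemma times_differentiableD: "times_differentiable k f \<Longrightarrow> f differentiable at x"
  by (cases k) auto

lemma times_differentiable_pred: "times_differentiable (Suc k) f \<Longrightarrow> times_differentiable k f"
  by (auto simp: times_differentiable_iff)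

lemma times_differentiable_cong_deriv:
  assumes "\<And>x. (f has_real_derivative g x) (at x)" "times_differentiable k g"
  shows "times_differentiable (Suc k) f"
proof -
  have "deriv f = g" using assms(1) by (auto intro: DERIV_imp_deriv)
  moreover have "f differentiable at x" for x
    using assms(1) real_differentiable_def by blast
  ultimately show ?thesis using assms(2) by auto
qed

lemma times_differentiable_DERIV:
  "times_differentiable k f \<Longrightarrow> (f has_real_derivative deriv f x) (at x)"
  by (metis times_differentiableD real_differentiable_def DERIV_imp_deriv)

lemma times_differentiable_add:
  "times_differentiable k f \<Longrightarrow> times_differentiable k g \<Longrightarrow> times_differentiable k (\<lambda>x. f x + g x)"
proof (induction k arbitrary: f g)
  case (Suc k)
  have "((\<lambda>x. f x + g x) has_real_derivative deriv f x + deriv g x) (at x)" for x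
    by (intro DERIV_add times_differentiable_DERIV[OF Suc.prems(1)] times_differentiable_DERIV[OF Suc.prems(2)])
  then show ?case
    by (rule times_differentiable_cong_deriv) (use Suc in simp)
qed (auto intro: differentiable_add)

lemma times_differentiable_mult:
  "times_differentiable k f \<Longrightarrow> times_differentiable k g \<Longrightarrow> times_differentiable k (\<lambda>x. f x * g x)"
proof (induction k arbitrary: f g)
  case (Suc k)
  have "((\<lambda>x. f x * g x) has_real_derivative deriv f x * g x + deriv g x * f x) (at x)" for x
    by (intro DERIV_mult times_differentiable_DERIV[OF Suc.prems(1)] times_differentiable_DERIV[OF Suc.prems(2)])
  then show ?case
  proof (rule times_differentiable_cong_deriv)
    show "times_differentiable k (\<lambda>x. deriv f x * g x + deriv g x * f x)"
      using Suc.prems times_differentiable_pred[OF Suc.prems(1)] times_differentiable_pred[OF Suc.prems(2)]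
      by (intro times_differentiable_add Suc.IH) simp_all
  qed
qed (auto intro: differentiable_mult)

lemma times_differentiable_const: "times_differentiable k (\<lambda>x. c)"
proof (induction k arbitrary: c)
  case (Suc k)
  show ?case by (rule times_differentiable_cong_deriv[where g="\<lambda>x. 0"]) (auto intro: Suc)
qed auto

lemma times_differentiable_affine:
  "times_differentiable k f \<Longrightarrow> times_differentiable k (\<lambda>x. f (a * x + b))"
proof (induction k arbitrary: f)
  case 0
  have "((\<lambda>x. f (a * x + b)) has_real_derivative deriv f (a * x + b) * a) (at x)" for x
    by (rule DERIV_chain2[where f=f, OF times_differentiable_DERIV[OF 0]]) (auto intro!: derivative_eq_intros)
  then show ?case using real_differentiable_def by (metis times_differentiable.simps(1))
next
  case (Suc k)
  have "((\<lambda>x. f (a * x + b)) has_real_derivative deriv f (a * x + b) * a) (at x)" for x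
    by (rule DERIV_chain2[where f=f, OF times_differentiable_DERIV[OF Suc.prems]]) (auto intro!: derivative_eq_intros)
  then show ?case
    by (rule times_differentiable_cong_deriv)
       (use Suc in \<open>auto intro!: times_differentiable_mult times_differentiable_const\<close>)
qed

section \<open>Smooth bump functions built from exp (-1/x)\<close>

lemma poly_times_exp_minus_tendsto_0:
  fixes p :: "real poly"
  shows "((\<lambda>y. poly p y * exp (- y)) \<longlongrightarrow> 0) at_top"
proof -
  have "((\<lambda>y. \<Sum>i\<le>degree p. coeff p i * (y ^ i / exp y)) \<longlongrightarrow> (\<Sum>i\<le>degree p. coeff p i * 0)) at_top"
    by (intro tendsto_sum tendsto_mult tendsto_const tendsto_power_div_exp_0)
  then show ?thesis
    by (simp add: poly_altdef exp_minus field_simps sum_divide_distrib)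
qed

text \<open>This family of functions is closed under differentiation, which gives smoothness at $0$.\<close>

definition flat_poly :: "real poly \<Rightarrow> real \<Rightarrow> real" where
  "flat_poly p x = (if 0 < x then poly p (1 / x) * exp (- (1 / x)) else 0)"

text \<open>With y = 1/x one has dy/dx = - y^2, so p(y) exp (-y) differentiates to y^2 (p - p')(y)
  exp (-y); the factor \<open>[:0, 0, 1:]\<close> is y^2.\<close>

lemma flat_poly_DERIV:
  "(flat_poly p has_real_derivative flat_poly ([:0, 0, 1:] * (p - pderiv p)) x) (at x)"
proof (cases "x = 0")
  case False
  have ev: "\<forall>\<^sub>F y in nhds x. y \<in> (if 0 < x then {0<..} else {..<0})"
    using False by (intro eventually_nhds_in_open) auto
  show ?thesis
  proof (cases "0 < x")
    case True
    have inv: "((\<lambda>x. 1 / x) has_real_derivative - (1 / x)\<^sup>2) (at x)"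
      using True by (auto intro!: derivative_eq_intros simp: power2_eq_square)
    have "((\<lambda>x. poly p (1 / x)) has_real_derivative poly (pderiv p) (1 / x) * - (1 / x)\<^sup>2) (at x)"
      by (rule DERIV_chain2[OF poly_DERIV inv])
    moreover have "((\<lambda>x. exp (- (1 / x))) has_real_derivative exp (- (1 / x)) * - (- (1 / x)\<^sup>2)) (at x)"
      by (rule DERIV_fun_exp[OF DERIV_minus[OF inv]])
    ultimately have "((\<lambda>x. poly p (1 / x) * exp (- (1 / x))) has_real_derivative
       poly (pderiv p) (1 / x) * - (1 / x)\<^sup>2 * exp (- (1 / x)) +
       exp (- (1 / x)) * - (- (1 / x)\<^sup>2) * poly p (1 / x)) (at x)"
      by (rule DERIV_mult)
    moreover have "poly (pderiv p) (1 / x) * - (1 / x)\<^sup>2 * exp (- (1 / x)) +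
       exp (- (1 / x)) * - (- (1 / x)\<^sup>2) * poly p (1 / x) =
       flat_poly ([:0, 0, 1:] * (p - pderiv p)) x"
      using True by (simp add: flat_poly_def algebra_simps power2_eq_square)
    ultimately have "((\<lambda>x. poly p (1 / x) * exp (- (1 / x))) has_real_derivative
       flat_poly ([:0, 0, 1:] * (p - pderiv p)) x) (at x)"
      by simp
    moreover have "\<forall>\<^sub>F y in nhds x. flat_poly p y = poly p (1 / y) * exp (- (1 / y))"
      using ev True by (auto elim!: eventually_mono simp: flat_poly_def)
    ultimately show ?thesis by (subst DERIV_cong_ev[OF refl _ refl]) auto
  next
    case F: False
    have "\<forall>\<^sub>F y in nhds x. flat_poly p y = 0"
      using ev F by (auto elim!: eventually_mono simp: flat_poly_def)
    moreover have "((\<lambda>y. 0) has_real_derivative flat_poly ([:0, 0, 1:] * (p - pderiv p)) x) (at x)"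
      using F by (simp add: flat_poly_def)
    ultimately show ?thesis by (subst DERIV_cong_ev[OF refl _ refl]) auto
  qed
next
  case True
  have "((\<lambda>h. (flat_poly p (0 + h) - flat_poly p 0) / h) \<longlongrightarrow> 0) (at 0)"
    unfolding filterlim_at_split
  proof
    show "((\<lambda>h. (flat_poly p (0 + h) - flat_poly p 0) / h) \<longlongrightarrow> 0) (at_left 0)"
      by (rule tendsto_eventually) (auto simp: eventually_at_left_field flat_poly_def intro!: exI[of _ "-1"])
    \<comment> \<open>Dividing p(1/h) exp (-1/h) by h multiplies the polynomial by its variable,
      which is \<open>pCons 0 p\<close>; exponential decay beats it.\<close>
    have "((\<lambda>h::real. poly (pCons 0 p) (inverse h) * exp (- inverse h)) \<longlongrightarrow> 0) (at_right 0)"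
      by (rule filterlim_compose[OF poly_times_exp_minus_tendsto_0 filterlim_inverse_at_top_right])
    then show "((\<lambda>h. (flat_poly p (0 + h) - flat_poly p 0) / h) \<longlongrightarrow> 0) (at_right 0)"
      by (rule Lim_transform_eventually)
         (auto simp: eventually_at_right_field flat_poly_def field_simps intro!: exI[of _ 1])
  qed
  then show ?thesis unfolding True DERIV_def by (simp add: flat_poly_def)
qed

lemma times_differentiable_flat_poly: "times_differentiable k (flat_poly p)"
proof (induction k arbitrary: p)
  case 0
  show ?case using flat_poly_DERIV real_differentiable_def by (metis times_differentiable.simps(1))
next
  case (Suc k)
  show ?case by (rule times_differentiable_cong_deriv[OF flat_poly_DERIV Suc])
qed

text \<open>As $n$ grows these converge boundedly to the indicator of $(a, b)$.\<close>

definition bump :: "real \<Rightarrow> real \<Rightarrow> nat \<Rightarrow> real \<Rightarrow> real" where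
  "bump a b n x = flat_poly 1 (real n * (x - a)) * flat_poly 1 (real n * (b - x))"

lemma bump_outside: "x \<notin> {a<..<b} \<Longrightarrow> bump a b n x = 0"
  by (auto simp: bump_def flat_poly_def zero_less_mult_iff)

lemma test_function_bump: "test_function (bump a b n)"
  unfolding test_function_iff
proof (intro conjI allI)
  show "times_differentiable k (bump a b n)" for k
  proof -
    have "times_differentiable k (\<lambda>x. flat_poly 1 (real n * x + - (real n * a)) * flat_poly 1 (- real n * x + real n * b))"
      by (intro times_differentiable_mult times_differentiable_affine times_differentiable_flat_poly)
    moreover have "(\<lambda>x. flat_poly 1 (real n * x + - (real n * a)) * flat_poly 1 (- real n * x + real n * b)) = bump a b n"
      by (simp add: bump_def fun_eq_iff right_diff_distrib add.commute)
    ultimately show ?thesis by simp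
  qed
  show "bounded {x. bump a b n x \<noteq> 0}"
  proof (rule bounded_subset[OF bounded_closed_interval[of a b]], rule subsetI)
    fix x assume "x \<in> {x. bump a b n x \<noteq> 0}"
    then have "x \<in> {a<..<b}" using bump_outside[of x a b n] by blast
    then show "x \<in> {a..b}" by simp
  qed
qed

lemma flat_poly_1_bounds: "0 \<le> flat_poly 1 x" "flat_poly 1 x \<le> 1"
  by (auto simp: flat_poly_def)

lemma bump_bounds: "0 \<le> bump a b n x" "bump a b n x \<le> 1"
  unfolding bump_def using flat_poly_1_bounds by (auto intro!: mult_nonneg_nonneg mult_le_one)

lemma flat_poly_1_scaled_tendsto: "0 < x \<Longrightarrow> (\<lambda>n. flat_poly 1 (real n * x)) \<longlonglongrightarrow> 1"
proof -
  assume x: "0 < x"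
  have "filterlim (\<lambda>n. real n * x) at_top sequentially"
    using filterlim_tendsto_pos_mult_at_top[OF tendsto_const x filterlim_real_sequentially]
    by (simp add: mult.commute)
  then have "(\<lambda>n. exp (- inverse (real n * x))) \<longlonglongrightarrow> exp (- 0)"
    by (intro tendsto_intros tendsto_inverse_0_at_top)
  moreover have "\<forall>\<^sub>F n in sequentially. exp (- inverse (real n * x)) = flat_poly 1 (real n * x)"
    using eventually_gt_at_top[of 0] by eventually_elim (use x in \<open>simp add: flat_poly_def inverse_eq_divide\<close>)
  ultimately show ?thesis using Lim_transform_eventually by fastforce
qed

lemma bump_tendsto: "(\<lambda>n. bump a b n x) \<longlonglongrightarrow> indicator {a<..<b} x"
proof (cases "x \<in> {a<..<b}")
  case True
  then show ?thesis
    using tendsto_mult[OF flat_poly_1_scaled_tendsto[of "x - a"] flat_poly_1_scaled_tendsto[of "b - x"]]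
    by (simp add: bump_def)
qed (simp add: bump_outside)

lemma test_function_continuous: "test_function \<phi> \<Longrightarrow> continuous_on UNIV \<phi>"
  unfolding test_function_iff
  by (intro continuous_at_imp_continuous_on ballI differentiable_imp_continuous_within) (auto dest: times_differentiableD)

lemma test_function_measurable [measurable_dest]: "test_function \<phi> \<Longrightarrow> \<phi> \<in> borel_measurable borel"
  by (intro borel_measurable_continuous_onI test_function_continuous)

lemma test_function_DERIV: "test_function \<phi> \<Longrightarrow> (\<phi> has_real_derivative deriv \<phi> x) (at x)"
  unfolding test_function_iff using times_differentiable_DERIV by blast

lemma test_function_support:
  assumes "test_function \<phi>"
  obtains R where "0 < R" "\<And>x. R \<le> \<bar>x\<bar> \<Longrightarrow> \<phi> x = 0"
proof -
  obtain B where B: "\<And>x. \<phi> x \<noteq> 0 \<Longrightarrow> \<bar>x\<bar> \<le> B"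
    using assms unfolding test_function_def bounded_iff by auto
  show ?thesis
  proof (rule that[of "\<bar>B\<bar> + 1"])
    show "\<phi> x = 0" if "\<bar>B\<bar> + 1 \<le> \<bar>x\<bar>" for x
      using B[of x] that by linarith
  qed simp
qed

lemma test_function_deriv:
  assumes "test_function \<phi>" shows "test_function (deriv \<phi>)"
  unfolding test_function_iff
proof
  show "\<forall>k. times_differentiable k (deriv \<phi>)"
    using assms unfolding test_function_iff by (metis times_differentiable.simps(2))
  obtain R where R: "0 < R" "\<And>x. R \<le> \<bar>x\<bar> \<Longrightarrow> \<phi> x = 0"
    using test_function_support[OF assms] by metis
  have "deriv \<phi> x = 0" if "R < \<bar>x\<bar>" for x
  proof -
    have "open {x::real. R < \<bar>x\<bar>}" by (intro open_Collect_less continuous_intros)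
    then have "\<forall>\<^sub>F y in nhds x. y \<in> {x. R < \<bar>x\<bar>}" using that by (intro eventually_nhds_in_open) auto
    then have "\<forall>\<^sub>F y in nhds x. \<phi> y = 0" by eventually_elim (simp add: R)
    then have "deriv \<phi> x = deriv (\<lambda>_. 0) x" by (rule deriv_cong_ev) simp
    then show ?thesis by simp
  qed
  then have "{x. deriv \<phi> x \<noteq> 0} \<subseteq> cball 0 R" by (auto simp: not_less[symmetric])
  then show "bounded {x. deriv \<phi> x \<noteq> 0}" by (rule bounded_subset[rotated]) simp
qed

lemma test_function_add_cmult:
  assumes "test_function \<phi>" "test_function \<psi>"
  shows "test_function (\<lambda>x. \<phi> x + c * \<psi> x)"
proof -
  have "{x. \<phi> x + c * \<psi> x \<noteq> 0} \<subseteq> {x. \<phi> x \<noteq> 0} \<union> {x. \<psi> x \<noteq> 0}" by auto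
  then have "bounded {x. \<phi> x + c * \<psi> x \<noteq> 0}"
    using assms unfolding test_function_iff by (meson bounded_Un bounded_subset)
  then show ?thesis
    using assms unfolding test_function_iff
    by (auto intro!: times_differentiable_add times_differentiable_mult times_differentiable_const)
qed

lemma test_function_integrable: assumes "test_function \<phi>" shows "integrable lborel \<phi>"
proof -
  obtain R where R: "0 < R" "\<And>x. R \<le> \<bar>x\<bar> \<Longrightarrow> \<phi> x = 0"
    using test_function_support[OF assms] by metis
  have "set_integrable lborel {-R..R} \<phi>"
    by (intro borel_integrable_atLeastAtMost' continuous_on_subset[OF test_function_continuous[OF assms]]) auto
  moreover have "(\<lambda>x. indicator {-R..R} x *\<^sub>R \<phi> x) = \<phi>"
  proof
    show "indicator {-R..R} x *\<^sub>R \<phi> x = \<phi> x" for x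
      using R(2)[of x] by (cases "x \<in> {-R..R}") auto
  qed
  ultimately show ?thesis by (simp add: set_integrable_def)
qed

text \<open>The primitive that starts at the left end of the support vanishes to the right of it
  because the mean of \<open>\<psi>\<close> is zero.\<close>

lemma test_function_primitive:
  assumes \<psi>: "test_function \<psi>" and zero: "(LINT x|lborel. \<psi> x) = 0"
  obtains \<theta> where "test_function \<theta>" "deriv \<theta> = \<psi>"
proof -
  obtain R where R: "0 < R" "\<And>x. R \<le> \<bar>x\<bar> \<Longrightarrow> \<psi> x = 0"
    using test_function_support[OF \<psi>] by metis
  obtain F where F: "\<And>x. (F has_vector_derivative \<psi> x) (at x)"
    using einterval_antiderivative[of "-\<infinity>" "\<infinity>" \<psi>] test_function_continuous[OF \<psi>]
    by (auto simp: continuous_on_eq_continuous_at)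
  then have F': "(F has_real_derivative \<psi> x) (at x)" for x
    by (simp add: has_real_derivative_iff_has_vector_derivative)
  define \<theta> where "\<theta> x = F x - F (-R)" for x
  have d: "(\<theta> has_real_derivative \<psi> x) (at x)" for x
    unfolding \<theta>_def[abs_def] using F' by (auto intro!: derivative_eq_intros)
  have FTC: "(LINT x|lborel. indicator {a..b} x *\<^sub>R \<psi> x) = F b - F a" if "a \<le> b" for a b
    by (rule integral_FTC_atLeastAtMost[OF that])
       (auto intro: has_vector_derivative_at_within F continuous_on_subset[OF test_function_continuous[OF \<psi>]])
  have "(LINT x|lborel. indicator {-R..R} x *\<^sub>R \<psi> x) = (LINT x|lborel. \<psi> x)"
  proof (rule Bochner_Integration.integral_cong[OF refl])
    show "indicator {-R..R} x *\<^sub>R \<psi> x = \<psi> x" for x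
      using R(2)[of x] by (cases "x \<in> {-R..R}") auto
  qed
  then have FR: "F R = F (-R)" using FTC[of "-R" R] R(1) zero by simp
  have out: "\<theta> x = 0" if "R < \<bar>x\<bar>" for x
  proof (cases "x > 0")
    case True
    then have "F x - F R = (LINT y|lborel. indicator {R..x} y *\<^sub>R \<psi> y)"
      using that by (intro FTC[symmetric]) auto
    also have "\<dots> = (LINT y::real|lborel. (0::real))"
      by (rule Bochner_Integration.integral_cong) (use R in \<open>auto simp: indicator_def\<close>)
    finally show ?thesis using FR by (simp add: \<theta>_def)
  next
    case False
    then have "F (-R) - F x = (LINT y|lborel. indicator {x..-R} y *\<^sub>R \<psi> y)"
      using that by (intro FTC[symmetric]) auto
    also have "\<dots> = (LINT y::real|lborel. (0::real))"
      by (rule Bochner_Integration.integral_cong) (use R in \<open>auto simp: indicator_def\<close>)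
    finally show ?thesis by (simp add: \<theta>_def)
  qed
  have "deriv \<theta> = \<psi>" using d by (auto intro: DERIV_imp_deriv)
  moreover have "test_function \<theta>" unfolding test_function_iff
  proof
    show "\<forall>k. times_differentiable k \<theta>"
    proof
      fix k
      have "times_differentiable (Suc k) \<theta>"
        using \<psi> by (intro times_differentiable_cong_deriv[OF d]) (simp add: test_function_iff)
      then show "times_differentiable k \<theta>" by (rule times_differentiable_pred)
    qed
    have "{x. \<theta> x \<noteq> 0} \<subseteq> cball 0 R" using out by (auto simp: not_less[symmetric])
    then show "bounded {x. \<theta> x \<noteq> 0}" by (rule bounded_subset[rotated]) simp
  qed
  ultimately show ?thesis using that by blast
qed

section \<open>Locally integrable functions\<close>

lemma locally_integrableD: "locally_integrable f \<Longrightarrow> set_integrable lborel {a..b} f"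
  by (simp add: locally_integrable_def)

text \<open>Measurability is inherited from the truncations to [-i, i], which are integrable and
  converge pointwise.\<close>

lemma locally_integrable_measurable [measurable_dest]:
  assumes "locally_integrable f" shows "f \<in> borel_measurable borel"
proof (rule borel_measurable_LIMSEQ_metric)
  fix i :: nat
  show "(\<lambda>x. indicator {-real i..real i} x *\<^sub>R f x) \<in> borel_measurable borel"
    using borel_measurable_integrable[OF locally_integrableD[OF assms, unfolded set_integrable_def]]
    by simp
next
  fix x :: real
  have "\<forall>\<^sub>F i in sequentially. f x = indicator {-real i..real i} x *\<^sub>R f x"
    using eventually_ge_at_top[of "nat \<lceil>\<bar>x\<bar>\<rceil>"] by eventually_elim (auto simp: nat_le_iff ceiling_le_iff abs_le_iff)
  then show "(\<lambda>i. indicator {-real i..real i} x *\<^sub>R f x) \<longlonglongrightarrow> f x"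
    by (rule Lim_transform_eventually[OF tendsto_const])
qed

lemma indicator_in_L2: "(\<lambda>x. indicator {a..b} x :: complex) \<in> L2"
proof (rule L2I_bound[where b="indicator {a..b}"])
  show "integrable lborel (indicat_real {a..b})"
    using emeasure_bounded_finite[of "{a..b}"] by (simp add: integrable_indicator_iff less_top)
  show "(cmod (indicator {a..b} x))\<^sup>2 \<le> indicat_real {a..b} x" for x
    by (auto simp: indicator_def)
qed simp

lemma L2_locally_integrable: assumes "f \<in> L2" shows "locally_integrable f"
  unfolding locally_integrable_def set_integrable_def
proof (intro allI)
  fix a b :: real
  have "integrable lborel (\<lambda>x. indicator {a..b} x * f x)"
    by (rule L2_mult_integrable[OF indicator_in_L2 assms])
  moreover have "(\<lambda>x. indicator {a..b} x * f x) = (\<lambda>x. indicator {a..b} x *\<^sub>R f x)"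
    by (auto simp: indicator_def)
  ultimately show "integrable lborel (\<lambda>x. indicator {a..b} x *\<^sub>R f x)" by simp
qed

lemma locally_integrable_add:
  "locally_integrable f \<Longrightarrow> locally_integrable g \<Longrightarrow> locally_integrable (\<lambda>x. f x + g x)"
  by (simp add: locally_integrable_def set_integral_add)

lemma locally_integrable_continuous_mult:
  assumes f: "locally_integrable f" and g: "continuous_on UNIV g"
  shows "locally_integrable (\<lambda>x. g x * f x)"
  unfolding locally_integrable_def set_integrable_def
proof (intro allI)
  fix a b :: real
  note [measurable] = locally_integrable_measurable[OF f] borel_measurable_continuous_onI[OF g]
  have "bounded (g ` {a..b})"
    by (intro compact_imp_bounded compact_continuous_image continuous_on_subset[OF g]) auto
  then obtain K where K: "\<forall>x\<in>{a..b}. cmod (g x) \<le> K"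
    unfolding bounded_iff by (metis image_eqI)
  show "integrable lborel (\<lambda>x. indicator {a..b} x *\<^sub>R (g x * f x))"
  proof (rule Bochner_Integration.integrable_bound)
    show "integrable lborel (\<lambda>x. K *\<^sub>R (indicator {a..b} x *\<^sub>R f x))"
      using locally_integrableD[OF f, of a b] unfolding set_integrable_def by (rule integrable_scaleR_right)
    show "AE x in lborel. norm (indicator {a..b} x *\<^sub>R (g x * f x)) \<le> norm (K *\<^sub>R (indicator {a..b} x *\<^sub>R f x))"
    proof (rule AE_I2)
      fix x
      show "norm (indicator {a..b} x *\<^sub>R (g x * f x)) \<le> norm (K *\<^sub>R (indicator {a..b} x *\<^sub>R f x))"
      proof (cases "x \<in> {a..b}")
        case True
        then have "cmod (g x) \<le> \<bar>K\<bar>" using K by fastforce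
        then show ?thesis using True by (simp add: norm_mult mult_right_mono)
      qed simp
    qed
  qed measurable
qed

lemma locally_integrable_continuous: "continuous_on UNIV f \<Longrightarrow> locally_integrable f"
  unfolding locally_integrable_def by (meson borel_integrable_atLeastAtMost' continuous_on_subset top_greatest)

lemma locally_integrable_cmult: "locally_integrable f \<Longrightarrow> locally_integrable (\<lambda>x. c * f x)"
  by (rule locally_integrable_continuous_mult) auto

lemma locally_integrable_diff:
  "locally_integrable f \<Longrightarrow> locally_integrable g \<Longrightarrow> locally_integrable (\<lambda>x. f x - g x)"
  by (simp add: locally_integrable_def set_integral_diff)

lemma locally_integrable_cnj:
  assumes "locally_integrable f" shows "locally_integrable (\<lambda>x. cnj (f x))"
  unfolding locally_integrable_def set_integrable_def
proof (intro allI)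
  fix a b :: real
  have "integrable lborel (\<lambda>x. indicator {a..b} x *\<^sub>R f x)"
    using locally_integrableD[OF assms, of a b] unfolding set_integrable_def .
  then have "integrable lborel (\<lambda>x. cnj (indicator {a..b} x *\<^sub>R f x))"
    by (rule integrable_bounded_linear[OF bounded_linear_cnj])
  then show "integrable lborel (\<lambda>x. indicator {a..b} x *\<^sub>R cnj (f x))" by simp
qed

lemma locally_integrable_cong_AE:
  assumes "locally_integrable f" and [measurable]: "g \<in> borel_measurable borel" and "AE x in lborel. f x = g x"
  shows "locally_integrable g"
  unfolding locally_integrable_def
proof (intro allI)
  fix a b
  note [measurable] = locally_integrable_measurable[OF assms(1)]
  have "set_integrable lborel {a..b} f = set_integrable lborel {a..b} g"
    unfolding set_integrable_def by (rule integrable_cong_AE) (use assms(3) in auto)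
  then show "set_integrable lborel {a..b} g" using locally_integrableD[OF assms(1)] by simp
qed

lemma locally_integrable_test_function:
  assumes f: "locally_integrable f" and \<phi>: "test_function \<phi>"
  shows "integrable lborel (\<lambda>x. f x * of_real (\<phi> x))"
proof -
  obtain R where R: "0 < R" "\<And>x. R \<le> \<bar>x\<bar> \<Longrightarrow> \<phi> x = 0"
    using test_function_support[OF \<phi>] by metis
  have "continuous_on UNIV (\<lambda>x. complex_of_real (\<phi> x))"
    by (intro continuous_intros test_function_continuous \<phi>)
  from locally_integrableD[OF locally_integrable_continuous_mult[OF f this], of "-R" R]
  have "integrable lborel (\<lambda>x. indicator {-R..R} x *\<^sub>R (of_real (\<phi> x) * f x))"
    by (simp add: set_integrable_def)
  moreover have "(\<lambda>x. indicator {-R..R} x *\<^sub>R (of_real (\<phi> x) * f x)) = (\<lambda>x. f x * of_real (\<phi> x))"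
  proof
    show "indicator {-R..R} x *\<^sub>R (of_real (\<phi> x) * f x) = f x * of_real (\<phi> x)" for x
    proof (cases "x \<in> {-R..R}")
      case False
      then have "\<phi> x = 0" using R(2)[of x] by (auto simp: abs_if)
      then show ?thesis by simp
    qed simp
  qed
  ultimately show ?thesis by simp
qed

section \<open>Uniqueness of weak derivatives\<close>

text \<open>A Dynkin argument: boxes form an intersection-stable generator of the Borel sets, and
  the sets over which \<open>f\<close> integrates to zero are closed under complements and countable
  disjoint unions.\<close>

lemma AE_zero_if_integral_boxes_zero:
  fixes f :: "real \<Rightarrow> 'b::{banach, second_countable_topology}"
  assumes f: "integrable lborel f" and zero: "\<And>a b. (LINT x:box a b|lborel. f x) = 0"
    and supp: "\<And>x. x \<notin> box l u \<Longrightarrow> f x = 0"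
  shows "AE x in lborel. f x = 0"
proof (rule sigma_finite_measure.density_zero[OF lborel.sigma_finite_measure_axioms f])
  have int: "set_integrable lborel A f" if "A \<in> sets borel" for A
    unfolding set_integrable_def using that by (intro integrable_mult_indicator f) auto
  \<comment> \<open>The complement case needs the integral over the whole line, which is no box; the
    support hypothesis supplies it.\<close>
  have total: "(LINT x|lborel. f x) = 0"
  proof -
    have "(LINT x|lborel. f x) = (LINT x:box l u|lborel. f x)"
      unfolding set_lebesgue_integral_def
      by (rule Bochner_Integration.integral_cong) (use supp in \<open>auto simp: indicator_def\<close>)
    then show ?thesis using zero by simp
  qed
  fix A :: "real set" assume "A \<in> sets lborel"
  then have A: "A \<in> sigma_sets UNIV (range (\<lambda>(a, b). box a b))"
    using borel_eq_box[where 'a=real] by (metis sets_lborel sets_measure_of subset_UNIV Pow_UNIV)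
  have meas: "B \<in> sets borel" if "B \<in> sigma_sets UNIV (range (\<lambda>(a, b). box a b))" for B :: "real set"
    using that borel_eq_box[where 'a=real] by (metis sets_measure_of subset_UNIV Pow_UNIV)
  have "Int_stable (range (\<lambda>(a, b). box a b :: real set))" "range (\<lambda>(a, b). box a b :: real set) \<subseteq> Pow UNIV"
    by (auto simp: Int_stable_def box_Int_box)
  from this A have "(LINT x:A|lborel. f x) = 0"
  proof (induction rule: sigma_sets_induct_disjoint)
    case (basic A) then show ?case using zero by auto
  next
    case empty show ?case by (simp add: set_lebesgue_integral_def)
  next
    case (compl A)
    have "(LINT x:A \<union> (UNIV - A)|lborel. f x) = (LINT x:A|lborel. f x) + (LINT x:UNIV - A|lborel. f x)"
      by (rule set_integral_Un) (use meas[OF compl(1)] in \<open>auto intro!: int\<close>)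
    then show ?case using compl(2) total by (simp add: set_lebesgue_integral_def)
  next
    case (union A)
    have "A i \<in> sets borel" for i using union(2) by (intro meas) auto
    then have "(LINT x:(\<Union>i. A i)|lborel. f x) = (\<Sum>i. LINT x:A i|lborel. f x)"
      by (intro lebesgue_integral_countable_add int)
         (use union(1) in \<open>auto simp: disjoint_family_on_def\<close>)
    then show ?case using union(3) by simp
  qed
  then show "(LINT x:A|lborel. f x) = 0" .
qed

text \<open>Bumps converge boundedly to indicators of intervals, so \<open>f\<close> integrates to
  zero over every bounded interval.\<close>

lemma fundamental_lemma:
  assumes f: "locally_integrable f"
    and zero: "\<And>\<phi>. test_function \<phi> \<Longrightarrow> (LINT x|lborel. f x * of_real (\<phi> x)) = 0"
  shows "AE x in lborel. f x = 0"
proof -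
  note [measurable] = locally_integrable_measurable[OF f] test_function_measurable[OF test_function_bump]
  have int: "integrable lborel (\<lambda>x. indicator {a<..<b} x *\<^sub>R f x)" for a b
    using set_integrable_subset[OF locally_integrableD[OF f, of a b], of "{a<..<b}"]
    by (simp add: set_integrable_def greaterThanLessThan_subseteq_atLeastAtMost_iff)
  have box: "(LINT x|lborel. indicator {a<..<b} x *\<^sub>R f x) = 0" for a b
  proof (rule LIMSEQ_unique)
    show "(\<lambda>n. LINT x|lborel. f x * of_real (bump a b n x)) \<longlonglongrightarrow> 0"
      using zero[OF test_function_bump] by simp
    show "(\<lambda>n. LINT x|lborel. f x * of_real (bump a b n x)) \<longlonglongrightarrow> (LINT x|lborel. indicator {a<..<b} x *\<^sub>R f x)"
    proof (rule integral_dominated_convergence)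
      show "integrable lborel (\<lambda>x. norm (indicator {a<..<b} x *\<^sub>R f x))" by (intro integrable_norm int)
      show "AE x in lborel. (\<lambda>n. f x * of_real (bump a b n x)) \<longlonglongrightarrow> indicator {a<..<b} x *\<^sub>R f x"
      proof (rule AE_I2)
        fix x
        have "(\<lambda>n. f x * of_real (bump a b n x)) \<longlonglongrightarrow> f x * of_real (indicator {a<..<b} x)"
          by (intro tendsto_intros bump_tendsto)
        then show "(\<lambda>n. f x * of_real (bump a b n x)) \<longlonglongrightarrow> indicator {a<..<b} x *\<^sub>R f x"
          by (simp add: scaleR_conv_of_real mult.commute)
      qed
      show "AE x in lborel. norm (f x * of_real (bump a b n x)) \<le> norm (indicator {a<..<b} x *\<^sub>R f x)" for n
      proof (rule AE_I2)
        fix x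
        show "norm (f x * of_real (bump a b n x)) \<le> norm (indicator {a<..<b} x *\<^sub>R f x)"
          using bump_bounds[of a b n x] bump_outside[of x a b n]
          by (cases "x \<in> {a<..<b}") (auto simp: norm_mult intro: mult_left_le)
      qed
    qed measurable
  qed
  \<comment> \<open>\<open>f\<close> need not be integrable on the whole line, so it is cut to (-n,
    n) and the countably many null sets are united.\<close>
  have "AE x in lborel. indicator {-real n<..<real n} x *\<^sub>R f x = 0" for n :: nat
  proof (rule AE_zero_if_integral_boxes_zero[where l="-real n" and u="real n", OF int])
    fix a b :: real
    have "(LINT x:box a b|lborel. indicator {-real n<..<real n} x *\<^sub>R f x) =
       (LINT x|lborel. indicator {max a (-real n)<..<min b (real n)} x *\<^sub>R f x)"
      unfolding set_lebesgue_integral_def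
      by (rule Bochner_Integration.integral_cong) (auto simp: indicator_def box_real)
    then show "(LINT x:box a b|lborel. indicator {-real n<..<real n} x *\<^sub>R f x) = 0"
      using box by simp
  qed (auto simp: box_real)
  then have "AE x in lborel. \<forall>n::nat. indicator {-real n<..<real n} x *\<^sub>R f x = 0"
    unfolding AE_all_countable by blast
  then show ?thesis
  proof eventually_elim
    case (elim x)
    obtain n :: nat where "\<bar>x\<bar> < real n" using reals_Archimedean2 by blast
    then show ?case using elim[rule_format, of n] by (auto simp: indicator_def split: if_splits)
  qed
qed

lemma has_weak_deriv_unique:
  assumes "has_weak_deriv k f g" "has_weak_deriv k f h"
  shows "AE x in lborel. g x = h x"
proof -
  have gh: "locally_integrable g" "locally_integrable h"
    using assms by (auto simp: has_weak_deriv_def)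
  have "AE x in lborel. g x - h x = 0"
  proof (rule fundamental_lemma)
    show "locally_integrable (\<lambda>x. g x - h x)" by (intro locally_integrable_diff gh)
    fix \<phi> assume \<phi>: "test_function \<phi>"
    have "(-1) ^ k * (LINT x|lborel. g x * of_real (\<phi> x)) = (-1) ^ k * (LINT x|lborel. h x * of_real (\<phi> x))"
      using assms \<phi> by (simp add: has_weak_deriv_def)
    then have "(LINT x|lborel. g x * of_real (\<phi> x)) = (LINT x|lborel. h x * of_real (\<phi> x))"
      by simp
    then show "(LINT x|lborel. (g x - h x) * of_real (\<phi> x)) = 0"
      using locally_integrable_test_function[OF gh(1) \<phi>] locally_integrable_test_function[OF gh(2) \<phi>]
      by (simp add: left_diff_distrib)
  qed
  then show ?thesis by simp
qed

lemma has_weak_deriv_cong_AE: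
  assumes "has_weak_deriv k f g" "AE x in lborel. f x = f' x" "AE x in lborel. g x = g' x"
    and [measurable]: "f' \<in> borel_measurable borel" "g' \<in> borel_measurable borel"
  shows "has_weak_deriv k f' g'"
proof -
  have fg: "locally_integrable f" "locally_integrable g"
    using assms by (auto simp: has_weak_deriv_def)
  note [measurable] = fg[THEN locally_integrable_measurable]
  have "(LINT x|lborel. f x * of_real (\<phi> x)) = (LINT x|lborel. f' x * of_real (\<phi> x))"
    if "\<phi> \<in> borel_measurable borel" for \<phi>
    by (rule integral_cong_AE) (use assms(2) that in auto)
  moreover have "(LINT x|lborel. g x * of_real (\<phi> x)) = (LINT x|lborel. g' x * of_real (\<phi> x))"
    if "\<phi> \<in> borel_measurable borel" for \<phi>
    by (rule integral_cong_AE) (use assms(3) that in auto)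
  moreover have "test_function ((deriv ^^ k) \<phi>)" if "test_function \<phi>" for \<phi>
    using that by (induction k) (auto intro: test_function_deriv)
  ultimately show ?thesis
    using assms(1) locally_integrable_cong_AE[OF fg(1) assms(4,2)] locally_integrable_cong_AE[OF fg(2) assms(5,3)]
    unfolding has_weak_deriv_def by (auto dest: test_function_measurable)
qed

text \<open>This is an equality of functions and not merely almost everywhere, since both sides
  choose from the same predicate.\<close>

lemma weak_deriv_cong_AE:
  assumes "AE x in lborel. f x = f' x" "f \<in> borel_measurable borel" "f' \<in> borel_measurable borel"
  shows "weak_deriv k f = weak_deriv k f'"
proof -
  have *: "AE x in lborel. f' x = f x" using assms(1) by eventually_elim simp
  have meas: "g \<in> borel_measurable borel" if "has_weak_deriv k h g" for h g
    using that by (simp add: has_weak_deriv_def locally_integrable_measurable)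
  have "has_weak_deriv k f = has_weak_deriv k f'"
  proof (intro ext iffI)
    show "has_weak_deriv k f' g" if "has_weak_deriv k f g" for g
      by (rule has_weak_deriv_cong_AE[OF that assms(1) _ assms(3) meas[OF that]]) simp
    show "has_weak_deriv k f g" if "has_weak_deriv k f' g" for g
      by (rule has_weak_deriv_cong_AE[OF that * _ assms(2) meas[OF that]]) simp
  qed
  then show ?thesis by (simp add: weak_deriv_def)
qed

lemma has_weak_deriv_weak_deriv: "has_weak_deriv k f g \<Longrightarrow> has_weak_deriv k f (weak_deriv k f)"
  unfolding weak_deriv_def by (rule someI[of "has_weak_deriv k f"])

lemma AE_weak_deriv: "has_weak_deriv k f g \<Longrightarrow> AE x in lborel. weak_deriv k f x = g x"
  by (rule has_weak_deriv_unique[OF has_weak_deriv_weak_deriv])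

lemma has_weak_deriv_diff:
  assumes "has_weak_deriv k f g" "has_weak_deriv k f' g'"
  shows "has_weak_deriv k (\<lambda>x. f x - f' x) (\<lambda>x. g x - g' x)"
proof -
  have l: "locally_integrable f" "locally_integrable g" "locally_integrable f'" "locally_integrable g'"
    using assms by (auto simp: has_weak_deriv_def)
  have "test_function ((deriv ^^ k) \<phi>)" if "test_function \<phi>" for \<phi>
    using that by (induction k) (auto intro: test_function_deriv)
  note test = this
  show ?thesis unfolding has_weak_deriv_def
  proof (intro conjI allI impI locally_integrable_diff l)
    fix \<phi> assume \<phi>: "test_function \<phi>"
    have "(LINT x|lborel. (f x - f' x) * of_real ((deriv ^^ k) \<phi> x)) =
      (LINT x|lborel. f x * of_real ((deriv ^^ k) \<phi> x)) - (LINT x|lborel. f' x * of_real ((deriv ^^ k) \<phi> x))"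
      unfolding left_diff_distrib
      by (intro Bochner_Integration.integral_diff locally_integrable_test_function l test \<phi>)
    moreover have "(LINT x|lborel. (g x - g' x) * of_real (\<phi> x)) =
      (LINT x|lborel. g x * of_real (\<phi> x)) - (LINT x|lborel. g' x * of_real (\<phi> x))"
      unfolding left_diff_distrib
      by (intro Bochner_Integration.integral_diff locally_integrable_test_function l \<phi>)
    ultimately show "(LINT x|lborel. (f x - f' x) * of_real ((deriv ^^ k) \<phi> x)) =
      (- 1) ^ k * (LINT x|lborel. (g x - g' x) * of_real (\<phi> x))"
      using assms \<phi> by (simp add: has_weak_deriv_def right_diff_distrib)
  qed
qed

text \<open>In \<open>Sobolev\<close> each order is a separate statement about \<open>f\<close>;
  testing against \<open>deriv \<phi>\<close> links consecutive orders.\<close>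

lemma has_weak_deriv_Suc:
  assumes "has_weak_deriv k f g" "has_weak_deriv (Suc k) f h"
  shows "has_weak_deriv 1 g h"
  unfolding has_weak_deriv_def
proof (intro conjI allI impI)
  show "locally_integrable g" "locally_integrable h" using assms by (auto simp: has_weak_deriv_def)
  fix \<phi> assume \<phi>: "test_function \<phi>"
  have "(-1) ^ k * (LINT x|lborel. g x * of_real (deriv \<phi> x)) = (LINT x|lborel. f x * of_real ((deriv ^^ k) (deriv \<phi>) x))"
    using assms(1) test_function_deriv[OF \<phi>] by (simp add: has_weak_deriv_def)
  also have "\<dots> = (-1) ^ Suc k * (LINT x|lborel. h x * of_real (\<phi> x))"
    using assms(2) \<phi> by (simp add: has_weak_deriv_def funpow_swap1)
  finally have "(-1) ^ k * ((LINT x|lborel. g x * of_real (deriv \<phi> x)) + (LINT x|lborel. h x * of_real (\<phi> x))) = 0"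
    by (simp add: distrib_left)
  then show "(LINT x|lborel. g x * of_real ((deriv ^^ 1) \<phi> x)) = (- 1) ^ 1 * (LINT x|lborel. h x * of_real (\<phi> x))"
    by (simp add: add_eq_0_iff2)
qed

lemma has_weak_deriv_0: "locally_integrable f \<Longrightarrow> has_weak_deriv 0 f f"
  by (simp add: has_weak_deriv_def)

section \<open>Absolutely continuous functions\<close>

text \<open>Absolute continuity expressed through the fundamental theorem of calculus, so that no
  pointwise derivative occurs and \<open>f\<close> may be changed on null sets.\<close>

definition ac_deriv :: "(real \<Rightarrow> complex) \<Rightarrow> (real \<Rightarrow> complex) \<Rightarrow> bool" where
  "ac_deriv F f \<longleftrightarrow> locally_integrable f \<and>
     (\<forall>a b. a \<le> b \<longrightarrow> F b - F a = (LINT x:{a..b}|lborel. f x))"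

lemma ac_deriv_locally_integrable: "ac_deriv F f \<Longrightarrow> locally_integrable f"
  by (simp add: ac_deriv_def)

lemma ac_derivD: "ac_deriv F f \<Longrightarrow> a \<le> b \<Longrightarrow> F b - F a = (LINT x:{a..b}|lborel. f x)"
  by (simp add: ac_deriv_def)

lemma ac_deriv_continuous: assumes "ac_deriv F f" shows "continuous_on UNIV F"
proof -
  have *: "continuous_on {a..b} F" for a b
  proof -
    have int: "set_integrable lborel {c..d} f" for c d
      using assms by (simp add: ac_deriv_def locally_integrableD)
    have "continuous_on {a..b} (\<lambda>x. F a + integral {a..x} f)"
      by (intro continuous_intros indefinite_integral_continuous_1 set_borel_integral_eq_integral(1) int)
    then show ?thesis
    proof (rule continuous_on_eq)
      fix x assume "x \<in> {a..b}"
      then have "F x - F a = integral {a..x} f"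
        using ac_derivD[OF assms, of a x] set_borel_integral_eq_integral(2)[OF int[of a x]] by simp
      then show "F a + integral {a..x} f = F x" by (simp add: algebra_simps)
    qed
  qed
  have "isCont F x" for x
  proof -
    have "continuous_on {x-1<..<x+1} F" by (rule continuous_on_subset[OF *[of "x-1" "x+1"]]) auto
    then show ?thesis by (rule continuous_on_interior) auto
  qed
  then show ?thesis by (simp add: continuous_at_imp_continuous_on)
qed

lemma ac_deriv_measurable [measurable_dest]: "ac_deriv F f \<Longrightarrow> F \<in> borel_measurable borel"
  by (intro borel_measurable_continuous_onI ac_deriv_continuous)

lemma ac_deriv_measurable' [measurable_dest]: "ac_deriv F f \<Longrightarrow> f \<in> borel_measurable borel"
  by (intro locally_integrable_measurable ac_deriv_locally_integrable)

lemma ac_deriv_if_continuously_differentiable: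
  assumes "\<And>x. (F has_vector_derivative f x) (at x)" "continuous_on UNIV f"
  shows "ac_deriv F f"
  unfolding ac_deriv_def
proof (intro conjI allI impI)
  show "locally_integrable f" by (rule locally_integrable_continuous) fact
  fix a b :: real assume "a \<le> b"
  then show "F b - F a = (LINT x:{a..b}|lborel. f x)"
    unfolding set_lebesgue_integral_def
    by (rule integral_FTC_atLeastAtMost[symmetric, OF _ has_vector_derivative_at_within[OF assms(1)]
          continuous_on_subset[OF assms(2) subset_UNIV]])
qed

lemma ac_deriv_add: "ac_deriv F f \<Longrightarrow> ac_deriv G g \<Longrightarrow> ac_deriv (\<lambda>x. F x + G x) (\<lambda>x. f x + g x)"
  unfolding ac_deriv_def by (auto simp: locally_integrable_add locally_integrableD algebra_simps set_integral_add(2) )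

lemma ac_deriv_cmult: "ac_deriv F f \<Longrightarrow> ac_deriv (\<lambda>x. c * F x) (\<lambda>x. c * f x)"
  unfolding ac_deriv_def
  by (auto simp: locally_integrable_cmult right_diff_distrib[symmetric] set_integral_mult_right)

lemma ac_deriv_cnj: assumes "ac_deriv F f" shows "ac_deriv (\<lambda>x. cnj (F x)) (\<lambda>x. cnj (f x))"
  unfolding ac_deriv_def
proof (intro conjI allI impI)
  show "locally_integrable (\<lambda>x. cnj (f x))"
    using assms by (intro locally_integrable_cnj) (simp add: ac_deriv_def)
  fix a b :: real assume "a \<le> b"
  have "(LINT x:{a..b}|lborel. cnj (f x)) = (LINT x|lborel. cnj (indicator {a..b} x *\<^sub>R f x))"
    by (simp add: set_lebesgue_integral_def)
  also have "\<dots> = cnj (LINT x:{a..b}|lborel. f x)"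
    unfolding set_lebesgue_integral_def by (rule Bochner_Integration.integral_cnj)
  finally show "cnj (F b) - cnj (F a) = (LINT x:{a..b}|lborel. cnj (f x))"
    using ac_derivD[OF assms \<open>a \<le> b\<close>] by (simp flip: complex_cnj_diff)
qed

lemma ac_deriv_cong_AE:
  assumes "ac_deriv F f" "AE x in lborel. f x = g x" and [measurable]: "g \<in> borel_measurable borel"
  shows "ac_deriv F g"
proof -
  note [measurable] = ac_deriv_measurable'[OF assms(1)]
  have "(LINT x:{a..b}|lborel. f x) = (LINT x:{a..b}|lborel. g x)" for a b
    by (rule set_lebesgue_integral_cong_AE) (use assms(2) in auto)
  then show ?thesis
    using assms(1) locally_integrable_cong_AE[OF _ assms(3,2)] by (simp add: ac_deriv_def)
qed

section \<open>The product rule for absolutely continuous functions\<close>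

lemma integrable_pair_mult:
  fixes f g :: "real \<Rightarrow> complex"
  assumes "integrable lborel f" "integrable lborel g"
  shows "integrable (lborel \<Otimes>\<^sub>M lborel) (\<lambda>(x, y). f x * g y)"
proof (rule lborel_pair.Fubini_integrable)
  note [measurable] = borel_measurable_integrable[OF assms(1)] borel_measurable_integrable[OF assms(2)]
  show "(\<lambda>(x, y). f x * g y) \<in> borel_measurable (lborel \<Otimes>\<^sub>M lborel)" by measurable
  show "integrable lborel (\<lambda>x. LINT y|lborel. norm (case (x, y) of (x, y) \<Rightarrow> f x * g y))"
    using assms by (simp add: norm_mult)
  show "AE x in lborel. integrable lborel (\<lambda>y. case (x, y) of (x, y) \<Rightarrow> f x * g y)"
    using assms by simp
qed

text \<open>The product of the two integrals is a double integral over the plane, which Fubini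
  splits into the half planes on either side of the diagonal.\<close>

lemma integral_mult_tails:
  fixes f g :: "real \<Rightarrow> complex"
  assumes f: "integrable lborel f" and g: "integrable lborel g"
  defines "P \<equiv> \<lambda>x. LINT y|lborel. (if y \<le> x then f y else 0)"
    and "Q \<equiv> \<lambda>x. LINT y|lborel. (if y \<le> x then g y else 0)"
  shows "integrable lborel (\<lambda>x. g x * P x)" "integrable lborel (\<lambda>x. f x * Q x)"
    "(LINT x|lborel. g x * P x) + (LINT x|lborel. f x * Q x) = (LINT x|lborel. f x) * (LINT x|lborel. g x)"
proof -
  note [measurable] = borel_measurable_integrable[OF f] borel_measurable_integrable[OF g]
  define h1 where "h1 x y = g x * (if y \<le> x then f y else 0)" for x y
  define h2 where "h2 x y = (if x \<le> y then g x else 0) * f y" for x y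
  have i0: "integrable (lborel \<Otimes>\<^sub>M lborel) (\<lambda>(x, y). g x * f y)"
    by (rule integrable_pair_mult[OF g f])
  have i1: "integrable (lborel \<Otimes>\<^sub>M lborel) (case_prod h1)"
    by (rule Bochner_Integration.integrable_bound[OF i0]) (auto simp: h1_def[abs_def] split_beta')
  have i2: "integrable (lborel \<Otimes>\<^sub>M lborel) (case_prod h2)"
    by (rule Bochner_Integration.integrable_bound[OF i0]) (auto simp: h2_def[abs_def] split_beta')
  have if_f: "integrable lborel (\<lambda>y. if y \<le> x then f y else 0)" for x
    by (rule Bochner_Integration.integrable_bound[OF f]) auto
  have if_g: "integrable lborel (\<lambda>y. if y \<le> x then g y else 0)" for x
    by (rule Bochner_Integration.integrable_bound[OF g]) auto
  have P: "(LINT y|lborel. h1 x y) = g x * P x" for x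
    unfolding h1_def P_def by (rule Bochner_Integration.integral_mult_right) (rule if_f)
  have Q: "(LINT x|lborel. h2 x y) = f y * Q y" for y
    unfolding h2_def Q_def by (subst mult.commute) (rule Bochner_Integration.integral_mult_right, rule if_g)
  show j1: "integrable lborel (\<lambda>x. g x * P x)"
    using lborel_pair.integrable_fst[OF i1] by (simp add: P)
  show "integrable lborel (\<lambda>x. f x * Q x)"
    using lborel_pair.integrable_snd[OF i2] by (simp add: Q)
  have "(LINT y|lborel. f y * Q y) = (LINT x|lborel. LINT y|lborel. h2 x y)"
    using lborel_pair.Fubini_integral[OF i2] by (simp add: Q)
  moreover have "(LINT x|lborel. g x * P x) = (LINT x|lborel. LINT y|lborel. h1 x y)"
    by (simp add: P)
  moreover have "(LINT x|lborel. LINT y|lborel. h1 x y) + (LINT x|lborel. LINT y|lborel. h2 x y) =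
     (LINT x|lborel. (LINT y|lborel. h1 x y) + (LINT y|lborel. h2 x y))"
    by (rule Bochner_Integration.integral_add[symmetric])
       (rule lborel_pair.integrable_fst[OF i1], rule lborel_pair.integrable_fst[OF i2])
  moreover have "(LINT y|lborel. h1 x y) + (LINT y|lborel. h2 x y) = g x * (LINT y|lborel. f y)" for x
  proof -
    have "integrable lborel (\<lambda>y. h1 x y)" unfolding h1_def using if_f by simp
    moreover have "integrable lborel (\<lambda>y. h2 x y)" unfolding h2_def
      by (rule Bochner_Integration.integrable_bound[OF integrable_mult_right[OF f, of "g x"]]) (auto simp: norm_mult)
    ultimately have "(LINT y|lborel. h1 x y) + (LINT y|lborel. h2 x y) = (LINT y|lborel. h1 x y + h2 x y)"
      by simp
    also have "\<dots> = (LINT y|lborel. g x * f y)"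
    proof (rule integral_cong_AE)
      show "AE y in lborel. h1 x y + h2 x y = g x * f y"
        \<comment> \<open>The half planes overlap only on the diagonal, a single point for each
          \<open>x\<close>.\<close>
        using AE_lborel_singleton[of x] by eventually_elim (auto simp: h1_def h2_def)
    qed (auto simp: h1_def h2_def)
    finally show ?thesis using f by simp
  qed
  ultimately show "(LINT x|lborel. g x * P x) + (LINT x|lborel. f x * Q x) = (LINT x|lborel. f x) * (LINT x|lborel. g x)"
    by (simp add: mult.commute)
qed

text \<open>On [a, b] write \<open>F\<close> and \<open>G\<close> as their values at
  \<open>a\<close> plus the running integrals \<open>P\<close> and \<open>Q\<close>; the terms
  without a constant factor are those of \<open>integral_mult_tails\<close>.\<close>

lemma ac_deriv_mult:
  assumes F: "ac_deriv F f" and G: "ac_deriv G g"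
  shows "ac_deriv (\<lambda>x. F x * G x) (\<lambda>x. f x * G x + F x * g x)"
  unfolding ac_deriv_def
proof (intro conjI allI impI)
  have l: "locally_integrable f" "locally_integrable g" using F G by (auto simp: ac_deriv_def)
  have "locally_integrable (\<lambda>x. G x * f x)" and Fg: "locally_integrable (\<lambda>x. F x * g x)"
    using l F G by (auto intro: locally_integrable_continuous_mult ac_deriv_continuous)
  then have Gf: "locally_integrable (\<lambda>x. f x * G x)" by (simp add: mult.commute)
  show "locally_integrable (\<lambda>x. f x * G x + F x * g x)" by (intro locally_integrable_add Gf Fg)
  fix a b :: real assume "a \<le> b"
  define f1 where "f1 x = indicator {a..b} x *\<^sub>R f x" for x
  define g1 where "g1 x = indicator {a..b} x *\<^sub>R g x" for x
  have i: "integrable lborel f1" "integrable lborel g1"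
    using l[THEN locally_integrableD, of a b] by (auto simp: f1_def[abs_def] g1_def[abs_def] set_integrable_def)
  define P where "P x = (LINT y|lborel. (if y \<le> x then f1 y else 0))" for x
  define Q where "Q x = (LINT y|lborel. (if y \<le> x then g1 y else 0))" for x
  note tails = integral_mult_tails[OF i, folded P_def Q_def]
  have FP: "F x = F a + P x" if "x \<in> {a..b}" for x
  proof -
    have "P x = (LINT y:{a..x}|lborel. f y)" unfolding P_def set_lebesgue_integral_def f1_def
      by (rule Bochner_Integration.integral_cong) (use that in \<open>auto simp: indicator_def\<close>)
    then show ?thesis using ac_derivD[OF F, of a x] that by (simp add: algebra_simps)
  qed
  have GQ: "G x = G a + Q x" if "x \<in> {a..b}" for x
  proof -
    have "Q x = (LINT y:{a..x}|lborel. g y)" unfolding Q_def set_lebesgue_integral_def g1_def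
      by (rule Bochner_Integration.integral_cong) (use that in \<open>auto simp: indicator_def\<close>)
    then show ?thesis using ac_derivD[OF G, of a x] that by (simp add: algebra_simps)
  qed
  have A: "(LINT x|lborel. f1 x) = F b - F a" and B: "(LINT x|lborel. g1 x) = G b - G a"
    using ac_derivD[OF F \<open>a \<le> b\<close>] ac_derivD[OF G \<open>a \<le> b\<close>]
    by (simp_all add: f1_def g1_def set_lebesgue_integral_def)
  have "(LINT x:{a..b}|lborel. f x * G x + F x * g x) =
     (LINT x|lborel. (G a * f1 x + F a * g1 x) + (g1 x * P x + f1 x * Q x))"
    unfolding set_lebesgue_integral_def
  proof (rule Bochner_Integration.integral_cong[OF refl])
    fix x
    show "indicator {a..b} x *\<^sub>R (f x * G x + F x * g x) = (G a * f1 x + F a * g1 x) + (g1 x * P x + f1 x * Q x)"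
    proof (cases "x \<in> {a..b}")
      case True
      show ?thesis unfolding FP[OF True] GQ[OF True] using True by (simp add: f1_def g1_def algebra_simps)
    qed (simp add: f1_def g1_def)
  qed
  also have "\<dots> = G a * (F b - F a) + F a * (G b - G a) + (F b - F a) * (G b - G a)"
    using i tails by (simp add: A B)
  finally show "F b * G b - F a * G a = (LINT x:{a..b}|lborel. f x * G x + F x * g x)"
    by (simp add: algebra_simps)
qed

lemma ac_deriv_test_function:
  assumes "test_function \<phi>"
  shows "ac_deriv (\<lambda>x. complex_of_real (\<phi> x)) (\<lambda>x. complex_of_real (deriv \<phi> x))"
proof (rule ac_deriv_if_continuously_differentiable)
  show "((\<lambda>x. complex_of_real (\<phi> x)) has_vector_derivative complex_of_real (deriv \<phi> x)) (at x)" for x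
    using test_function_DERIV[OF assms, of x]
    by (intro has_vector_derivative_of_real) (simp add: has_real_derivative_iff_has_vector_derivative)
  show "continuous_on UNIV (\<lambda>x. complex_of_real (deriv \<phi> x))"
    by (intro continuous_intros test_function_continuous test_function_deriv assms)
qed

text \<open>The product rule with a test function, on an interval so long that the boundary terms
  vanish.\<close>

lemma ac_deriv_has_weak_deriv:
  assumes F: "ac_deriv F f" shows "has_weak_deriv 1 F f"
  unfolding has_weak_deriv_def
proof (intro conjI allI impI)
  show lF: "locally_integrable F" and lf: "locally_integrable f"
    using locally_integrable_continuous[OF ac_deriv_continuous[OF F]] ac_deriv_locally_integrable[OF F] by auto
  fix \<phi> assume \<phi>: "test_function \<phi>"
  obtain R where R: "0 < R" "\<And>x. R \<le> \<bar>x\<bar> \<Longrightarrow> \<phi> x = 0"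
    using test_function_support[OF \<phi>] by metis
  obtain R' where R': "0 < R'" "\<And>x. R' \<le> \<bar>x\<bar> \<Longrightarrow> deriv \<phi> x = 0"
    using test_function_support[OF test_function_deriv[OF \<phi>]] by metis
  define S where "S = max R R'"
  have out: "\<phi> x = 0" "deriv \<phi> x = 0" if "S \<le> \<bar>x\<bar>" for x
    using that R(2) R'(2) by (auto simp: S_def)
  have S: "0 < S" using R by (simp add: S_def)
  let ?p = "\<lambda>x. f x * of_real (\<phi> x) + F x * of_real (deriv \<phi> x)"
  have "(LINT x:{-S..S}|lborel. ?p x) = F S * of_real (\<phi> S) - F (-S) * of_real (\<phi> (-S))"
    using ac_derivD[OF ac_deriv_mult[OF F ac_deriv_test_function[OF \<phi>]], of "-S" S] S by simp
  also have "\<dots> = 0" using S by (simp add: out)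
  also have "(LINT x:{-S..S}|lborel. ?p x) = (LINT x|lborel. ?p x)"
    unfolding set_lebesgue_integral_def
  proof (rule Bochner_Integration.integral_cong[OF refl])
    fix x show "indicator {-S..S} x *\<^sub>R ?p x = ?p x"
      using out[of x] by (cases "x \<in> {-S..S}") (auto simp: abs_if split: if_splits)
  qed
  also have "\<dots> = (LINT x|lborel. f x * of_real (\<phi> x)) + (LINT x|lborel. F x * of_real (deriv \<phi> x))"
    by (intro Bochner_Integration.integral_add locally_integrable_test_function lF lf \<phi> test_function_deriv)
  finally show "(LINT x|lborel. F x * of_real ((deriv ^^ 1) \<phi> x)) = (- 1) ^ 1 * (LINT x|lborel. f x * of_real (\<phi> x))"
    by (simp add: add_eq_0_iff)
qed

section \<open>Absolutely continuous representatives of weakly differentiable functions\<close>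

lemma ac_deriv_exists:
  assumes f: "locally_integrable f"
  obtains F where "ac_deriv F f"
proof
  have int: "interval_lebesgue_integrable lborel (ereal a) (ereal b) f" for a b
    using locally_integrableD[OF f, of "min a b" "max a b"]
    by (auto simp: interval_lebesgue_integrable_def intro: set_integrable_subset)
  show "ac_deriv (\<lambda>x. LBINT y=ereal 0..ereal x. f y) f"
    unfolding ac_deriv_def
  proof (intro conjI allI impI f)
    fix a b :: real assume "a \<le> b"
    have "(LBINT y=ereal 0..ereal a. f y) + (LBINT y=ereal a..ereal b. f y) = (LBINT y=ereal 0..ereal b. f y)"
      by (rule interval_integral_sum) (use int in \<open>auto simp: min_def max_def\<close>)
    then show "(LBINT y=ereal 0..ereal b. f y) - (LBINT y=ereal 0..ereal a. f y) = (LINT x:{a..b}|lborel. f x)"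
      using interval_integral_Icc[OF \<open>a \<le> b\<close>, of f] by (simp add: algebra_simps)
  qed
qed

text \<open>The du Bois-Reymond lemma. A test function of mean zero is the derivative of another;
  subtracting a multiple of a fixed \<open>\<psi>\<close> of nonzero mean reduces the general test
  function to that case.\<close>

lemma AE_const_if_weak_deriv_zero:
  assumes h: "locally_integrable h"
    and zero: "\<And>\<phi>. test_function \<phi> \<Longrightarrow> (LINT x|lborel. h x * of_real (deriv \<phi> x)) = 0"
  obtains c where "AE x in lborel. h x = c"
proof -
  define \<psi> where "\<psi> = bump 0 1 1"
  have \<psi>: "test_function \<psi>" by (simp add: \<psi>_def test_function_bump)
  have "(LINT x|lborel. \<psi> x) \<noteq> 0"
  proof
    assume "(LINT x|lborel. \<psi> x) = 0"
    then have "AE x in lborel. \<psi> x = 0"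
      using integral_nonneg_eq_0_iff_AE[OF test_function_integrable[OF \<psi>]] bump_bounds by (simp add: \<psi>_def)
    then have "AE x in lborel. x \<notin> {0<..<1::real}"
      by eventually_elim (auto simp: \<psi>_def bump_def flat_poly_def)
    then have "{0<..<1::real} \<in> null_sets lborel"
      by (subst (asm) AE_iff_null) (auto simp: greaterThanLessThan_def greaterThan_def lessThan_def Collect_conj_eq)
    then have "emeasure lborel {0<..<1::real} = 0" by (rule null_setsD1)
    then show False unfolding emeasure_lborel_Ioo[OF zero_le_one] by simp
  qed
  then obtain m where m: "m \<noteq> 0" "(LINT x|lborel. \<psi> x) = m" by blast
  \<comment> \<open>The value that testing a constant against \<open>\<psi>\<close> would
    force.\<close>
  define c where "c = (LINT x|lborel. h x * of_real (\<psi> x)) / of_real m"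
  have "AE x in lborel. h x - c = 0"
  proof (rule fundamental_lemma)
    show "locally_integrable (\<lambda>x. h x - c)"
      by (intro locally_integrable_diff h locally_integrable_continuous) auto
    fix \<phi> assume \<phi>: "test_function \<phi>"
    \<comment> \<open>Chosen so that \<phi> - k \<psi> has mean zero.\<close>
    define k where "k = (LINT x|lborel. \<phi> x) / m"
    have "test_function (\<lambda>x. \<phi> x + (-k) * \<psi> x)" by (rule test_function_add_cmult[OF \<phi> \<psi>])
    moreover have "(LINT x|lborel. \<phi> x + (-k) * \<psi> x) = 0"
      using test_function_integrable[OF \<phi>] test_function_integrable[OF \<psi>] m by (simp add: k_def)
    ultimately obtain \<theta> where \<theta>: "test_function \<theta>" "deriv \<theta> = (\<lambda>x. \<phi> x + (-k) * \<psi> x)"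
      by (rule test_function_primitive)
    have "0 = (LINT x|lborel. h x * of_real (\<phi> x) - of_real k * (h x * of_real (\<psi> x)))"
      using zero[OF \<theta>(1)] unfolding \<theta>(2) by (simp add: algebra_simps)
    also have "\<dots> = (LINT x|lborel. h x * of_real (\<phi> x)) - of_real k * (LINT x|lborel. h x * of_real (\<psi> x))"
      using locally_integrable_test_function[OF h \<phi>] locally_integrable_test_function[OF h \<psi>] by simp
    also have "of_real k * (LINT x|lborel. h x * of_real (\<psi> x)) = c * of_real (LINT x|lborel. \<phi> x)"
      using m by (simp add: c_def k_def)
    also have "\<dots> = (LINT x|lborel. c * of_real (\<phi> x))" by simp
    also have "(LINT x|lborel. h x * of_real (\<phi> x)) - (LINT x|lborel. c * of_real (\<phi> x)) =
        (LINT x|lborel. (h x - c) * of_real (\<phi> x))"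
      unfolding left_diff_distrib
      by (rule Bochner_Integration.integral_diff[symmetric])
         (use test_function_integrable[OF \<phi>] in \<open>auto intro: locally_integrable_test_function[OF h \<phi>]\<close>)
    finally show "(LINT x|lborel. (h x - c) * of_real (\<phi> x)) = 0" by simp
  qed
  then show ?thesis by (intro that[of c]) simp
qed

text \<open>A primitive of \<open>g\<close> has the same weak derivative as \<open>f\<close>, so the
  two differ by a constant almost everywhere; the constant is added to the primitive.\<close>

lemma has_weak_deriv_imp_ac_deriv:
  assumes fg: "has_weak_deriv 1 f g"
  obtains F where "ac_deriv F g" "AE x in lborel. f x = F x"
proof -
  have l: "locally_integrable f" "locally_integrable g" using fg by (auto simp: has_weak_deriv_def)
  obtain G where G: "ac_deriv G g" using ac_deriv_exists[OF l(2)] .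
  have "has_weak_deriv 1 (\<lambda>x. f x - G x) (\<lambda>x. g x - g x)"
    by (rule has_weak_deriv_diff[OF fg ac_deriv_has_weak_deriv[OF G]])
  then obtain c where c: "AE x in lborel. f x - G x = c"
    using AE_const_if_weak_deriv_zero[of "\<lambda>x. f x - G x"] by (auto simp: has_weak_deriv_def)
  show ?thesis
  proof (rule that[of "\<lambda>x. G x + c"])
    show "ac_deriv (\<lambda>x. G x + c) g" using G by (simp add: ac_deriv_def)
    show "AE x in lborel. f x = G x + c" using c by eventually_elim (simp add: algebra_simps)
  qed
qed

section \<open>Bounded subsets of the Sobolev space of order one\<close>

text \<open>One number bounds both norms, so that a single constant per time, and later per compact
  time interval, feeds all the estimates.\<close>

definition H1_deriv :: "real \<Rightarrow> (real \<Rightarrow> complex) \<Rightarrow> (real \<Rightarrow> complex) \<Rightarrow> bool" where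
  "H1_deriv M F f \<longleftrightarrow> ac_deriv F f \<and> F \<in> L2 \<and> f \<in> L2 \<and> L2_norm F \<le> M \<and> L2_norm f \<le> M"

lemma H1_derivD:
  assumes "H1_deriv M F f"
  shows "ac_deriv F f" "F \<in> L2" "f \<in> L2" "L2_norm F \<le> M" "L2_norm f \<le> M" "0 \<le> M"
  using assms order_trans[OF L2_norm_nonneg[of F]] by (auto simp: H1_deriv_def)

lemma H1_deriv_mono: "H1_deriv M F f \<Longrightarrow> M \<le> N \<Longrightarrow> H1_deriv N F f"
  by (auto simp: H1_deriv_def)

lemma L2_norm_indicator: "a \<le> b \<Longrightarrow> L2_norm (\<lambda>x. indicator {a..b} x) = sqrt (b - a)"
proof -
  assume "a \<le> b"
  have "(LINT x|lborel. (cmod (indicator {a..b} x))\<^sup>2) = (LINT x|lborel. indicat_real {a..b} x)"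
    by (rule Bochner_Integration.integral_cong) (auto simp: indicator_def)
  also have "\<dots> = b - a" using \<open>a \<le> b\<close> by simp
  finally show ?thesis by (simp add: L2_norm_def)
qed

lemma integrable_indicator_Icc: "integrable lborel (\<lambda>x::real. indicator {a..b} x *\<^sub>R (c::real))"
  using emeasure_bounded_finite[of "{a..b}"]
  by (intro integrable_scaleR_left integrable_real_indicator) auto

lemma set_integral_norm_le_L2:
  assumes "f \<in> L2" "a \<le> b"
  shows "(LINT x:{a..b}|lborel. cmod (f x)) \<le> sqrt (b - a) * L2_norm f"
proof -
  have "(LINT x:{a..b}|lborel. cmod (f x)) = (LINT x|lborel. cmod (indicator {a..b} x) * cmod (f x))"
    unfolding set_lebesgue_integral_def
    by (rule Bochner_Integration.integral_cong) (auto simp: indicator_def)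
  also have "\<dots> \<le> L2_norm (\<lambda>x. indicator {a..b} x) * L2_norm f"
    by (rule L2_Cauchy_Schwarz[OF indicator_in_L2 assms(1)])
  finally show ?thesis by (simp add: L2_norm_indicator assms)
qed

lemma ac_deriv_increment_le:
  assumes F: "ac_deriv F f" and ab: "c \<le> a" "a \<le> b" "b \<le> d"
  shows "cmod (F b - F a) \<le> (LINT x:{c..d}|lborel. cmod (f x))"
proof -
  have i: "set_integrable lborel {c..d} f" for c d
    using F by (simp add: ac_deriv_def locally_integrableD)
  have n: "set_integrable lborel {c..d} (\<lambda>x. cmod (f x))" for c d
    by (rule set_integrable_norm[OF i])
  have "cmod (F b - F a) \<le> (LINT x:{a..b}|lborel. cmod (f x))"
    unfolding ac_derivD[OF F ab(2)] by (rule set_integral_norm_bound[OF i])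
  also have "\<dots> \<le> (LINT x:{c..d}|lborel. cmod (f x))"
    unfolding set_lebesgue_integral_def
    by (rule integral_mono) (use n ab in \<open>auto simp: set_integrable_def indicator_def\<close>)
  finally show ?thesis .
qed

text \<open>Hoelder continuity of exponent 1/2, from Cauchy-Schwarz against the indicator of
  [a, b].\<close>

lemma H1_deriv_increment_le:
  assumes F: "H1_deriv M F f" and ab: "a \<le> b"
  shows "cmod (F b - F a) \<le> sqrt (b - a) * M"
proof -
  have "cmod (F b - F a) \<le> (LINT x:{a..b}|lborel. cmod (f x))"
    using ac_deriv_increment_le[OF H1_derivD(1)[OF F] order_refl ab order_refl] .
  also have "\<dots> \<le> sqrt (b - a) * L2_norm f"
    by (rule set_integral_norm_le_L2[OF H1_derivD(3)[OF F] ab])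
  also have "\<dots> \<le> sqrt (b - a) * M"
    using H1_derivD(5)[OF F] ab by (intro mult_left_mono) auto
  finally show ?thesis .
qed

text \<open>Averaging over [x, x + 1]: by the Hoelder bound \<open>F x\<close> differs from each
  \<open>F y\<close> there by at most \<open>M\<close>, and the mean of |F| over a unit interval is
  at most its L2 norm.\<close>

lemma H1_deriv_bound:
  assumes F: "H1_deriv M F f"
  shows "cmod (F x) \<le> 2 * M"
proof -
  note D = H1_derivD[OF F]
  have n: "set_integrable lborel {x..x+1} (\<lambda>x. cmod (F x))"
    by (rule set_integrable_norm[OF locally_integrableD[OF L2_locally_integrable[OF D(2)]]])
  note i = integrable_indicator_Icc[of x "x + 1"]
  have "cmod (F x) = (LINT y|lborel. indicator {x..x+1} y *\<^sub>R cmod (F x))" by simp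
  also have "\<dots> \<le> (LINT y|lborel. indicator {x..x+1} y *\<^sub>R cmod (F y) + indicator {x..x+1} y *\<^sub>R M)"
  proof (rule integral_mono[OF i])
    show "integrable lborel (\<lambda>y. indicator {x..x+1} y *\<^sub>R cmod (F y) + indicator {x..x+1} y *\<^sub>R M)"
      using n by (intro Bochner_Integration.integrable_add i) (simp add: set_integrable_def)
    fix y
    have "cmod (F x) \<le> cmod (F y) + M" if y: "y \<in> {x..x+1}"
    proof -
      have "cmod (F y - F x) \<le> sqrt (y - x) * M" using y by (intro H1_deriv_increment_le[OF F]) auto
      also have "\<dots> \<le> 1 * M" using y D(6) by (intro mult_right_mono) (auto simp: real_sqrt_le_1_iff)
      finally show ?thesis using norm_triangle_ineq2[of "F x" "F y"] by (simp add: norm_minus_commute)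
    qed
    then show "indicator {x..x+1} y *\<^sub>R cmod (F x) \<le> indicator {x..x+1} y *\<^sub>R cmod (F y) + indicator {x..x+1} y *\<^sub>R M"
      by (auto simp: indicator_def)
  qed
  also have "\<dots> = (LINT y:{x..x+1}|lborel. cmod (F y)) + (LINT y|lborel. indicator {x..x+1} y *\<^sub>R M)"
    using n i unfolding set_lebesgue_integral_def set_integrable_def by (intro Bochner_Integration.integral_add)
  also have "\<dots> \<le> sqrt 1 * L2_norm F + M"
    using set_integral_norm_le_L2[OF D(2), of x "x+1"] by simp
  also have "\<dots> \<le> 2 * M" using D(4) by simp
  finally show ?thesis .
qed

lemma H1_deriv_add:
  assumes F: "H1_deriv M F f" and G: "H1_deriv N G g"
  shows "H1_deriv (M + N) (\<lambda>x. F x + G x) (\<lambda>x. f x + g x)"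
  unfolding H1_deriv_def
  using L2_norm_triangle[OF H1_derivD(2)[OF F] H1_derivD(2)[OF G]]
    L2_norm_triangle[OF H1_derivD(3)[OF F] H1_derivD(3)[OF G]] H1_derivD[OF F] H1_derivD[OF G]
  by (auto intro: ac_deriv_add L2_add)

lemma H1_deriv_cnj: "H1_deriv M F f \<Longrightarrow> H1_deriv M (\<lambda>x. cnj (F x)) (\<lambda>x. cnj (f x))"
  by (auto simp: H1_deriv_def intro: ac_deriv_cnj L2_cnj)

lemma H1_deriv_bounded_mult:
  assumes F: "H1_deriv M F f" and W: "ac_deriv W w" and K: "\<And>x. cmod (W x) \<le> K" "\<And>x. cmod (w x) \<le> K"
  shows "H1_deriv (2 * K * M) (\<lambda>x. W x * F x) (\<lambda>x. w x * F x + W x * f x)"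
proof -
  note [measurable] = ac_deriv_measurable[OF W] ac_deriv_measurable'[OF W]
  note D = H1_derivD[OF F]
  have K0: "0 \<le> K" using K(1)[of 0] norm_ge_zero order_trans by blast
  have L: "(\<lambda>x. W x * F x) \<in> L2" "(\<lambda>x. w x * F x) \<in> L2" "(\<lambda>x. W x * f x) \<in> L2"
    by (rule L2_bounded_mult[OF D(2) _ K(1)], measurable, rule L2_bounded_mult[OF D(2) _ K(2)], measurable,
        rule L2_bounded_mult[OF D(3) _ K(1)], measurable)
  have N: "L2_norm (\<lambda>x. W x * F x) \<le> K * M" "L2_norm (\<lambda>x. w x * F x) \<le> K * M" "L2_norm (\<lambda>x. W x * f x) \<le> K * M"
    using L2_norm_bounded_mult[OF D(2) ac_deriv_measurable[OF W] K(1)] L2_norm_bounded_mult[OF D(2) ac_deriv_measurable'[OF W] K(2)]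
      L2_norm_bounded_mult[OF D(3) ac_deriv_measurable[OF W] K(1)]
      mult_left_mono[OF D(4) K0] mult_left_mono[OF D(5) K0] by linarith+
  show ?thesis unfolding H1_deriv_def
    using ac_deriv_mult[OF W D(1)] L N L2_add[OF L(2,3)] L2_norm_triangle[OF L(2,3)] mult_nonneg_nonneg[OF K0 D(6)]
    by (auto simp: mult_ac)
qed

text \<open>Each of F G, f G and F g is a factor bounded by 2 M or 2 N times a square integrable
  one, which costs 2 M N; the derivative has two such terms.\<close>

lemma H1_deriv_mult:
  assumes F: "H1_deriv M F f" and G: "H1_deriv N G g"
  shows "H1_deriv (4 * M * N) (\<lambda>x. F x * G x) (\<lambda>x. f x * G x + F x * g x)"
proof -
  note D = H1_derivD[OF F] and E = H1_derivD[OF G]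
  note [measurable] = ac_deriv_measurable[OF D(1)] ac_deriv_measurable[OF E(1)]
  note bF = H1_deriv_bound[OF F] and bG = H1_deriv_bound[OF G]
  have L: "(\<lambda>x. F x * G x) \<in> L2" "(\<lambda>x. f x * G x) \<in> L2" "(\<lambda>x. F x * g x) \<in> L2"
    using L2_bounded_mult[OF E(2) ac_deriv_measurable[OF D(1)] bF] L2_bounded_mult[OF E(3) ac_deriv_measurable[OF D(1)] bF]
      L2_bounded_mult[OF D(3) ac_deriv_measurable[OF E(1)] bG]
    by (simp_all add: mult.commute)
  have "L2_norm (\<lambda>x. F x * G x) \<le> 2 * M * L2_norm G"
    by (rule L2_norm_bounded_mult[OF E(2) _ bF]) simp
  also have "\<dots> \<le> 2 * M * N" using E(4) D(6) by (intro mult_left_mono) auto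
  finally have N1: "L2_norm (\<lambda>x. F x * G x) \<le> 2 * M * N" .
  have "L2_norm (\<lambda>x. F x * g x) \<le> 2 * M * L2_norm g"
    by (rule L2_norm_bounded_mult[OF E(3) _ bF]) simp
  also have "\<dots> \<le> 2 * M * N" using E(5) D(6) by (intro mult_left_mono) auto
  finally have N2: "L2_norm (\<lambda>x. F x * g x) \<le> 2 * M * N" .
  have "L2_norm (\<lambda>x. G x * f x) \<le> 2 * N * L2_norm f"
    by (rule L2_norm_bounded_mult[OF D(3) _ bG]) simp
  also have "\<dots> \<le> 2 * N * M" using D(5) E(6) by (intro mult_left_mono) auto
  finally have N3: "L2_norm (\<lambda>x. f x * G x) \<le> 2 * M * N" by (simp add: mult_ac)
  have "0 \<le> M * N" using D(6) E(6) by simp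
  then show ?thesis unfolding H1_deriv_def
    using ac_deriv_mult[OF D(1) E(1)] L N1 N2 N3 L2_add[OF L(2,3)] L2_norm_triangle[OF L(2,3)]
    by simp
qed

text \<open>No limit of \<open>P\<close> at infinity is taken. The integral of P (x + 1) - P x over
  the line is 0 by translation invariance; as this difference is the integral of p (x + s) over 0
  \<le> s \<le> 1, Fubini turns it into the integral of \<open>p\<close>.\<close>

lemma integral_ac_deriv_zero:
  assumes P: "ac_deriv P p" and iP: "integrable lborel P" and ip: "integrable lborel p"
  shows "(LINT x|lborel. p x) = 0"
proof -
  note [measurable] = ac_deriv_measurable[OF P] ac_deriv_measurable'[OF P]
  define k where "k s x = indicator {0..1::real} s *\<^sub>R p (s + 1 * x)" for s x
  have ip': "integrable lborel (\<lambda>x. p (s + 1 * x))" for s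
    by (rule lborel_integrable_real_affine[OF ip]) simp
  have t: "(LINT x|lborel. p (s + 1 * x)) = (LINT x|lborel. p x)" for s
    using lborel_integral_real_affine[of 1 p s] by simp
  have tn: "(LINT x|lborel. cmod (p (s + 1 * x))) = (LINT x|lborel. cmod (p x))" for s
    using lborel_integral_real_affine[of 1 "\<lambda>x. cmod (p x)" s] by simp
  have "integrable (lborel \<Otimes>\<^sub>M lborel) (case_prod k)"
  proof (rule lborel_pair.Fubini_integrable)
    show "case_prod k \<in> borel_measurable (lborel \<Otimes>\<^sub>M lborel)"
      unfolding k_def[abs_def] split_beta' by measurable
    have "(\<lambda>s. LINT x|lborel. norm (case_prod k (s, x))) = (\<lambda>s. indicator {0..1} s *\<^sub>R (LINT x|lborel. cmod (p x)))"
      by (auto simp: k_def indicator_def tn[simplified])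
    moreover have "integrable lborel (\<lambda>s. indicator {0..1::real} s *\<^sub>R (LINT x|lborel. cmod (p x)))"
      by (rule integrable_indicator_Icc)
    ultimately show "integrable lborel (\<lambda>s. LINT x|lborel. norm (case_prod k (s, x)))" by simp
    show "AE s in lborel. integrable lborel (\<lambda>x. case_prod k (s, x))"
      using ip' by (auto simp: k_def)
  qed
  note pair = this
  have inner: "(LINT s|lborel. k s x) = P (1 + x) - P x" for x
  proof -
    have "P (x + 1) - P x = (LINT y|lborel. indicator {x..x+1} y *\<^sub>R p y)"
      using ac_derivD[OF P, of x "x+1"] by (simp add: set_lebesgue_integral_def)
    also have "\<dots> = (LINT s|lborel. indicator {x..x+1} (x + 1 * s) *\<^sub>R p (x + 1 * s))"
      using lborel_integral_real_affine[of 1 "\<lambda>y. indicator {x..x+1} y *\<^sub>R p y" x] by simp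
    also have "\<dots> = (LINT s|lborel. k s x)"
      by (rule Bochner_Integration.integral_cong) (auto simp: k_def indicator_def add.commute)
    finally show ?thesis by (simp add: add.commute)
  qed
  have "(LINT x|lborel. P (1 + x) - P x) = (LINT s|lborel. LINT x|lborel. k s x)"
    using lborel_pair.Fubini_integral[OF pair] by (simp add: inner)
  also have "\<dots> = (LINT s|lborel. indicator {0..1::real} s *\<^sub>R (LINT x|lborel. p x))"
    by (simp add: k_def t[simplified])
  also have "\<dots> = (LINT x|lborel. p x)" by simp
  also have "(LINT x|lborel. P (1 + x) - P x) = 0"
    using lborel_integrable_real_affine[OF iP, of 1 1] lborel_integral_real_affine[of 1 P 1] iP by simp
  finally show ?thesis by simp
qed

lemma H1_deriv_integral_by_parts:
  assumes F: "H1_deriv M F f" and G: "H1_deriv N G g"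
  shows "(LINT x|lborel. f x * G x) = - (LINT x|lborel. F x * g x)"
proof -
  note D = H1_derivD[OF F] and E = H1_derivD[OF G]
  have i: "integrable lborel (\<lambda>x. f x * G x)" "integrable lborel (\<lambda>x. F x * g x)" "integrable lborel (\<lambda>x. F x * G x)"
    by (intro L2_mult_integrable D E)+
  have "(LINT x|lborel. f x * G x + F x * g x) = 0"
    by (rule integral_ac_deriv_zero[OF ac_deriv_mult[OF D(1) E(1)] i(3)]) (use i in auto)
  then show ?thesis using i by (simp add: add_eq_0_iff)
qed

section \<open>The Hilbert transform of Sobolev functions\<close>

lemma integrable_even_extension:
  fixes p :: "real \<Rightarrow> real"
  assumes [measurable]: "p \<in> borel_measurable borel" and "\<And>h. 0 \<le> p h"
    and fin: "(\<integral>\<^sup>+h. ennreal (p h) * indicator {0..} h \<partial>lborel) < \<infinity>"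
  shows "integrable lborel (\<lambda>h. p \<bar>h\<bar>)"
proof -
  have i: "integrable lborel (\<lambda>h. indicator {0..} h * p h)"
  proof (rule integrableI_bounded)
    have "(\<integral>\<^sup>+h. ennreal (norm (indicator {0..} h * p h)) \<partial>lborel) = (\<integral>\<^sup>+h. ennreal (p h) * indicator {0..} h \<partial>lborel)"
      by (rule nn_integral_cong) (use assms(2) in \<open>auto simp: indicator_def\<close>)
    then show "(\<integral>\<^sup>+h. ennreal (norm (indicator {0..} h * p h)) \<partial>lborel) < \<infinity>" using fin by simp
  qed measurable
  have "integrable lborel (\<lambda>h. indicator {0..} (0 + (-1) * h) * p (0 + (-1) * h))"
    by (rule lborel_integrable_real_affine[OF i]) simp
  from Bochner_Integration.integrable_add[OF i this]
  show ?thesis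
    by (rule Bochner_Integration.integrable_bound) (use assms(2) in \<open>auto simp: indicator_def abs_if\<close>)
qed

text \<open>The Hoelder bound of exponent 1/2 divided by |h|: an integrable singularity, cut off at
  distance 1.\<close>

definition near_kernel :: "real \<Rightarrow> real" where
  "near_kernel h = (if \<bar>h\<bar> \<le> 1 then \<bar>h\<bar> powr (- 1 / 2) else 0)"

text \<open>The Hilbert kernel with its singularity removed. Radius 1 gives the majorant away from
  0; general \<open>\<epsilon>\<close> occurs in the principal value.\<close>

definition far_kernel :: "real \<Rightarrow> real \<Rightarrow> real" where
  "far_kernel \<epsilon> h = (if \<epsilon> < \<bar>h\<bar> then 1 / h else 0)"

lemma near_kernel_nonneg: "0 \<le> near_kernel h"
  by (simp add: near_kernel_def)

lemma near_kernel_integrable: "integrable lborel near_kernel"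
proof -
  define p where "p h = indicator {0..1::real} h * h powr (- 1 / 2)" for h
  have I: "((\<lambda>x::real. x powr (-1/2)) has_integral (1 powr (-1/2+1) / (-1/2+1))) {0..1}"
    by (rule has_integral_powr_from_0) auto
  have "(\<integral>\<^sup>+h. ennreal (p h) * indicator {0..} h \<partial>lborel) = (\<integral>\<^sup>+h. ennreal (h powr (-1/2)) * indicator {0..1} h \<partial>lborel)"
    by (rule nn_integral_cong) (auto simp: p_def indicator_def)
  also have "\<dots> = ennreal (1 powr (-1/2+1) / (-1/2+1))"
    by (rule nn_integral_has_integral_lebesgue'[OF _ I]) simp
  also have "\<dots> < \<infinity>" by simp
  finally have "integrable lborel (\<lambda>h. p \<bar>h\<bar>)"
    by (intro integrable_even_extension) (auto simp: p_def[abs_def])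
  moreover have "(\<lambda>h. p \<bar>h\<bar>) = near_kernel" by (auto simp: p_def near_kernel_def indicator_def)
  ultimately show ?thesis by simp
qed

lemma near_kernel_measurable [measurable]: "near_kernel \<in> borel_measurable borel"
  using borel_measurable_integrable[OF near_kernel_integrable] by simp

lemma integrable_inverse_one_plus_square: "integrable lborel (\<lambda>h::real. 1 / (1 + h\<^sup>2))"
proof -
  have "(\<integral>\<^sup>+h. ennreal (1 / (1 + h\<^sup>2)) * indicator {0..} h \<partial>lborel) = ennreal (pi / 2 - arctan 0)"
    by (rule nn_integral_FTC_atLeast)
       (auto intro!: derivative_eq_intros tendsto_arctan_at_top simp: field_simps)
  also have "\<dots> < \<infinity>" by simp
  finally have "integrable lborel (\<lambda>h::real. 1 / (1 + \<bar>h\<bar>\<^sup>2))"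
    by (intro integrable_even_extension) auto
  then show ?thesis by simp
qed

lemma far_kernel_measurable [measurable]: "far_kernel \<epsilon> \<in> borel_measurable borel"
  unfolding far_kernel_def[abs_def] by measurable

lemma far_kernel_in_L2:
  assumes "0 < \<epsilon>" shows "(\<lambda>h. complex_of_real (far_kernel \<epsilon> h)) \<in> L2"
proof (rule L2I_bound)
  show "integrable lborel (\<lambda>h. (1 + 1 / \<epsilon>\<^sup>2) * (1 / (1 + h\<^sup>2)))"
    by (intro integrable_mult_right integrable_inverse_one_plus_square)
  fix h :: real
  show "(cmod (complex_of_real (far_kernel \<epsilon> h)))\<^sup>2 \<le> (1 + 1 / \<epsilon>\<^sup>2) * (1 / (1 + h\<^sup>2))"
  proof (cases "\<epsilon> < \<bar>h\<bar>")
    case True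
    then have "h \<noteq> 0" "\<epsilon>\<^sup>2 \<le> h\<^sup>2" using assms abs_le_square_iff[of \<epsilon> h] by auto
    then have "1 / h\<^sup>2 \<le> 1 / \<epsilon>\<^sup>2" using assms by (intro divide_left_mono) auto
    have "0 < 1 + h\<^sup>2" by (simp add: add_pos_nonneg)
    \<comment> \<open>Trades 1/h^2 for a function integrable on the whole line; the factor 1 + 1/h^2
      is bounded because |h| exceeds \<open>\<epsilon>\<close>.\<close>
    then have "1 / h\<^sup>2 = (1 + 1 / h\<^sup>2) * (1 / (1 + h\<^sup>2))" using \<open>h \<noteq> 0\<close> by (simp add: field_simps)
    also have "\<dots> \<le> (1 + 1 / \<epsilon>\<^sup>2) * (1 / (1 + h\<^sup>2))"
      using \<open>1 / h\<^sup>2 \<le> 1 / \<epsilon>\<^sup>2\<close> \<open>0 < 1 + h\<^sup>2\<close> by (intro mult_right_mono) auto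
    finally show ?thesis using True by (simp add: far_kernel_def norm_divide power_divide)
  qed (auto simp: far_kernel_def)
qed measurable

lemma L2_affine:
  assumes "f \<in> L2" "c = 1 \<or> c = -1"
  shows "(\<lambda>h. f (x + c * h)) \<in> L2" "L2_norm (\<lambda>h. f (x + c * h)) = L2_norm f"
proof -
  have c: "c \<noteq> 0" "\<bar>c\<bar> = 1" using assms(2) by auto
  note [measurable] = L2_measurable[OF assms(1)]
  show "(\<lambda>h. f (x + c * h)) \<in> L2"
    using lborel_integrable_real_affine[OF L2_integrable_square[OF assms(1)] c(1), of x] by (simp add: L2_def)
  show "L2_norm (\<lambda>h. f (x + c * h)) = L2_norm f"
    using lborel_integral_real_affine[OF c(1), of "\<lambda>x. (cmod (f x))\<^sup>2" x] c(2) by (simp add: L2_norm_def)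
qed

lemmas L2_shift = L2_affine[where c = 1, simplified]
lemmas L2_reflect = L2_affine[where c = "-1", simplified]

definition symmetric_quotient :: "(real \<Rightarrow> complex) \<Rightarrow> real \<Rightarrow> real \<Rightarrow> complex" where
  "symmetric_quotient F x h = (F (x - h) - F (x + h)) / of_real h"

text \<open>The principal value with the points x - h and x + h paired, so that for H^1 functions
  the integral converges absolutely. As \<open>h\<close> takes both signs each pair is counted
  twice, hence 2 pi instead of pi.\<close>

definition Hilbert_integral :: "(real \<Rightarrow> complex) \<Rightarrow> real \<Rightarrow> complex" where
  "Hilbert_integral F x = of_real (1 / (2 * pi)) * (LINT h|lborel. symmetric_quotient F x h)"

text \<open>The sqrt 2 comes from the increment over [x - |h|, x + |h|], of length 2 |h|; the 2 from
  the two values F (x - h) and F (x + h) paired with the far kernel.\<close>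

definition Hilbert_const :: real where
  "Hilbert_const = sqrt 2 * (LINT h|lborel. near_kernel h) + 2 * L2_norm (\<lambda>h. of_real (far_kernel 1 h))"

lemma Hilbert_const_nonneg: "0 \<le> Hilbert_const"
  unfolding Hilbert_const_def by (auto intro!: add_nonneg_nonneg mult_nonneg_nonneg integral_nonneg_AE simp: near_kernel_nonneg)

lemma symmetric_quotient_le:
  assumes F: "H1_deriv M F f"
  shows "cmod (symmetric_quotient F x h) \<le> sqrt 2 * M * near_kernel h +
    (cmod (F (x - h)) * cmod (of_real (far_kernel 1 h)) + cmod (F (x + h)) * cmod (of_real (far_kernel 1 h)))"
proof (cases "h = 0")
  case True
  then show ?thesis using H1_derivD(6)[OF F]
    by (simp add: symmetric_quotient_def near_kernel_nonneg)
next
  case h: False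
  show ?thesis
  proof (cases "\<bar>h\<bar> \<le> 1")
    case True
    have "cmod (F (x + \<bar>h\<bar>) - F (x - \<bar>h\<bar>)) \<le> sqrt ((x + \<bar>h\<bar>) - (x - \<bar>h\<bar>)) * M"
      by (intro H1_deriv_increment_le[OF F]) auto
    then have "cmod (F (x - h) - F (x + h)) \<le> sqrt 2 * sqrt \<bar>h\<bar> * M"
      by (cases "h \<ge> 0") (auto simp: norm_minus_commute real_sqrt_mult[symmetric])
    then have "cmod (symmetric_quotient F x h) \<le> (sqrt 2 * sqrt \<bar>h\<bar> * M) / \<bar>h\<bar>"
      by (simp add: symmetric_quotient_def norm_divide divide_right_mono)
    also have "\<dots> = sqrt 2 * M * near_kernel h"
    proof -
      have "sqrt \<bar>h\<bar> / \<bar>h\<bar> = near_kernel h"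
        using h True powr_diff[of "\<bar>h\<bar>" "1/2" 1] by (simp add: near_kernel_def powr_half_sqrt[symmetric])
      then show ?thesis by (metis (no_types, opaque_lifting) mult.assoc mult.commute times_divide_eq_right)
    qed
    finally show ?thesis using True by (simp add: far_kernel_def)
  next
    case False
    then have "cmod (symmetric_quotient F x h) \<le> (cmod (F (x - h)) + cmod (F (x + h))) * \<bar>1 / h\<bar>"
      using norm_triangle_ineq4[of "F (x - h)" "F (x + h)"]
      by (simp add: symmetric_quotient_def norm_divide divide_right_mono)
    then show ?thesis using False by (simp add: far_kernel_def near_kernel_def norm_divide algebra_simps)
  qed
qed

lemma symmetric_quotient_majorant:
  fixes x :: real
  assumes F: "H1_deriv M F f"
  defines "w \<equiv> \<lambda>h. sqrt 2 * M * near_kernel h +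
    (cmod (F (x - h)) * cmod (of_real (far_kernel 1 h)) + cmod (F (x + h)) * cmod (of_real (far_kernel 1 h)))"
  shows "integrable lborel w" "(LINT h|lborel. w h) \<le> Hilbert_const * M"
proof -
  note D = H1_derivD[OF F]
  have k: "(\<lambda>h. complex_of_real (far_kernel 1 h)) \<in> L2" by (rule far_kernel_in_L2) simp
  have i: "integrable lborel (\<lambda>h. cmod (F (x - h)) * cmod (complex_of_real (far_kernel 1 h)))"
     "integrable lborel (\<lambda>h. cmod (F (x + h)) * cmod (complex_of_real (far_kernel 1 h)))"
     "integrable lborel (\<lambda>h. sqrt 2 * M * near_kernel h)"
    using near_kernel_integrable by (auto intro!: L2_mult_abs_integrable k L2_shift L2_reflect D simp del: norm_of_real)
  then show "integrable lborel w" unfolding w_def by (intro Bochner_Integration.integrable_add)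
  have "(LINT h|lborel. w h) = sqrt 2 * M * (LINT h|lborel. near_kernel h) +
    ((LINT h|lborel. cmod (F (x - h)) * cmod (complex_of_real (far_kernel 1 h))) +
     (LINT h|lborel. cmod (F (x + h)) * cmod (complex_of_real (far_kernel 1 h))))"
    unfolding w_def using i near_kernel_integrable by (simp del: norm_of_real)
  also have "\<dots> \<le> sqrt 2 * M * (LINT h|lborel. near_kernel h) +
    (L2_norm F * L2_norm (\<lambda>h. of_real (far_kernel 1 h)) + L2_norm F * L2_norm (\<lambda>h. of_real (far_kernel 1 h)))"
    using L2_Cauchy_Schwarz[OF L2_reflect(1)[OF D(2)] k, of x] L2_Cauchy_Schwarz[OF L2_shift(1)[OF D(2)] k, of x]
    unfolding L2_reflect(2)[OF D(2)] L2_shift(2)[OF D(2)] by (intro add_mono order_refl)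
  also have "\<dots> \<le> sqrt 2 * M * (LINT h|lborel. near_kernel h) +
    (M * L2_norm (\<lambda>h. of_real (far_kernel 1 h)) + M * L2_norm (\<lambda>h. of_real (far_kernel 1 h)))"
    using D(4) by (intro add_mono mult_right_mono order_refl) auto
  also have "\<dots> = Hilbert_const * M" by (simp add: Hilbert_const_def algebra_simps)
  finally show "(LINT h|lborel. w h) \<le> Hilbert_const * M" .
qed

lemma symmetric_quotient_measurable_pair:
  assumes [measurable]: "F \<in> borel_measurable borel"
  shows "(\<lambda>(x, h). symmetric_quotient F x h) \<in> borel_measurable (lborel \<Otimes>\<^sub>M lborel)"
  unfolding symmetric_quotient_def by measurable

lemma symmetric_quotient_measurable:
  assumes [measurable]: "F \<in> borel_measurable borel"
  shows "symmetric_quotient F x \<in> borel_measurable borel"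
  unfolding symmetric_quotient_def[abs_def] by measurable

lemma symmetric_quotient_integrable:
  assumes F: "H1_deriv M F f"
  shows "integrable lborel (symmetric_quotient F x)"
    "(LINT h|lborel. cmod (symmetric_quotient F x h)) \<le> Hilbert_const * M"
proof -
  note [measurable] = symmetric_quotient_measurable[OF L2_measurable[OF H1_derivD(2)[OF F]]]
  show i: "integrable lborel (symmetric_quotient F x)"
    by (rule Bochner_Integration.integrable_bound[OF symmetric_quotient_majorant(1)[OF F, of x]])
       (use symmetric_quotient_le[OF F, of x] in \<open>auto intro!: AE_I2 order_trans[OF _ abs_ge_self] simp del: norm_of_real\<close>)
  have "(LINT h|lborel. cmod (symmetric_quotient F x h)) \<le> (LINT h|lborel. sqrt 2 * M * near_kernel h +
    (cmod (F (x - h)) * cmod (of_real (far_kernel 1 h)) + cmod (F (x + h)) * cmod (of_real (far_kernel 1 h))))"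
    by (intro integral_mono integrable_norm i symmetric_quotient_majorant(1)[OF F] symmetric_quotient_le[OF F])
  also note symmetric_quotient_majorant(2)[OF F]
  finally show "(LINT h|lborel. cmod (symmetric_quotient F x h)) \<le> Hilbert_const * M" .
qed

text \<open>A sup bound by the H^1 norm takes the place of the L2 theory of the Hilbert transform;
  the factor 1/(2 pi) is simply estimated by 1.\<close>

lemma Hilbert_integral_bound:
  assumes F: "H1_deriv M F f"
  shows "cmod (Hilbert_integral F x) \<le> Hilbert_const * M"
proof -
  have "cmod (LINT h|lborel. symmetric_quotient F x h) \<le> Hilbert_const * M"
    using integral_norm_bound order_trans symmetric_quotient_integrable(2)[OF F] by blast
  moreover have "\<bar>1 / (2 * pi)\<bar> \<le> 1" using pi_gt3 by (simp add: field_simps)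
  ultimately have "\<bar>1 / (2 * pi)\<bar> * cmod (LINT h|lborel. symmetric_quotient F x h) \<le> 1 * (Hilbert_const * M)"
    by (intro mult_mono) auto
  then show ?thesis by (simp only: Hilbert_integral_def norm_mult norm_of_real mult_1)
qed

lemma Hilbert_integral_measurable:
  assumes [measurable]: "F \<in> borel_measurable borel"
  shows "Hilbert_integral F \<in> borel_measurable borel"
proof -
  note [measurable] = symmetric_quotient_measurable_pair[OF assms]
  have "(\<lambda>x. LINT h|lborel. symmetric_quotient F x h) \<in> borel_measurable lborel" by measurable
  then show ?thesis unfolding Hilbert_integral_def[abs_def] by simp
qed

text \<open>The Hilbert transform commutes with differentiation. Integrating the symmetric quotient
  of \<open>f\<close> first in \<open>x\<close> produces increments of \<open>F\<close>; the H^1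
  bound on \<open>f\<close> makes the double integral absolutely convergent.\<close>

lemma Hilbert_integral_ac_deriv:
  assumes F: "H1_deriv M F f" and f: "H1_deriv N f f'"
  shows "ac_deriv (Hilbert_integral F) (Hilbert_integral f)"
  unfolding ac_deriv_def
proof (intro conjI allI impI)
  note mf [measurable] = L2_measurable[OF H1_derivD(2)[OF f]]
  note [measurable] = Hilbert_integral_measurable[OF mf] symmetric_quotient_measurable_pair[OF mf]
  note ind = integrable_indicator_Icc
  show "locally_integrable (Hilbert_integral f)"
    unfolding locally_integrable_def set_integrable_def
  proof (intro allI)
    fix a b :: real
    show "integrable lborel (\<lambda>x. indicator {a..b} x *\<^sub>R Hilbert_integral f x)"
      by (rule Bochner_Integration.integrable_bound[OF ind[of a b "Hilbert_const * N"]])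
         (auto intro!: AE_I2 order_trans[OF Hilbert_integral_bound[OF f]] simp: indicator_def)
  qed
  fix a b :: real assume ab: "a \<le> b"
  define k where "k x h = indicator {a..b} x *\<^sub>R symmetric_quotient f x h" for x h
  have mk [measurable]: "case_prod k \<in> borel_measurable (lborel \<Otimes>\<^sub>M lborel)"
    unfolding k_def[abs_def] split_beta' using symmetric_quotient_measurable_pair[OF mf]
    by (auto simp: split_beta')
  have pair: "integrable (lborel \<Otimes>\<^sub>M lborel) (case_prod k)"
  proof (rule lborel_pair.Fubini_integrable[OF mk])
    have "(\<lambda>x. LINT h|lborel. norm (case_prod k (x, h))) \<in> borel_measurable lborel" by measurable
    then show "integrable lborel (\<lambda>x. LINT h|lborel. norm (case_prod k (x, h)))"
      by (rule Bochner_Integration.integrable_bound[OF ind[of a b "Hilbert_const * N"]])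
         (use symmetric_quotient_integrable(2)[OF f] in \<open>auto simp: k_def indicator_def
            intro!: AE_I2 order_trans[OF _ abs_ge_self]\<close>)
    show "AE x in lborel. integrable lborel (\<lambda>h. case_prod k (x, h))"
      using symmetric_quotient_integrable(1)[OF f] by (auto simp: k_def)
  qed
  have inner: "(LINT x|lborel. k x h) = symmetric_quotient F b h - symmetric_quotient F a h" for h
  proof -
    have *: "set_integrable lborel {a..b} (\<lambda>x. f (x + c))" "(LINT x:{a..b}|lborel. f (x + c)) = F (b + c) - F (a + c)" for c
    proof -
      have e: "indicator {a+c..b+c} (c + 1 * x) *\<^sub>R f (c + 1 * x) = indicator {a..b} x *\<^sub>R f (x + c)" for x
        by (auto simp: indicator_def add.commute)
      have "integrable lborel (\<lambda>y. indicator {a+c..b+c} y *\<^sub>R f y)"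
        using locally_integrableD[OF L2_locally_integrable[OF H1_derivD(2)[OF f]]] by (simp add: set_integrable_def)
      from lborel_integrable_real_affine[OF this, of 1 c]
      show "set_integrable lborel {a..b} (\<lambda>x. f (x + c))" unfolding e set_integrable_def by simp
      have "F (b + c) - F (a + c) = (LINT y|lborel. indicator {a+c..b+c} y *\<^sub>R f y)"
        using ac_derivD[OF H1_derivD(1)[OF F], of "a+c" "b+c"] ab by (simp add: set_lebesgue_integral_def)
      also have "\<dots> = (LINT x:{a..b}|lborel. f (x + c))"
        using lborel_integral_real_affine[of 1 "\<lambda>y. indicator {a+c..b+c} y *\<^sub>R f y" c]
        unfolding e set_lebesgue_integral_def by simp
      finally show "(LINT x:{a..b}|lborel. f (x + c)) = F (b + c) - F (a + c)" by simp
    qed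
    have "(LINT x|lborel. k x h) = (LINT x:{a..b}|lborel. (f (x + - h) - f (x + h)) / of_real h)"
      unfolding k_def set_lebesgue_integral_def symmetric_quotient_def by simp
    also have "\<dots> = ((F (b - h) - F (a - h)) - (F (b + h) - F (a + h))) / of_real h"
      using *(2)[of "-h"] *(2)[of h] set_integral_diff(2)[OF *(1)[of "-h"] *(1)[of h]] by simp
    finally show ?thesis by (simp add: symmetric_quotient_def diff_divide_distrib)
  qed
  have "(LINT x:{a..b}|lborel. Hilbert_integral f x) =
     (LINT x|lborel. of_real (1 / (2 * pi)) * (LINT h|lborel. k x h))"
    unfolding set_lebesgue_integral_def
    by (rule Bochner_Integration.integral_cong) (auto simp: k_def Hilbert_integral_def indicator_def)
  also have "\<dots> = of_real (1 / (2 * pi)) * (LINT x|lborel. LINT h|lborel. k x h)" by simp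
  also have "(LINT x|lborel. LINT h|lborel. k x h) = (LINT h|lborel. symmetric_quotient F b h - symmetric_quotient F a h)"
    unfolding lborel_pair.Fubini_integral[OF pair, symmetric] inner ..
  also have "\<dots> = (LINT h|lborel. symmetric_quotient F b h) - (LINT h|lborel. symmetric_quotient F a h)"
    by (intro Bochner_Integration.integral_diff symmetric_quotient_integrable[OF F])
  finally show "Hilbert_integral F b - Hilbert_integral F a = (LINT x:{a..b}|lborel. Hilbert_integral f x)"
    by (simp add: Hilbert_integral_def right_diff_distrib)
qed

text \<open>The integral is written once with y = x - h and once with y = x + h, and the two forms
  are averaged; each converges because the truncated kernel is in L2.\<close>

lemma truncated_Hilbert_integral:
  assumes F: "F \<in> L2" and \<epsilon>: "0 < \<epsilon>"
  shows "(LINT y:{y. \<epsilon> < \<bar>x - y\<bar>}|lborel. F y / of_real (x - y)) =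
    (1 / 2) * (LINT h|lborel. indicator {h. \<epsilon> < \<bar>h\<bar>} h *\<^sub>R symmetric_quotient F x h)"
    (is "?A = _")
proof -
  let ?g = "\<lambda>y. indicator {y. \<epsilon> < \<bar>x - y\<bar>} y *\<^sub>R (F y / of_real (x - y))"
  note k = far_kernel_in_L2[OF \<epsilon>]
  have 1: "?A = (LINT h|lborel. F (x - h) * of_real (far_kernel \<epsilon> h))"
  proof -
    have "?A = (LINT h|lborel. ?g (x + (-1) * h))"
      unfolding set_lebesgue_integral_def using lborel_integral_real_affine[of "-1" ?g x] by simp
    also have "\<dots> = (LINT h|lborel. F (x - h) * of_real (far_kernel \<epsilon> h))"
      by (rule Bochner_Integration.integral_cong) (auto simp: far_kernel_def indicator_def)
    finally show ?thesis .
  qed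
  have 2: "?A = - (LINT h|lborel. F (x + h) * of_real (far_kernel \<epsilon> h))"
  proof -
    have "?A = (LINT h|lborel. ?g (x + 1 * h))"
      unfolding set_lebesgue_integral_def using lborel_integral_real_affine[of 1 ?g x] by simp
    also have "\<dots> = (LINT h|lborel. - (F (x + h) * of_real (far_kernel \<epsilon> h)))"
      by (rule Bochner_Integration.integral_cong) (auto simp: far_kernel_def indicator_def)
    finally show ?thesis by simp
  qed
  have i: "integrable lborel (\<lambda>h. F (x - h) * of_real (far_kernel \<epsilon> h))" "integrable lborel (\<lambda>h. F (x + h) * of_real (far_kernel \<epsilon> h))"
    by (intro L2_mult_integrable L2_reflect L2_shift F k)+
  have "?A + ?A = (LINT h|lborel. F (x - h) * of_real (far_kernel \<epsilon> h)) - (LINT h|lborel. F (x + h) * of_real (far_kernel \<epsilon> h))"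
    using 1 2 by simp
  also have "\<dots> = (LINT h|lborel. F (x - h) * of_real (far_kernel \<epsilon> h) - F (x + h) * of_real (far_kernel \<epsilon> h))"
    using i by simp
  also have "\<dots> = (LINT h|lborel. indicator {h. \<epsilon> < \<bar>h\<bar>} h *\<^sub>R symmetric_quotient F x h)"
    by (rule Bochner_Integration.integral_cong)
       (auto simp: far_kernel_def symmetric_quotient_def indicator_def diff_divide_distrib)
  finally show ?thesis by (simp add: field_simps)
qed

lemma Hilbert_transform_eq_integral:
  assumes F: "H1_deriv M F f"
  shows "Hilbert_transform F x = Hilbert_integral F x"
proof -
  note mF = L2_measurable[OF H1_derivD(2)[OF F]]
  note [measurable] = symmetric_quotient_measurable[OF mF]
  let ?s = "\<lambda>\<epsilon> h. indicator {h. \<epsilon> < \<bar>h\<bar>} h *\<^sub>R symmetric_quotient F x h"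
  \<comment> \<open>Dominated convergence is applied along t = 1/\<epsilon>, which turns the limit
    at 0 into one at infinity.\<close>
  have "((\<lambda>t. LINT h|lborel. ?s (inverse t) h) \<longlongrightarrow> (LINT h|lborel. symmetric_quotient F x h)) at_top"
  proof (rule integral_dominated_convergence_at_top)
    show "integrable lborel (\<lambda>h. cmod (symmetric_quotient F x h))"
      by (intro integrable_norm symmetric_quotient_integrable[OF F])
    show "AE h in lborel. ((\<lambda>t. ?s (inverse t) h) \<longlongrightarrow> symmetric_quotient F x h) at_top"
    proof (rule AE_I2)
      fix h
      show "((\<lambda>t. ?s (inverse t) h) \<longlongrightarrow> symmetric_quotient F x h) at_top"
      proof (cases "h = 0")
        case False
        then have "\<forall>\<^sub>F t in at_top. inverse t < \<bar>h\<bar>"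
          using order_tendstoD(2)[OF tendsto_inverse_0_at_top[OF filterlim_ident], of "\<bar>h\<bar>"] by simp
        then have "\<forall>\<^sub>F t in at_top. symmetric_quotient F x h = ?s (inverse t) h"
          by eventually_elim simp
        then show ?thesis by (rule Lim_transform_eventually[OF tendsto_const])
      \<comment> \<open>At h = 0 the quotient is 0 / 0 = 0, as is its truncation.\<close>
      qed (simp add: symmetric_quotient_def)
    qed
  qed (auto simp: indicator_def intro!: always_eventually)
  then have "((\<lambda>\<epsilon>. LINT h|lborel. ?s \<epsilon> h) \<longlongrightarrow> (LINT h|lborel. symmetric_quotient F x h)) (at_right 0)"
    by (subst filterlim_at_right_to_top)
  then have "((\<lambda>\<epsilon>. (1 / 2) * (LINT h|lborel. ?s \<epsilon> h)) \<longlongrightarrow> (1 / 2) * (LINT h|lborel. symmetric_quotient F x h)) (at_right 0)"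
    by (intro tendsto_intros)
  moreover have "\<forall>\<^sub>F \<epsilon> in at_right 0. (1 / 2) * (LINT h|lborel. ?s \<epsilon> h) =
      (LINT y:{y. \<epsilon> < \<bar>x - y\<bar>}|lborel. F y / of_real (x - y))"
    using eventually_at_right_less by eventually_elim (use truncated_Hilbert_integral[OF H1_derivD(2)[OF F]] in simp)
  ultimately have "((\<lambda>\<epsilon>. LINT y:{y. \<epsilon> < \<bar>x - y\<bar>}|lborel. F y / of_real (x - y)) \<longlongrightarrow>
     (1 / 2) * (LINT h|lborel. symmetric_quotient F x h)) (at_right 0)"
    by (rule Lim_transform_eventually)
  then have lim: "Lim (at_right 0) (\<lambda>\<epsilon>. LINT y:{y. \<epsilon> < \<bar>x - y\<bar>}|lborel. F y / of_real (x - y)) =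
     (1 / 2) * (LINT h|lborel. symmetric_quotient F x h)"
    by (intro tendsto_Lim) auto
  show ?thesis unfolding Hilbert_transform_def Hilbert_integral_def lim by simp
qed

lemma Hilbert_transform_cong_AE:
  assumes [measurable]: "f \<in> borel_measurable borel" "g \<in> borel_measurable borel"
    and "AE x in lborel. f x = g x"
  shows "Hilbert_transform f x = Hilbert_transform g x"
proof -
  have "(LINT y:{y. \<epsilon> < \<bar>x - y\<bar>}|lborel. f y / of_real (x - y)) =
        (LINT y:{y. \<epsilon> < \<bar>x - y\<bar>}|lborel. g y / of_real (x - y))" for \<epsilon>
    unfolding set_lebesgue_integral_def by (rule integral_cong_AE) (use assms(3) in auto)
  then show ?thesis by (simp add: Hilbert_transform_def)
qed

section \<open>Chains of derivatives\<close>

text \<open>Precise representatives of an H^4 function and its derivatives: \<open>p 0\<close> to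
  \<open>p 3\<close> are absolutely continuous, \<open>p 4\<close> is only square integrable, later
  entries are arbitrary.\<close>

definition Sobolev_chain :: "real \<Rightarrow> (nat \<Rightarrow> real \<Rightarrow> complex) \<Rightarrow> bool" where
  "Sobolev_chain M p \<longleftrightarrow> (\<forall>j<4. H1_deriv M (p j) (p (Suc j)))"

lemma Sobolev_chainD: "Sobolev_chain M p \<Longrightarrow> j < 4 \<Longrightarrow> H1_deriv M (p j) (p (Suc j))"
  by (simp add: Sobolev_chain_def)

lemma Sobolev_chain_H1:
  assumes "Sobolev_chain M p"
  shows "H1_deriv M (p 0) (p 1)" "H1_deriv M (p 1) (p 2)" "H1_deriv M (p 2) (p 3)" "H1_deriv M (p 3) (p 4)"
  using Sobolev_chainD[OF assms, of 0] Sobolev_chainD[OF assms, of 1] Sobolev_chainD[OF assms, of 2]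
    Sobolev_chainD[OF assms, of 3] by (simp_all add: numeral_eq_Suc)

lemma Sobolev_chain_L2:
  assumes "Sobolev_chain M p" "j \<le> 4" shows "p j \<in> L2" "L2_norm (p j) \<le> M"
proof -
  have "p j \<in> L2 \<and> L2_norm (p j) \<le> M"
  proof (cases "j < 4")
    case True
    then show ?thesis using H1_derivD[OF Sobolev_chainD[OF assms(1) True]] by simp
  next
    case False
    then have "j = 4" using assms(2) by simp
    then show ?thesis using H1_derivD[OF Sobolev_chain_H1(4)[OF assms(1)]] by simp
  qed
  then show "p j \<in> L2" "L2_norm (p j) \<le> M" by auto
qed

lemma Sobolev_chain_add:
  assumes "Sobolev_chain M p" "Sobolev_chain N q"
  shows "Sobolev_chain (M + N) (\<lambda>j x. p j x + q j x)"
  using assms by (auto simp: Sobolev_chain_def intro: H1_deriv_add)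

lemma Sobolev_chain_diff:
  assumes "Sobolev_chain M p" "Sobolev_chain N q"
  shows "Sobolev_chain (M + N) (\<lambda>j x. p j x - q j x)"
proof -
  have "H1_deriv N (\<lambda>x. - F x) (\<lambda>x. - f x)" if "H1_deriv N F f" for F f
    using that ac_deriv_cmult[of F f "-1"] L2_cmult[of F "-1"] L2_cmult[of f "-1"]
      L2_norm_cmult[of "-1" F] L2_norm_cmult[of "-1" f]
    by (simp add: H1_deriv_def)
  then have "Sobolev_chain N (\<lambda>j x. - q j x)" using assms(2) by (simp add: Sobolev_chain_def)
  from Sobolev_chain_add[OF assms(1) this] show ?thesis by simp
qed

lemma Sobolev_chain_exists:
  assumes u: "u \<in> Sobolev 4"
  obtains p M where "Sobolev_chain M p" "\<And>j. j \<le> 4 \<Longrightarrow> has_weak_deriv j u (p j)"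
    "AE x in lborel. u x = p 0 x"
proof -
  have "\<forall>j. \<exists>g. j \<le> 4 \<longrightarrow> g \<in> L2 \<and> has_weak_deriv j u g" using u by (auto simp: Sobolev_def)
  then obtain g where g: "\<And>j. j \<le> 4 \<Longrightarrow> g j \<in> L2" "\<And>j. j \<le> 4 \<Longrightarrow> has_weak_deriv j u (g j)" by metis
  have "\<exists>F. ac_deriv F (g (Suc j)) \<and> (AE x in lborel. g j x = F x)" if "j < 4" for j
    using has_weak_deriv_imp_ac_deriv[OF has_weak_deriv_Suc[OF g(2)[of j] g(2)[of "Suc j"]]] that by auto
  then obtain F where F: "\<And>j. j < 4 \<Longrightarrow> ac_deriv (F j) (g (Suc j))"
    "\<And>j. j < 4 \<Longrightarrow> AE x in lborel. g j x = F j x" by metis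
  \<comment> \<open>The absolutely continuous representative wherever a further derivative exists;
    the top derivative keeps the given one.\<close>
  define p where "p j = (if j < 4 then F j else g 4)" for j
  have gp: "AE x in lborel. g j x = p j x" if "j \<le> 4" for j
    using F(2)[of j] that by (cases "j < 4") (auto simp: p_def)
  have meas: "p j \<in> borel_measurable borel" if "j \<le> 4" for j
    using that by (cases "j < 4") (auto simp: p_def intro: ac_deriv_measurable[OF F(1)] L2_measurable[OF g(1)])
  have L2: "p j \<in> L2" if "j \<le> 4" for j
    by (rule L2_cong_AE[OF g(1) meas gp]) (use that in auto)
  have ac: "ac_deriv (p j) (p (Suc j))" if "j < 4" for j
    using ac_deriv_cong_AE[OF F(1)[OF that] gp meas] that by (simp add: p_def)
  define M where "M = (\<Sum>j\<le>4. L2_norm (p j))"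
  have M: "L2_norm (p j) \<le> M" if "j \<le> 4" for j
    unfolding M_def by (rule member_le_sum) (use that in auto)
  show ?thesis
  proof (rule that[of M p])
    show "Sobolev_chain M p" using ac L2 M by (simp add: Sobolev_chain_def H1_deriv_def)
    have um: "u \<in> borel_measurable borel" using u by (auto simp: Sobolev_def L2_def)
    show "has_weak_deriv j u (p j)" if "j \<le> 4" for j
      by (rule has_weak_deriv_cong_AE[OF g(2)[OF that] _ gp[OF that] um meas[OF that]]) simp
    from this[of 0] have "has_weak_deriv 0 u (p 0)" by simp
    moreover have "locally_integrable u" using u by (intro L2_locally_integrable) (simp add: Sobolev_def)
    ultimately show "AE x in lborel. u x = p 0 x"
      using has_weak_deriv_unique[OF has_weak_deriv_0] by blast
  qed
qed

section \<open>The potential\<close>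

text \<open>The successive derivatives of the square of the modulus, written as sums of products without
  collecting equal terms, so that each is syntactically the derivative of the previous one.\<close>

definition chain_prod :: "(nat \<Rightarrow> real \<Rightarrow> complex) \<Rightarrow> nat \<Rightarrow> nat \<Rightarrow> real \<Rightarrow> complex" where
  "chain_prod p i j x = p i x * cnj (p j x)"

fun density_deriv :: "(nat \<Rightarrow> real \<Rightarrow> complex) \<Rightarrow> nat \<Rightarrow> nat \<Rightarrow> nat \<Rightarrow> real \<Rightarrow> complex" where
  "density_deriv p 0 i j = chain_prod p i j"
| "density_deriv p (Suc k) i j = (\<lambda>x. density_deriv p k (Suc i) j x + density_deriv p k i (Suc j) x)"

text \<open>The constant is that of \<open>H1_deriv_mult\<close>, doubled by every further
  derivative. The index bounds keep the last derivative at order at most 4.\<close>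

lemma density_deriv_H1:
  assumes "Sobolev_chain M p" "i + k < 4" "j + k < 4"
  shows "H1_deriv (2 ^ k * (4 * M\<^sup>2)) (density_deriv p k i j) (density_deriv p (Suc k) i j)"
  using assms(2,3)
proof (induction k arbitrary: i j)
  case 0
  have "H1_deriv (4 * M * M) (\<lambda>x. p i x * cnj (p j x))
     (\<lambda>x. p (Suc i) x * cnj (p j x) + p i x * cnj (p (Suc j) x))"
    using 0 by (intro H1_deriv_mult H1_deriv_cnj Sobolev_chainD[OF assms(1)]) auto
  then show ?case by (simp add: chain_prod_def[abs_def] power2_eq_square mult.assoc)
next
  case (Suc k)
  have "H1_deriv (2 ^ k * (4 * M\<^sup>2) + 2 ^ k * (4 * M\<^sup>2))
     (\<lambda>x. density_deriv p k (Suc i) j x + density_deriv p k i (Suc j) x)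
     (\<lambda>x. density_deriv p (Suc k) (Suc i) j x + density_deriv p (Suc k) i (Suc j) x)"
    using Suc.prems by (intro H1_deriv_add Suc.IH) auto
  then show ?case by (simp add: mult_ac)
qed

text \<open>G for k = 0 and its derivatives for k = 1, 2; the shift by \<open>Suc\<close> is the
  derivative already contained in G.\<close>

definition potential :: "(nat \<Rightarrow> real \<Rightarrow> complex) \<Rightarrow> nat \<Rightarrow> real \<Rightarrow> complex" where
  "potential p k x = Hilbert_integral (density_deriv p (Suc k) 0 0) x + (- \<i>) * density_deriv p (Suc k) 0 0 x"

lemma potential_ac_deriv:
  assumes p: "Sobolev_chain M p" and k: "k < 2"
  shows "ac_deriv (potential p k) (potential p (Suc k))"
proof -
  have 1: "H1_deriv (2 ^ Suc k * (4 * M\<^sup>2)) (density_deriv p (Suc k) 0 0) (density_deriv p (Suc (Suc k)) 0 0)"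
    using k by (intro density_deriv_H1[OF p]) auto
  \<comment> \<open>For k = 1 the last derivative of the density has order 4, the highest
    available.\<close>
  have 2: "H1_deriv (2 ^ Suc (Suc k) * (4 * M\<^sup>2)) (density_deriv p (Suc (Suc k)) 0 0) (density_deriv p (Suc (Suc (Suc k))) 0 0)"
    using k by (intro density_deriv_H1[OF p]) auto
  show ?thesis unfolding potential_def[abs_def]
    by (intro ac_deriv_add ac_deriv_cmult Hilbert_integral_ac_deriv[OF 1 2] H1_derivD(1)[OF 1])
qed

text \<open>32 is 2 ^ 3 times 4, the constant of \<open>density_deriv_H1\<close> for G''; the
  summand 2 is the Sobolev constant of \<open>H1_deriv_bound\<close>.\<close>

definition potential_bound :: "real \<Rightarrow> real" where
  "potential_bound M = (Hilbert_const + 2) * (32 * M\<^sup>2)"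

lemma potential_bound_nonneg: "0 \<le> potential_bound M"
  using Hilbert_const_nonneg by (simp add: potential_bound_def)

lemma potential_le:
  assumes p: "Sobolev_chain M p" and k: "k \<le> 2"
  shows "cmod (potential p k x) \<le> potential_bound M"
proof -
  have "H1_deriv (2 ^ Suc k * (4 * M\<^sup>2)) (density_deriv p (Suc k) 0 0) (density_deriv p (Suc (Suc k)) 0 0)"
    using k by (intro density_deriv_H1[OF p]) auto
  moreover have "2 ^ Suc k * (4 * M\<^sup>2) \<le> 8 * (4 * M\<^sup>2)"
    using power_increasing[of "Suc k" 3 "2::real"] k by (intro mult_right_mono) auto
  ultimately have H: "H1_deriv (32 * M\<^sup>2) (density_deriv p (Suc k) 0 0) (density_deriv p (Suc (Suc k)) 0 0)"
    by (auto intro: H1_deriv_mono)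
  have "cmod (potential p k x) \<le> cmod (Hilbert_integral (density_deriv p (Suc k) 0 0) x) + cmod (density_deriv p (Suc k) 0 0 x)"
    using norm_triangle_ineq[of "Hilbert_integral (density_deriv p (Suc k) 0 0) x" "(- \<i>) * density_deriv p (Suc k) 0 0 x"]
    by (simp only: potential_def norm_mult norm_minus_cancel norm_ii mult_1)
  also have "\<dots> \<le> Hilbert_const * (32 * M\<^sup>2) + 2 * (32 * M\<^sup>2)"
    by (intro add_mono Hilbert_integral_bound[OF H] H1_deriv_bound[OF H])
  finally show ?thesis by (simp add: potential_bound_def algebra_simps)
qed

text \<open>\<open>D\<close> is some representative of the weak derivative, but the Hilbert
  transform is built from integrals and so agrees at every point with that of the continuous
  representative.\<close>

lemma potential_eq_nonlinearity:
  assumes p: "Sobolev_chain M p" and u: "AE x in lborel. u x = p 0 x" and [measurable]: "u \<in> borel_measurable borel"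
  defines "D \<equiv> weak_deriv 1 (\<lambda>x. of_real ((cmod (u x))\<^sup>2))"
  shows "AE x in lborel. Hilbert_transform D x - \<i> * D x = potential p 0 x"
proof -
  note [measurable] = L2_measurable[OF Sobolev_chain_L2(1)[OF p, of 0, simplified]]
  have H0: "H1_deriv (2 ^ 0 * (4 * M\<^sup>2)) (density_deriv p 0 0 0) (density_deriv p (Suc 0) 0 0)"
    by (rule density_deriv_H1[OF p]) auto
  have H1: "H1_deriv (2 ^ Suc 0 * (4 * M\<^sup>2)) (density_deriv p (Suc 0) 0 0) (density_deriv p (Suc (Suc 0)) 0 0)"
    by (rule density_deriv_H1[OF p]) auto
  have w: "has_weak_deriv 1 (density_deriv p 0 0 0) (density_deriv p (Suc 0) 0 0)"
    by (rule ac_deriv_has_weak_deriv[OF H1_derivD(1)[OF H0]])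
  have "AE x in lborel. of_real ((cmod (u x))\<^sup>2) = density_deriv p 0 0 0 x"
    using u by eventually_elim (simp add: chain_prod_def complex_norm_square del: of_real_power)
  then have D: "D = weak_deriv 1 (density_deriv p 0 0 0)"
    unfolding D_def
    by (rule weak_deriv_cong_AE) (use L2_measurable[OF H1_derivD(2)[OF H0]] in auto)
  have AE: "AE x in lborel. D x = density_deriv p (Suc 0) 0 0 x"
    unfolding D by (rule AE_weak_deriv[OF w])
  have "D \<in> borel_measurable borel"
    unfolding D using has_weak_deriv_weak_deriv[OF w] by (simp add: has_weak_deriv_def locally_integrable_measurable)
  then have transform: "Hilbert_transform D x = Hilbert_integral (density_deriv p (Suc 0) 0 0) x" for x
    using Hilbert_transform_cong_AE[OF _ L2_measurable[OF H1_derivD(2)[OF H1]] AE]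
      Hilbert_transform_eq_integral[OF H1] by simp
  from AE show ?thesis by eventually_elim (simp add: transform potential_def)
qed

section \<open>Weighted energies\<close>

text \<open>Only the majorant has to be checked for integrability: a non-integrable \<open>f\<close>
  has integral 0 by convention, and \<open>g\<close> is nonnegative.\<close>

lemma norm_integral_le:
  fixes f :: "'a \<Rightarrow> 'b::{banach, second_countable_topology}"
  assumes "integrable M g" "\<And>x. norm (f x) \<le> g x"
  shows "norm (\<integral>x. f x \<partial>M) \<le> (\<integral>x. g x \<partial>M)"
proof -
  have "norm (\<integral>x. f x \<partial>M) \<le> (\<integral>x. norm (f x) \<partial>M)" by (rule integral_norm_bound)
  also have "\<dots> \<le> (\<integral>x. g x \<partial>M)"
    by (rule integral_mono'[OF assms(1)]) (use assms(2) order_trans[OF norm_ge_zero] in blast)+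
  finally show ?thesis .
qed

lemma mult_le_sum_squares: "(a::real) * b \<le> a\<^sup>2 / 2 + b\<^sup>2 / 2"
  using sum_squares_bound[of a b] by simp

text \<open>Dominates each of the three coefficients that \<open>energy_rate_le\<close> collects for
  E_0, E_2 and 1; it depends on \<open>M\<close> alone and not on the weight.\<close>

definition growth_rate :: "real \<Rightarrow> real" where
  "growth_rate M = 3 + 2 * M\<^sup>2 + 8 * potential_bound M + 2 * potential_bound M * M\<^sup>2"

text \<open>The bounds are of two kinds. \<open>L\<close> may blow up as the truncation is removed
  and serves only finiteness and limits at a fixed weight; the last assumption has an absolute
  constant and is the one behind the growth rate.\<close>

locale energy_weight =
  fixes w w' w'' :: "real \<Rightarrow> real" and L :: real
  assumes w_DERIV: "\<And>x. (w has_real_derivative w' x) (at x)"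
    and w'_DERIV: "\<And>x. (w' has_real_derivative w'' x) (at x)"
    and w''_continuous: "continuous_on UNIV w''"
    and w_nonneg: "\<And>x. 0 \<le> w x"
    and w_le: "\<And>x. w x \<le> L" and w'_le: "\<And>x. \<bar>w' x\<bar> \<le> L" and w''_le: "\<And>x. \<bar>w'' x\<bar> \<le> L"
    and w'_square_le: "\<And>x. (w' x)\<^sup>2 \<le> 4 * w x"
begin

lemma w'_continuous: "continuous_on UNIV w'"
  by (intro continuous_at_imp_continuous_on ballI DERIV_isCont[OF w'_DERIV])

lemma w_continuous: "continuous_on UNIV w"
  by (intro continuous_at_imp_continuous_on ballI DERIV_isCont[OF w_DERIV])

lemma w_measurable [measurable]:
  "w \<in> borel_measurable borel" "w' \<in> borel_measurable borel" "w'' \<in> borel_measurable borel"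
  using w_continuous w'_continuous w''_continuous by (auto intro: borel_measurable_continuous_onI)

lemma w_ac_deriv: "ac_deriv (\<lambda>x. of_real (w x)) (\<lambda>x. of_real (w' x))"
  using w_DERIV by (intro ac_deriv_if_continuously_differentiable has_vector_derivative_of_real continuous_intros w'_continuous)
    (simp add: has_real_derivative_iff_has_vector_derivative)

lemma w'_ac_deriv: "ac_deriv (\<lambda>x. of_real (w' x)) (\<lambda>x. of_real (w'' x))"
  using w'_DERIV by (intro ac_deriv_if_continuously_differentiable has_vector_derivative_of_real continuous_intros w''_continuous)
    (simp add: has_real_derivative_iff_has_vector_derivative)

lemma w_norm_le: "cmod (of_real (w x)) \<le> L" "cmod (of_real (w' x)) \<le> L" "cmod (of_real (w'' x)) \<le> L"
  using w_le w_nonneg w'_le w''_le by (auto simp: abs_of_nonneg)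

text \<open>Young's inequality; the factor 4 in \<open>w'_square_le\<close> is what turns (w'/2)^2
  into \<open>w\<close>.\<close>

lemma w'_mult_le:
  assumes "0 \<le> a" "0 \<le> b"
  shows "\<bar>w' x\<bar> * a * b \<le> a\<^sup>2 * w x + b\<^sup>2"
proof -
  have "\<bar>w' x\<bar> * a * b = 2 * ((\<bar>w' x\<bar> / 2 * a) * b)" by simp
  also have "\<dots> \<le> (\<bar>w' x\<bar> / 2 * a)\<^sup>2 + b\<^sup>2"
    using sum_squares_bound[of "\<bar>w' x\<bar> / 2 * a" b] by simp
  also have "(\<bar>w' x\<bar> / 2 * a)\<^sup>2 = (w' x)\<^sup>2 / 4 * a\<^sup>2" by (simp add: power_mult_distrib power_divide)
  also have "\<dots> \<le> w x * a\<^sup>2" using w'_square_le[of x] by (intro mult_right_mono) auto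
  finally show ?thesis by (simp add: mult.commute)
qed

definition energy :: "(real \<Rightarrow> complex) \<Rightarrow> real" where
  "energy f = (LINT x|lborel. (cmod (f x))\<^sup>2 * w x)"

lemma energy_integrable: assumes "f \<in> L2" shows "integrable lborel (\<lambda>x. (cmod (f x))\<^sup>2 * w x)"
proof (rule Bochner_Integration.integrable_bound)
  note [measurable] = L2_measurable[OF assms]
  show "integrable lborel (\<lambda>x. (cmod (f x))\<^sup>2 * L)"
    using L2_integrable_square[OF assms] by simp
  show "(\<lambda>x. (cmod (f x))\<^sup>2 * w x) \<in> borel_measurable lborel" by measurable
  show "AE x in lborel. norm ((cmod (f x))\<^sup>2 * w x) \<le> norm ((cmod (f x))\<^sup>2 * L)"
    using w_le w_nonneg order_trans[OF w_nonneg w_le]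
    by (auto simp: abs_mult abs_of_nonneg intro!: mult_left_mono)
qed

lemma energy_nonneg: "0 \<le> energy f"
  unfolding energy_def using w_nonneg by (intro integral_nonneg_AE AE_I2 mult_nonneg_nonneg) auto

lemma energy_eq: "complex_of_real (energy f) = (LINT x|lborel. f x * (of_real (w x) * cnj (f x)))"
  unfolding energy_def integral_complex_of_real[symmetric]
proof (rule Bochner_Integration.integral_cong[OF refl])
  fix x
  have "complex_of_real ((cmod (f x))\<^sup>2 * w x) = (f x * cnj (f x)) * of_real (w x)"
    unfolding of_real_mult complex_norm_square ..
  then show "complex_of_real ((cmod (f x))\<^sup>2 * w x) = f x * (of_real (w x) * cnj (f x))"
    by (simp only: mult_ac)
qed

lemma H1_deriv_w:
  "H1_deriv M F f \<Longrightarrow> H1_deriv (2 * L * M) (\<lambda>x. of_real (w x) * F x) (\<lambda>x. of_real (w' x) * F x + of_real (w x) * f x)"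
  by (rule H1_deriv_bounded_mult[OF _ w_ac_deriv w_norm_le(1,2)])

lemma H1_deriv_w':
  "H1_deriv M F f \<Longrightarrow> H1_deriv (2 * L * M) (\<lambda>x. of_real (w' x) * F x) (\<lambda>x. of_real (w'' x) * F x + of_real (w' x) * f x)"
  by (rule H1_deriv_bounded_mult[OF _ w'_ac_deriv w_norm_le(2,3)])

text \<open>In the term containing w' the weight is put on \<open>p 0\<close>, which leaves an
  unweighted square of \<open>p 1\<close> at the cost of M^2.\<close>

lemma energy_interpolation:
  assumes p: "Sobolev_chain M p"
  shows "energy (p 1) \<le> 2 * energy (p 0) + energy (p 2) + M\<^sup>2"
proof -
  note H = Sobolev_chain_H1[OF p]
  have L: "p 0 \<in> L2" "p 1 \<in> L2" "p 2 \<in> L2" using Sobolev_chain_L2[OF p] by auto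
  have "complex_of_real (energy (p 1)) = - (LINT x|lborel. p 0 x * (of_real (w' x) * cnj (p 1 x) + of_real (w x) * cnj (p 2 x)))"
    unfolding energy_eq by (rule H1_deriv_integral_by_parts[OF H(1) H1_deriv_w[OF H1_deriv_cnj[OF H(2)]]])
  then have "cmod (complex_of_real (energy (p 1))) = cmod (LINT x|lborel. p 0 x * (of_real (w' x) * cnj (p 1 x) + of_real (w x) * cnj (p 2 x)))"
    by (simp only: norm_minus_cancel)
  then have "energy (p 1) = cmod (LINT x|lborel. p 0 x * (of_real (w' x) * cnj (p 1 x) + of_real (w x) * cnj (p 2 x)))"
    using energy_nonneg[of "p 1"] by (simp only: norm_of_real abs_of_nonneg)
  also have "\<dots> \<le> (LINT x|lborel. ((cmod (p 0 x))\<^sup>2 * w x + (cmod (p 1 x))\<^sup>2) + ((cmod (p 0 x))\<^sup>2 * w x + (cmod (p 2 x))\<^sup>2 * w x))"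
  proof (rule norm_integral_le)
    show "integrable lborel (\<lambda>x. ((cmod (p 0 x))\<^sup>2 * w x + (cmod (p 1 x))\<^sup>2) + ((cmod (p 0 x))\<^sup>2 * w x + (cmod (p 2 x))\<^sup>2 * w x))"
      by (intro Bochner_Integration.integrable_add energy_integrable L L2_integrable_square)
    fix x
    have "cmod (p 0 x * (of_real (w' x) * cnj (p 1 x) + of_real (w x) * cnj (p 2 x))) \<le>
      cmod (p 0 x) * (cmod (of_real (w' x) * cnj (p 1 x)) + cmod (of_real (w x) * cnj (p 2 x)))"
      unfolding norm_mult[of "p 0 x"] by (intro mult_left_mono norm_triangle_ineq) auto
    also have "\<dots> = \<bar>w' x\<bar> * cmod (p 0 x) * cmod (p 1 x) + cmod (p 0 x) * cmod (p 2 x) * w x"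
      using w_nonneg[of x] by (simp add: norm_mult algebra_simps)
    also have "\<dots> \<le> ((cmod (p 0 x))\<^sup>2 * w x + (cmod (p 1 x))\<^sup>2) + ((cmod (p 0 x))\<^sup>2 / 2 + (cmod (p 2 x))\<^sup>2 / 2) * w x"
      by (intro add_mono w'_mult_le mult_right_mono mult_le_sum_squares w_nonneg) auto
    also have "\<dots> \<le> ((cmod (p 0 x))\<^sup>2 * w x + (cmod (p 1 x))\<^sup>2) + ((cmod (p 0 x))\<^sup>2 + (cmod (p 2 x))\<^sup>2) * w x"
      by (intro add_mono order_refl mult_right_mono w_nonneg) auto
    finally show "cmod (p 0 x * (of_real (w' x) * cnj (p 1 x) + of_real (w x) * cnj (p 2 x))) \<le>
       ((cmod (p 0 x))\<^sup>2 * w x + (cmod (p 1 x))\<^sup>2) + ((cmod (p 0 x))\<^sup>2 * w x + (cmod (p 2 x))\<^sup>2 * w x)"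
      by (simp only: distrib_right)
  qed
  also have "\<dots> = (energy (p 0) + (L2_norm (p 1))\<^sup>2) + (energy (p 0) + energy (p 2))"
    using energy_integrable[OF L(1)] energy_integrable[OF L(3)] L2_integrable_square[OF L(2)]
    unfolding energy_def L2_norm_square
    by (simp only: Bochner_Integration.integral_add Bochner_Integration.integrable_add)
  also have "(L2_norm (p 1))\<^sup>2 \<le> M\<^sup>2" using Sobolev_chain_L2(2)[OF p, of 1] by (intro power_mono) auto
  finally show ?thesis by simp
qed

text \<open>
  This is $(\bar p_2 w)''$. As $u$ is differentiable in time only in $L^2$, difference quotients
  of $E_2$ are taken after moving two space derivatives onto this factor.
\<close>

definition adjoint_term :: "(nat \<Rightarrow> real \<Rightarrow> complex) \<Rightarrow> real \<Rightarrow> complex" where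
  "adjoint_term p x = of_real (w'' x) * cnj (p 2 x) + 2 * (of_real (w' x) * cnj (p 3 x)) + of_real (w x) * cnj (p 4 x)"

lemma adjoint_term_H1:
  assumes p: "Sobolev_chain M p"
  shows "H1_deriv (2 * L * M) (\<lambda>x. of_real (w x) * cnj (p 2 x)) (\<lambda>x. of_real (w' x) * cnj (p 2 x) + of_real (w x) * cnj (p 3 x))"
    "H1_deriv (2 * L * M + 2 * L * M) (\<lambda>x. of_real (w' x) * cnj (p 2 x) + of_real (w x) * cnj (p 3 x)) (adjoint_term p)"
proof -
  note H = Sobolev_chain_H1[OF p]
  show "H1_deriv (2 * L * M) (\<lambda>x. of_real (w x) * cnj (p 2 x)) (\<lambda>x. of_real (w' x) * cnj (p 2 x) + of_real (w x) * cnj (p 3 x))"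
    by (rule H1_deriv_w[OF H1_deriv_cnj[OF H(3)]])
  have "adjoint_term p = (\<lambda>x. (of_real (w'' x) * cnj (p 2 x) + of_real (w' x) * cnj (p 3 x)) +
     (of_real (w' x) * cnj (p 3 x) + of_real (w x) * cnj (p 4 x)))"
    by (simp add: adjoint_term_def fun_eq_iff)
  then show "H1_deriv (2 * L * M + 2 * L * M) (\<lambda>x. of_real (w' x) * cnj (p 2 x) + of_real (w x) * cnj (p 3 x)) (adjoint_term p)"
    using H1_deriv_add[OF H1_deriv_w'[OF H1_deriv_cnj[OF H(3)]] H1_deriv_w[OF H1_deriv_cnj[OF H(4)]]] by simp
qed

text \<open>Two integrations by parts, so the signs cancel.\<close>

lemma integral_adjoint_term:
  assumes "H1_deriv M F F1" "H1_deriv M' F1 F2" "Sobolev_chain N q"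
  shows "(LINT x|lborel. F x * adjoint_term q x) = (LINT x|lborel. F2 x * (of_real (w x) * cnj (q 2 x)))"
  using H1_deriv_integral_by_parts[OF assms(1) adjoint_term_H1(2)[OF assms(3)]]
    H1_deriv_integral_by_parts[OF assms(2) adjoint_term_H1(1)[OF assms(3)]] by simp

section \<open>Rates of change of the energies\<close>

text \<open>The dispersive term is not integrated by parts here: 2 |p_2| |p_0| w \<le> (|p_2|^2 +
  |p_0|^2) w is affordable because E_2 belongs to the total energy.\<close>

lemma energy0_rate_le:
  assumes p: "Sobolev_chain M p"
    and v: "AE x in lborel. v x = \<i> * p 2 x + \<i> * (p 0 x * potential p 0 x)"
    and [measurable]: "v \<in> borel_measurable borel"
  shows "\<bar>Re (LINT x|lborel. v x * (2 * (of_real (w x) * cnj (p 0 x))))\<bar>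
    \<le> (1 + 2 * potential_bound M) * energy (p 0) + energy (p 2)"
proof -
  let ?K = "potential_bound M"
  have L: "p 0 \<in> L2" "p 2 \<in> L2" using Sobolev_chain_L2[OF p] by auto
  note [measurable] = L2_measurable[OF L(1)] L2_measurable[OF L(2)] ac_deriv_measurable[OF potential_ac_deriv[OF p, of 0, simplified]]
  have v_eq: "(LINT x|lborel. v x * (2 * (of_real (w x) * cnj (p 0 x)))) =
    (LINT x|lborel. (\<i> * p 2 x + \<i> * (p 0 x * potential p 0 x)) * (2 * (of_real (w x) * cnj (p 0 x))))"
    by (rule integral_cong_AE) (use v in auto)
  have "cmod (LINT x|lborel. v x * (2 * (of_real (w x) * cnj (p 0 x)))) \<le>
    (LINT x|lborel. ((cmod (p 2 x))\<^sup>2 * w x + (cmod (p 0 x))\<^sup>2 * w x) + 2 * ?K * ((cmod (p 0 x))\<^sup>2 * w x))"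
    unfolding v_eq
  proof (rule norm_integral_le)
    show "integrable lborel (\<lambda>x. ((cmod (p 2 x))\<^sup>2 * w x + (cmod (p 0 x))\<^sup>2 * w x) + 2 * ?K * ((cmod (p 0 x))\<^sup>2 * w x))"
      by (intro Bochner_Integration.integrable_add integrable_mult_right energy_integrable L)
    fix x
    have "cmod ((\<i> * p 2 x + \<i> * (p 0 x * potential p 0 x)) * (2 * (of_real (w x) * cnj (p 0 x)))) =
      cmod (\<i> * p 2 x + \<i> * (p 0 x * potential p 0 x)) * (2 * (w x * cmod (p 0 x)))"
      using w_nonneg[of x] by (simp add: norm_mult)
    also have "\<dots> \<le> (cmod (p 2 x) + cmod (p 0 x) * ?K) * (2 * (w x * cmod (p 0 x)))"
    proof (rule mult_right_mono)
      have "cmod (\<i> * p 2 x + \<i> * (p 0 x * potential p 0 x)) \<le> cmod (p 2 x) + cmod (p 0 x) * cmod (potential p 0 x)"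
        using norm_triangle_ineq[of "\<i> * p 2 x" "\<i> * (p 0 x * potential p 0 x)"] by (simp add: norm_mult)
      also have "\<dots> \<le> cmod (p 2 x) + cmod (p 0 x) * ?K"
        using potential_le[OF p, of 0 x] by (intro add_left_mono mult_left_mono) auto
      finally show "cmod (\<i> * p 2 x + \<i> * (p 0 x * potential p 0 x)) \<le> cmod (p 2 x) + cmod (p 0 x) * ?K" .
    qed (use w_nonneg[of x] in auto)
    also have "\<dots> = 2 * (cmod (p 2 x) * cmod (p 0 x)) * w x + 2 * ?K * ((cmod (p 0 x))\<^sup>2 * w x)"
      by (simp add: algebra_simps power2_eq_square)
    also have "\<dots> \<le> ((cmod (p 2 x))\<^sup>2 + (cmod (p 0 x))\<^sup>2) * w x + 2 * ?K * ((cmod (p 0 x))\<^sup>2 * w x)"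
      using mult_le_sum_squares[of "cmod (p 2 x)" "cmod (p 0 x)"]
      by (intro add_right_mono mult_right_mono w_nonneg) auto
    finally show "cmod ((\<i> * p 2 x + \<i> * (p 0 x * potential p 0 x)) * (2 * (of_real (w x) * cnj (p 0 x)))) \<le>
      ((cmod (p 2 x))\<^sup>2 * w x + (cmod (p 0 x))\<^sup>2 * w x) + 2 * ?K * ((cmod (p 0 x))\<^sup>2 * w x)"
      by (simp only: distrib_right)
  qed
  also have "\<dots> = (energy (p 2) + energy (p 0)) + 2 * ?K * energy (p 0)"
  proof -
    note i0 = energy_integrable[OF L(1)] and i2 = energy_integrable[OF L(2)]
    have i: "integrable lborel (\<lambda>x. 2 * ?K * ((cmod (p 0 x))\<^sup>2 * w x))"
      by (rule integrable_mult_right[OF i0])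
    show ?thesis
      unfolding energy_def Bochner_Integration.integral_add[OF Bochner_Integration.integrable_add[OF i2 i0] i]
        Bochner_Integration.integral_add[OF i2 i0] Bochner_Integration.integral_mult_right_zero[of lborel "2 * ?K"] ..
  qed
  also have "\<dots> = (1 + 2 * ?K) * energy (p 0) + energy (p 2)" by (simp add: algebra_simps)
  finally show ?thesis using abs_Re_le_cmod order_trans by blast
qed

text \<open>Nothing bounds the energy of \<open>p 3\<close> uniformly in the truncation, so its
  cancellation is essential; the surviving term needs \<open>p 3\<close> only without
  weight.\<close>

lemma energy2_linear_rate_le:
  assumes p: "Sobolev_chain M p"
  shows "\<bar>Re (\<i> * (LINT x|lborel. p 2 x * adjoint_term p x))\<bar> \<le> M\<^sup>2 + energy (p 2)"
proof -
  note H = Sobolev_chain_H1[OF p]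
  have L: "p 2 \<in> L2" "p 3 \<in> L2" using Sobolev_chain_L2[OF p] by auto
  note [measurable] = L2_measurable[OF L(1)] L2_measurable[OF L(2)]
  have i1: "integrable lborel (\<lambda>x. p 3 x * (of_real (w' x) * cnj (p 2 x)))"
    by (intro L2_mult_integrable L L2_bounded_mult[OF L2_cnj[OF L(1)] _ w_norm_le(2)]) simp
  have i2: "integrable lborel (\<lambda>x. p 3 x * (of_real (w x) * cnj (p 3 x)))"
    by (intro L2_mult_integrable L L2_bounded_mult[OF L2_cnj[OF L(2)] _ w_norm_le(1)]) simp
  have "(LINT x|lborel. p 2 x * adjoint_term p x) =
    - (LINT x|lborel. p 3 x * (of_real (w' x) * cnj (p 2 x) + of_real (w x) * cnj (p 3 x)))"
    using H1_deriv_integral_by_parts[OF H(3) adjoint_term_H1(2)[OF p]] by simp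
  also have "\<dots> = - ((LINT x|lborel. p 3 x * (of_real (w' x) * cnj (p 2 x))) + complex_of_real (energy (p 3)))"
    unfolding energy_eq distrib_left using i1 i2 by simp
  finally have "\<bar>Re (\<i> * (LINT x|lborel. p 2 x * adjoint_term p x))\<bar> = \<bar>Im (LINT x|lborel. p 3 x * (of_real (w' x) * cnj (p 2 x)))\<bar>"
    by simp
  also have "\<dots> \<le> cmod (LINT x|lborel. p 3 x * (of_real (w' x) * cnj (p 2 x)))" by (rule abs_Im_le_cmod)
  also have "\<dots> \<le> (LINT x|lborel. (cmod (p 2 x))\<^sup>2 * w x + (cmod (p 3 x))\<^sup>2)"
  proof (rule norm_integral_le)
    show "integrable lborel (\<lambda>x. (cmod (p 2 x))\<^sup>2 * w x + (cmod (p 3 x))\<^sup>2)"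
      by (intro Bochner_Integration.integrable_add energy_integrable L L2_integrable_square)
    show "cmod (p 3 x * (of_real (w' x) * cnj (p 2 x))) \<le> (cmod (p 2 x))\<^sup>2 * w x + (cmod (p 3 x))\<^sup>2" for x
      using w'_mult_le[of "cmod (p 2 x)" "cmod (p 3 x)" x] by (simp add: norm_mult mult_ac)
  qed
  also have "\<dots> = energy (p 2) + (L2_norm (p 3))\<^sup>2"
    using energy_integrable[OF L(1)] L2_integrable_square[OF L(2)] by (simp add: energy_def L2_norm_square)
  also have "(L2_norm (p 3))\<^sup>2 \<le> M\<^sup>2" using Sobolev_chain_L2(2)[OF p, of 3] by (intro power_mono) auto
  finally show ?thesis by simp
qed

text \<open>Both derivatives are moved back onto u G, so that neither \<open>p 3\<close> nor
  \<open>p 4\<close> meets the weight. The product rule for (u G)'' yields G' p_1 twice.\<close>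

lemma energy2_nonlinear_rate_le:
  assumes p: "Sobolev_chain M p"
  shows "cmod (LINT x|lborel. (potential p 0 x * p 0 x) * adjoint_term p x)
    \<le> potential_bound M * (energy (p 0) + energy (p 1) + 3 * energy (p 2))"
proof -
  let ?K = "potential_bound M"
  note H = Sobolev_chain_H1[OF p]
  have L: "p 0 \<in> L2" "p 1 \<in> L2" "p 2 \<in> L2" using Sobolev_chain_L2[OF p] by auto
  have G: "ac_deriv (potential p 0) (potential p 1)" "ac_deriv (potential p 1) (potential p 2)"
    using potential_ac_deriv[OF p, of 0] potential_ac_deriv[OF p, of 1] by (simp_all add: numeral_2_eq_2)
  have K: "\<And>x. cmod (potential p 0 x) \<le> ?K" "\<And>x. cmod (potential p 1 x) \<le> ?K" "\<And>x. cmod (potential p 2 x) \<le> ?K"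
    using potential_le[OF p] by auto
  let ?U1 = "\<lambda>x. potential p 1 x * p 0 x + potential p 0 x * p 1 x"
  let ?U2 = "\<lambda>x. (potential p 2 x * p 0 x + potential p 1 x * p 1 x) + (potential p 1 x * p 1 x + potential p 0 x * p 2 x)"
  have U: "H1_deriv (2 * ?K * M) (\<lambda>x. potential p 0 x * p 0 x) ?U1"
    by (rule H1_deriv_bounded_mult[OF H(1) G(1) K(1,2)])
  have U': "H1_deriv (2 * ?K * M + 2 * ?K * M) ?U1 ?U2"
    by (rule H1_deriv_add[OF H1_deriv_bounded_mult[OF H(1) G(2) K(2,3)] H1_deriv_bounded_mult[OF H(2) G(1) K(1,2)]])
  have U_eq: "(LINT x|lborel. (potential p 0 x * p 0 x) * adjoint_term p x) =
    (LINT x|lborel. ?U2 x * (of_real (w x) * cnj (p 2 x)))"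
    by (rule integral_adjoint_term[OF U U' p])
  have "cmod (LINT x|lborel. (potential p 0 x * p 0 x) * adjoint_term p x) \<le> (LINT x|lborel. ?K * ((cmod (p 0 x))\<^sup>2 * w x + (cmod (p 1 x))\<^sup>2 * w x + 3 * ((cmod (p 2 x))\<^sup>2 * w x)))"
    unfolding U_eq
  proof (rule norm_integral_le)
    show "integrable lborel (\<lambda>x. ?K * ((cmod (p 0 x))\<^sup>2 * w x + (cmod (p 1 x))\<^sup>2 * w x + 3 * ((cmod (p 2 x))\<^sup>2 * w x)))"
      by (intro Bochner_Integration.integrable_add integrable_mult_right energy_integrable L)
    fix x
    have factor: "cmod (potential p k x * p j x) \<le> ?K * cmod (p j x)" if "k \<le> 2" for k j
      unfolding norm_mult using potential_le[OF p that] by (intro mult_right_mono) auto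
    have "cmod (?U2 x) \<le> (cmod (potential p 2 x * p 0 x) + cmod (potential p 1 x * p 1 x)) +
      (cmod (potential p 1 x * p 1 x) + cmod (potential p 0 x * p 2 x))"
      by (intro order_trans[OF norm_triangle_ineq] add_mono norm_triangle_ineq)
    also have "\<dots> \<le> (?K * cmod (p 0 x) + ?K * cmod (p 1 x)) + (?K * cmod (p 1 x) + ?K * cmod (p 2 x))"
      by (intro add_mono factor) auto
    also have "\<dots> = ?K * (cmod (p 0 x) + 2 * cmod (p 1 x) + cmod (p 2 x))" by (simp add: algebra_simps)
    finally have U2: "cmod (?U2 x) \<le> ?K * (cmod (p 0 x) + 2 * cmod (p 1 x) + cmod (p 2 x))" .
    have "cmod (?U2 x * (of_real (w x) * cnj (p 2 x))) = cmod (?U2 x) * (w x * cmod (p 2 x))"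
      using w_nonneg[of x] by (simp only: norm_mult norm_of_real abs_of_nonneg complex_mod_cnj)
    also have "\<dots> \<le> ?K * (cmod (p 0 x) + 2 * cmod (p 1 x) + cmod (p 2 x)) * (w x * cmod (p 2 x))"
      using U2 w_nonneg[of x] by (intro mult_right_mono) auto
    also have "\<dots> = ?K * ((cmod (p 0 x) * cmod (p 2 x) + 2 * (cmod (p 1 x) * cmod (p 2 x)) + (cmod (p 2 x))\<^sup>2) * w x)"
      by (simp add: algebra_simps power2_eq_square)
    also have "\<dots> \<le> ?K * (((cmod (p 0 x))\<^sup>2 + (cmod (p 1 x))\<^sup>2 + 3 * (cmod (p 2 x))\<^sup>2) * w x)"
    proof (intro mult_left_mono mult_right_mono w_nonneg potential_bound_nonneg)
      show "cmod (p 0 x) * cmod (p 2 x) + 2 * (cmod (p 1 x) * cmod (p 2 x)) + (cmod (p 2 x))\<^sup>2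
        \<le> (cmod (p 0 x))\<^sup>2 + (cmod (p 1 x))\<^sup>2 + 3 * (cmod (p 2 x))\<^sup>2"
        \<comment> \<open>Young's inequality gives the coefficients 1/2, 1 and 5/2, which are
          rounded up.\<close>
        using mult_le_sum_squares[of "cmod (p 0 x)" "cmod (p 2 x)"] mult_le_sum_squares[of "cmod (p 1 x)" "cmod (p 2 x)"]
          zero_le_power2[of "cmod (p 0 x)"] zero_le_power2[of "cmod (p 2 x)"] by linarith
    qed
    finally show "cmod (?U2 x * (of_real (w x) * cnj (p 2 x))) \<le>
      ?K * ((cmod (p 0 x))\<^sup>2 * w x + (cmod (p 1 x))\<^sup>2 * w x + 3 * ((cmod (p 2 x))\<^sup>2 * w x))"
      by (simp only: distrib_right mult.assoc)
  qed
  also have "\<dots> = ?K * (energy (p 0) + energy (p 1) + 3 * energy (p 2))"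
    using L[THEN energy_integrable] by (simp add: energy_def)
  finally show ?thesis .
qed

lemma energy2_rate_le:
  assumes p: "Sobolev_chain M p"
    and v: "AE x in lborel. v x = \<i> * p 2 x + \<i> * (p 0 x * potential p 0 x)"
    and [measurable]: "v \<in> borel_measurable borel"
  shows "\<bar>Re (LINT x|lborel. v x * (2 * adjoint_term p x))\<bar> \<le>
    2 * (M\<^sup>2 + energy (p 2) + potential_bound M * (energy (p 0) + energy (p 1) + 3 * energy (p 2)))"
proof -
  have L: "p 0 \<in> L2" "p 2 \<in> L2" using Sobolev_chain_L2[OF p] by auto
  have A: "adjoint_term p \<in> L2" using H1_derivD(3)[OF adjoint_term_H1(2)[OF p]] .
  note G = ac_deriv_measurable[OF potential_ac_deriv[OF p, of 0, simplified]]
  note [measurable] = L2_measurable[OF L(1)] L2_measurable[OF L(2)] G L2_measurable[OF A]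
  have i: "integrable lborel (\<lambda>x. p 2 x * adjoint_term p x)" "integrable lborel (\<lambda>x. (potential p 0 x * p 0 x) * adjoint_term p x)"
    using potential_le[OF p, of 0] by (auto intro!: L2_mult_integrable L A L2_bounded_mult[OF L(1) G])
  have "(LINT x|lborel. v x * (2 * adjoint_term p x)) =
    (LINT x|lborel. 2 * (\<i> * (p 2 x * adjoint_term p x) + \<i> * ((potential p 0 x * p 0 x) * adjoint_term p x)))"
  proof (rule integral_cong_AE)
    show "AE x in lborel. v x * (2 * adjoint_term p x) =
      2 * (\<i> * (p 2 x * adjoint_term p x) + \<i> * ((potential p 0 x * p 0 x) * adjoint_term p x))"
      using v by eventually_elim (simp add: algebra_simps)
  qed auto
  also have "\<dots> = 2 * (\<i> * (LINT x|lborel. p 2 x * adjoint_term p x) +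
     \<i> * (LINT x|lborel. (potential p 0 x * p 0 x) * adjoint_term p x))"
    using i by simp
  finally have rate: "Re (LINT x|lborel. v x * (2 * adjoint_term p x)) = 2 * (Re (\<i> * (LINT x|lborel. p 2 x * adjoint_term p x)) -
     Im (LINT x|lborel. (potential p 0 x * p 0 x) * adjoint_term p x))"
    by simp
  have nonlinear: "\<bar>Im (LINT x|lborel. (potential p 0 x * p 0 x) * adjoint_term p x)\<bar> \<le>
    potential_bound M * (energy (p 0) + energy (p 1) + 3 * energy (p 2))"
    using energy2_nonlinear_rate_le[OF p] abs_Im_le_cmod order_trans by blast
  have combine: "\<bar>x\<bar> \<le> 2 * (A + B)" if "x = 2 * (a - b)" "\<bar>b\<bar> \<le> B" "\<bar>a\<bar> \<le> A" for x a b A B :: real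
    using that unfolding abs_le_iff by auto
  show ?thesis by (rule combine[OF rate nonlinear energy2_linear_rate_le[OF p]])
qed

text \<open>\<open>energy_interpolation\<close> eliminates the energy of \<open>p 1\<close>, and the
  terms in \<open>M\<close> alone are absorbed by the 1 added to the energies.\<close>

lemma energy_rate_le:
  assumes p: "Sobolev_chain M p"
    and v: "AE x in lborel. v x = \<i> * p 2 x + \<i> * (p 0 x * potential p 0 x)"
    and m: "v \<in> borel_measurable borel"
  shows "\<bar>Re (LINT x|lborel. v x * (2 * (of_real (w x) * cnj (p 0 x)))) + Re (LINT x|lborel. v x * (2 * adjoint_term p x))\<bar>
    \<le> growth_rate M * (energy (p 0) + energy (p 2) + 1)"
proof -
  let ?K = "potential_bound M"
  define a b where "a = energy (p 0)" and "b = energy (p 2)"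
  have nn: "0 \<le> a" "0 \<le> b" "0 \<le> ?K" using energy_nonneg potential_bound_nonneg by (auto simp: a_def b_def)
  have "?K * (a + energy (p 1) + 3 * b) \<le> ?K * (a + (2 * a + b + M\<^sup>2) + 3 * b)"
    using energy_interpolation[OF p] nn by (intro mult_left_mono) (auto simp: a_def b_def)
  then have "\<bar>Re (LINT x|lborel. v x * (2 * (of_real (w x) * cnj (p 0 x)))) + Re (LINT x|lborel. v x * (2 * adjoint_term p x))\<bar>
    \<le> ((1 + 2 * ?K) * a + b) + 2 * (M\<^sup>2 + b + ?K * (a + (2 * a + b + M\<^sup>2) + 3 * b))"
    using energy0_rate_le[OF p v m] energy2_rate_le[OF p v m] by (simp add: a_def b_def)
  also have "\<dots> = (1 + 8 * ?K) * a + (3 + 8 * ?K) * b + (2 * M\<^sup>2 + 2 * ?K * M\<^sup>2)"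
    by (simp add: algebra_simps)
  also have "\<dots> \<le> growth_rate M * a + growth_rate M * b + growth_rate M * 1"
  proof -
    have "0 \<le> ?K * M\<^sup>2" "0 \<le> M\<^sup>2" using nn by auto
    then have "1 + 8 * ?K \<le> growth_rate M" "3 + 8 * ?K \<le> growth_rate M" "2 * M\<^sup>2 + 2 * ?K * M\<^sup>2 \<le> growth_rate M * 1"
      using nn unfolding growth_rate_def by auto
    then show ?thesis using nn by (intro add_mono mult_right_mono)
  qed
  finally show ?thesis by (simp add: a_def b_def algebra_simps)
qed

end

section \<open>Evolution of the weighted energies\<close>

text \<open>Differentiates a quadratic functional along a curve that is differentiable only in L2:
  the increment of \<open>E\<close> pairs the increment of \<open>a\<close> with a factor
  \<open>b s\<close> that merely has to converge.\<close>

lemma L2_difference_quotient_DERIV: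
  assumes E: "\<And>s. s \<in> I \<Longrightarrow> E s - E t = Re (LINT x|lborel. (a s x - a t x) * b s x)"
    and a: "((\<lambda>s. L2_norm (\<lambda>x. (a s x - a t x) / of_real (s - t) - v x)) \<longlongrightarrow> 0) (at t within I)"
    and aL: "\<And>s. s \<in> I \<Longrightarrow> a s \<in> L2" and t: "t \<in> I" and vL: "v \<in> L2"
    and b: "((\<lambda>s. L2_norm (\<lambda>x. b s x - b0 x)) \<longlongrightarrow> 0) (at t within I)"
    and bL: "\<And>s. s \<in> I \<Longrightarrow> b s \<in> L2" and b0L: "b0 \<in> L2"
  shows "(E has_real_derivative Re (LINT x|lborel. v x * b0 x)) (at t within I)"
  unfolding has_field_derivative_iff
proof (rule Lim_transform_eventually)
  have ev: "\<forall>\<^sub>F s in at t within I. s \<in> I \<and> s \<noteq> t" by (simp add: eventually_at_filter)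
  have "((\<lambda>s. LINT x|lborel. (a s x - a t x) / of_real (s - t) * b s x) \<longlongrightarrow> (LINT x|lborel. v x * b0 x)) (at t within I)"
  proof (rule L2_tendsto_integral_mult[OF a _ vL b _ b0L])
    show "\<forall>\<^sub>F s in at t within I. (\<lambda>x. (a s x - a t x) / of_real (s - t)) \<in> L2"
      using ev by eventually_elim (intro L2_divide L2_diff aL t, simp)
    show "\<forall>\<^sub>F s in at t within I. b s \<in> L2"
      using ev by eventually_elim (simp add: bL)
  qed
  then show "((\<lambda>s. Re (LINT x|lborel. (a s x - a t x) / of_real (s - t) * b s x)) \<longlongrightarrow> Re (LINT x|lborel. v x * b0 x)) (at t within I)"
    by (rule tendsto_Re)
  show "\<forall>\<^sub>F s in at t within I. Re (LINT x|lborel. (a s x - a t x) / of_real (s - t) * b s x) = (E s - E t) / (s - t)"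
    using ev
  proof eventually_elim
    case (elim s)
    have "(LINT x|lborel. (a s x - a t x) / of_real (s - t) * b s x) =
      (LINT x|lborel. ((a s x - a t x) * b s x) / of_real (s - t))"
      by (intro Bochner_Integration.integral_cong) auto
    also have "\<dots> = (LINT x|lborel. (a s x - a t x) * b s x) / of_real (s - t)"
      by (rule integral_divide_zero)
    finally show ?case using E[of s] elim by (simp only: Re_divide_of_real)
  qed
qed

context energy_weight
begin

lemma weighted_L2: "f \<in> L2 \<Longrightarrow> (\<lambda>x. of_real (w x) * f x) \<in> L2"
  by (rule L2_bounded_mult[OF _ _ w_norm_le(1)]) simp_all

text \<open>|f|^2 - |g|^2 is the real part of (f - g) cnj (f + g), the shape that
  \<open>L2_difference_quotient_DERIV\<close> asks for.\<close>

lemma energy_diff: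
  assumes "f \<in> L2" "g \<in> L2"
  shows "energy f - energy g = Re (LINT x|lborel. (f x - g x) * (of_real (w x) * cnj (f x + g x)))"
proof -
  have i: "integrable lborel (\<lambda>x. (f x - g x) * (of_real (w x) * cnj (f x + g x)))"
    by (intro L2_mult_integrable L2_diff weighted_L2 L2_cnj L2_add assms)
  have pointwise: "Re ((f x - g x) * (of_real (w x) * cnj (f x + g x))) = (cmod (f x))\<^sup>2 * w x - (cmod (g x))\<^sup>2 * w x" for x
    unfolding cmod_power2 by (simp add: algebra_simps power2_eq_square)
  have "Re (LINT x|lborel. (f x - g x) * (of_real (w x) * cnj (f x + g x))) =
    (LINT x|lborel. Re ((f x - g x) * (of_real (w x) * cnj (f x + g x))))"
    by (rule integral_Re[symmetric, OF i])
  also have "\<dots> = energy f - energy g"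
    unfolding pointwise energy_def by (rule Bochner_Integration.integral_diff) (intro energy_integrable assms)+
  finally show ?thesis by simp
qed

lemma adjoint_term_L2:
  assumes "p 2 \<in> L2" "p 3 \<in> L2" "p 4 \<in> L2"
  shows "adjoint_term p \<in> L2"
    "L2_norm (adjoint_term p) \<le> L * L2_norm (p 2) + 2 * (L * L2_norm (p 3)) + L * L2_norm (p 4)"
proof -
  note c = assms[THEN L2_cnj]
  have A: "(\<lambda>x. of_real (w'' x) * cnj (p 2 x)) \<in> L2" "(\<lambda>x. of_real (w' x) * cnj (p 3 x)) \<in> L2" "(\<lambda>x. of_real (w x) * cnj (p 4 x)) \<in> L2"
    by (rule L2_bounded_mult[OF c(1) _ w_norm_le(3)], simp, rule L2_bounded_mult[OF c(2) _ w_norm_le(2)], simp,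
        rule L2_bounded_mult[OF c(3) _ w_norm_le(1)], simp)
  have N: "L2_norm (\<lambda>x. of_real (w'' x) * cnj (p 2 x)) \<le> L * L2_norm (p 2)"
    "L2_norm (\<lambda>x. of_real (w' x) * cnj (p 3 x)) \<le> L * L2_norm (p 3)"
    "L2_norm (\<lambda>x. of_real (w x) * cnj (p 4 x)) \<le> L * L2_norm (p 4)"
    by (rule order_trans[OF L2_norm_bounded_mult[OF c(1) _ w_norm_le(3)]], simp_all,
        rule order_trans[OF L2_norm_bounded_mult[OF c(2) _ w_norm_le(2)]], simp_all,
        rule order_trans[OF L2_norm_bounded_mult[OF c(3) _ w_norm_le(1)]], simp_all)
  note B = L2_cmult[OF A(2), of 2]
  show "adjoint_term p \<in> L2" unfolding adjoint_term_def[abs_def] by (intro L2_add A B)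
  have "L2_norm (adjoint_term p) \<le> L2_norm (\<lambda>x. of_real (w'' x) * cnj (p 2 x) + 2 * (of_real (w' x) * cnj (p 3 x))) +
     L2_norm (\<lambda>x. of_real (w x) * cnj (p 4 x))"
    unfolding adjoint_term_def[abs_def] by (rule L2_norm_triangle[OF L2_add[OF A(1) B] A(3)])
  moreover have "L2_norm (\<lambda>x. of_real (w'' x) * cnj (p 2 x) + 2 * (of_real (w' x) * cnj (p 3 x))) \<le>
    L2_norm (\<lambda>x. of_real (w'' x) * cnj (p 2 x)) + 2 * L2_norm (\<lambda>x. of_real (w' x) * cnj (p 3 x))"
    using L2_norm_triangle[OF A(1) B] L2_norm_cmult[of 2 "\<lambda>x. of_real (w' x) * cnj (p 3 x)"] by simp
  ultimately show "L2_norm (adjoint_term p) \<le> L * L2_norm (p 2) + 2 * (L * L2_norm (p 3)) + L * L2_norm (p 4)"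
    using N by linarith
qed

end

text \<open>The solution seen through precise representatives, with the equation solved for the time
  derivative \<open>v\<close>. The constant of each chain may depend on the time.\<close>

locale CMDNLS_flow =
  fixes I :: "real set" and p :: "real \<Rightarrow> nat \<Rightarrow> real \<Rightarrow> complex" and v :: "real \<Rightarrow> real \<Rightarrow> complex"
  assumes open_I: "open I"
    and chain: "\<And>t. t \<in> I \<Longrightarrow> \<exists>M. Sobolev_chain M (p t)"
    and cont: "\<And>t j. t \<in> I \<Longrightarrow> j \<le> 4 \<Longrightarrow> ((\<lambda>s. L2_norm (\<lambda>x. p s j x - p t j x)) \<longlongrightarrow> 0) (at t within I)"
    and v_L2: "\<And>t. t \<in> I \<Longrightarrow> v t \<in> L2"
    and time_deriv: "\<And>t. t \<in> I \<Longrightarrow>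
      ((\<lambda>s. L2_norm (\<lambda>x. (p s 0 x - p t 0 x) / of_real (s - t) - v t x)) \<longlongrightarrow> 0) (at t within I)"
    and equation: "\<And>t. t \<in> I \<Longrightarrow> AE x in lborel. v t x = \<i> * p t 2 x + \<i> * (p t 0 x * potential (p t) 0 x)"
begin

lemma p_L2: "t \<in> I \<Longrightarrow> j \<le> 4 \<Longrightarrow> p t j \<in> L2"
  using chain Sobolev_chain_L2(1) by blast

text \<open>The norms are continuous in time, hence bounded on a compact set; this yields one growth
  rate for a whole time segment.\<close>

lemma uniform_chain:
  assumes "compact J" "J \<subseteq> I"
  obtains M where "\<And>t. t \<in> J \<Longrightarrow> Sobolev_chain M (p t)"
proof -
  have "continuous_on I (\<lambda>t. \<Sum>j\<le>4. L2_norm (p t j))"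
  proof (intro continuous_on_sum)
    fix j :: nat assume "j \<in> {..4}"
    then have j: "j \<le> 4" by simp
    show "continuous_on I (\<lambda>t. L2_norm (p t j))"
      unfolding continuous_on_def
    proof
      fix t assume t: "t \<in> I"
      show "((\<lambda>t. L2_norm (p t j)) \<longlongrightarrow> L2_norm (p t j)) (at t within I)"
        by (rule L2_norm_zero_tendsto[OF cont[OF t j] _ p_L2[OF t j]])
           (use p_L2 j in \<open>auto simp: eventually_at_filter\<close>)
    qed
  qed
  then have "compact ((\<lambda>t. \<Sum>j\<le>4. L2_norm (p t j)) ` J)"
    by (intro compact_continuous_image assms continuous_on_subset[OF _ assms(2)])
  then have "bounded ((\<lambda>t. \<Sum>j\<le>4. L2_norm (p t j)) ` J)" by (rule compact_imp_bounded)
  then obtain M where M: "\<forall>y\<in>(\<lambda>t. \<Sum>j\<le>4. L2_norm (p t j)) ` J. norm y \<le> M"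
    unfolding bounded_iff by blast
  have norm: "L2_norm (p t j) \<le> M" if "t \<in> J" "j \<le> 4" for t j
  proof -
    have "L2_norm (p t j) \<le> (\<Sum>j\<le>4. L2_norm (p t j))" by (rule member_le_sum) (use that in auto)
    also have "\<dots> \<le> M" using M that(1) by (auto dest!: bspec)
    finally show ?thesis .
  qed
  have "Sobolev_chain M (p t)" if t: "t \<in> J" for t
  proof -
    obtain N where "Sobolev_chain N (p t)" using chain t assms(2) by blast
    then show ?thesis using norm[OF t] by (auto simp: Sobolev_chain_def H1_deriv_def)
  qed
  then show ?thesis by (rule that)
qed

lemma energy_DERIV:
  assumes W: "energy_weight w w' w'' L" and t: "t \<in> I"
  shows "((\<lambda>s. energy_weight.energy w (p s 0) + energy_weight.energy w (p s 2)) has_real_derivative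
    Re (LINT x|lborel. v t x * (2 * (of_real (w x) * cnj (p t 0 x)))) +
    Re (LINT x|lborel. v t x * (2 * energy_weight.adjoint_term w w' w'' (p t) x))) (at t)"
proof -
  interpret energy_weight w w' w'' L by fact
  have ev: "\<forall>\<^sub>F s in at t within I. s \<in> I" by (simp add: eventually_at_filter)
  have "((\<lambda>s. energy (p s 0)) has_real_derivative Re (LINT x|lborel. v t x * (2 * (of_real (w x) * cnj (p t 0 x))))) (at t within I)"
  proof (rule L2_difference_quotient_DERIV[where a="\<lambda>s. p s 0" and b="\<lambda>s x. of_real (w x) * cnj (p s 0 x + p t 0 x)"])
    show "energy (p s 0) - energy (p t 0) = Re (LINT x|lborel. (p s 0 x - p t 0 x) * (of_real (w x) * cnj (p s 0 x + p t 0 x)))"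
      if "s \<in> I" for s using that t by (intro energy_diff p_L2) auto
    \<comment> \<open>At s = t the sum doubles, which is the origin of the factor 2 in the
      derivative.\<close>
    show "((\<lambda>s. L2_norm (\<lambda>x. of_real (w x) * cnj (p s 0 x + p t 0 x) - 2 * (of_real (w x) * cnj (p t 0 x)))) \<longlongrightarrow> 0) (at t within I)"
    proof (rule Lim_null_comparison)
      show "((\<lambda>s. L * L2_norm (\<lambda>x. p s 0 x - p t 0 x)) \<longlongrightarrow> 0) (at t within I)"
        using tendsto_mult_right_zero[OF cont[OF t, of 0]] by simp
      show "\<forall>\<^sub>F s in at t within I. norm (L2_norm (\<lambda>x. of_real (w x) * cnj (p s 0 x + p t 0 x) - 2 * (of_real (w x) * cnj (p t 0 x))))
        \<le> L * L2_norm (\<lambda>x. p s 0 x - p t 0 x)"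
        using ev
      proof eventually_elim
        case (elim s)
        have "(\<lambda>x. of_real (w x) * cnj (p s 0 x + p t 0 x) - 2 * (of_real (w x) * cnj (p t 0 x))) =
          (\<lambda>x. of_real (w x) * cnj (p s 0 x - p t 0 x))"
          by (simp add: fun_eq_iff algebra_simps)
        moreover have "L2_norm (\<lambda>x. of_real (w x) * cnj (p s 0 x - p t 0 x)) \<le> L * L2_norm (\<lambda>x. cnj (p s 0 x - p t 0 x))"
          by (rule L2_norm_bounded_mult[OF L2_cnj[OF L2_diff[OF p_L2[OF elim] p_L2[OF t]]] _ w_norm_le(1)]) simp_all
        ultimately show ?case by (simp only: L2_norm_cnj real_norm_def abs_of_nonneg L2_norm_nonneg)
      qed
    qed
  qed (use t in \<open>auto intro!: p_L2 weighted_L2 L2_cnj L2_add L2_cmult v_L2 time_deriv simp del: complex_cnj_add of_real_diff\<close>)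
  moreover have "((\<lambda>s. energy (p s 2)) has_real_derivative Re (LINT x|lborel. v t x * (2 * adjoint_term (p t) x))) (at t within I)"
  proof (rule L2_difference_quotient_DERIV[where a="\<lambda>s. p s 0" and b="\<lambda>s. adjoint_term (\<lambda>j x. p s j x + p t j x)"])
    \<comment> \<open>Differences and sums of the chains at \<open>s\<close> and \<open>t\<close>
      are again chains, so two integrations by parts reduce the increment to
      \<open>p s 0 - p t 0\<close>, whose difference quotient is known to converge.\<close>
    show "energy (p s 2) - energy (p t 2) = Re (LINT x|lborel. (p s 0 x - p t 0 x) * adjoint_term (\<lambda>j x. p s j x + p t j x) x)"
      if s: "s \<in> I" for s
    proof -
      obtain M N where c: "Sobolev_chain M (p s)" "Sobolev_chain N (p t)" using chain s t by blast
      note H = Sobolev_chain_H1[OF Sobolev_chain_diff[OF c]]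
      show ?thesis
        unfolding integral_adjoint_term[OF H(1,2) Sobolev_chain_add[OF c]]
        using s t by (intro energy_diff p_L2) auto
    qed
    show "((\<lambda>s. L2_norm (\<lambda>x. adjoint_term (\<lambda>j x. p s j x + p t j x) x - 2 * adjoint_term (p t) x)) \<longlongrightarrow> 0) (at t within I)"
    proof (rule Lim_null_comparison)
      let ?d = "\<lambda>j s. L2_norm (\<lambda>x. p s j x - p t j x)"
      have "((\<lambda>s. L * ?d 2 s + 2 * (L * ?d 3 s) + L * ?d 4 s) \<longlongrightarrow> L * 0 + 2 * (L * 0) + L * 0) (at t within I)"
        by (intro tendsto_intros cont t) auto
      then show "((\<lambda>s. L * ?d 2 s + 2 * (L * ?d 3 s) + L * ?d 4 s) \<longlongrightarrow> 0) (at t within I)" by simp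
      show "\<forall>\<^sub>F s in at t within I. norm (L2_norm (\<lambda>x. adjoint_term (\<lambda>j x. p s j x + p t j x) x - 2 * adjoint_term (p t) x))
         \<le> L * ?d 2 s + 2 * (L * ?d 3 s) + L * ?d 4 s"
        using ev
      proof eventually_elim
        case (elim s)
        have "(\<lambda>x. adjoint_term (\<lambda>j x. p s j x + p t j x) x - 2 * adjoint_term (p t) x) = adjoint_term (\<lambda>j x. p s j x - p t j x)"
          by (simp add: fun_eq_iff adjoint_term_def algebra_simps)
        moreover have "L2_norm (adjoint_term (\<lambda>j x. p s j x - p t j x)) \<le> L * ?d 2 s + 2 * (L * ?d 3 s) + L * ?d 4 s"
          by (rule adjoint_term_L2(2)) (auto intro!: L2_diff p_L2 elim t)
        ultimately show ?case by (simp only: real_norm_def abs_of_nonneg L2_norm_nonneg)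
      qed
    qed
    show "adjoint_term (\<lambda>j x. p s j x + p t j x) \<in> L2" if "s \<in> I" for s
      by (rule adjoint_term_L2(1)) (auto intro!: L2_add p_L2 that t)
    show "(\<lambda>x. 2 * adjoint_term (p t) x) \<in> L2"
      by (intro L2_cmult adjoint_term_L2(1) p_L2 t) auto
  qed (use t in \<open>auto intro!: p_L2 v_L2 time_deriv simp del: of_real_diff\<close>)
  ultimately show ?thesis
    using at_within_open[OF t open_I] by (auto dest: DERIV_add)
qed

lemma energy_rate_bound:
  assumes W: "energy_weight w w' w'' L" and t: "t \<in> I" and M: "Sobolev_chain M (p t)"
  obtains r where "((\<lambda>s. energy_weight.energy w (p s 0) + energy_weight.energy w (p s 2)) has_real_derivative r) (at t)"
    "\<bar>r\<bar> \<le> growth_rate M * (energy_weight.energy w (p t 0) + energy_weight.energy w (p t 2) + 1)"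
proof -
  interpret energy_weight w w' w'' L by fact
  show ?thesis
    by (rule that[OF energy_DERIV[OF W t] energy_rate_le[OF M equation[OF t] L2_measurable[OF v_L2[OF t]]]])
qed

end

section \<open>Gronwall's inequality in both time directions\<close>

lemma gronwall_forward:
  fixes Y :: "real \<Rightarrow> real"
  assumes "0 \<le> t" and d: "\<And>s. 0 \<le> s \<Longrightarrow> s \<le> t \<Longrightarrow> \<exists>r. (Y has_real_derivative r) (at s) \<and> \<bar>r\<bar> \<le> C * (Y s + 1)"
  shows "Y t + 1 \<le> (Y 0 + 1) * exp (C * t)"
proof -
  \<comment> \<open>The integrating factor exp (- C s) makes Y + 1 nonincreasing.\<close>
  have "(Y t + 1) * exp (- C * t) \<le> (Y 0 + 1) * exp (- C * 0)"
  proof (rule DERIV_nonpos_imp_nonincreasing[OF \<open>0 \<le> t\<close>])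
    fix s assume "0 \<le> s" "s \<le> t"
    then obtain r where r: "(Y has_real_derivative r) (at s)" "\<bar>r\<bar> \<le> C * (Y s + 1)" using d by blast
    have "((\<lambda>s. (Y s + 1) * exp (- C * s)) has_real_derivative (r - C * (Y s + 1)) * exp (- C * s)) (at s)"
      using r(1) by (auto intro!: derivative_eq_intros simp: algebra_simps)
    moreover have "(r - C * (Y s + 1)) * exp (- C * s) \<le> 0" using r(2) by (intro mult_nonpos_nonneg) auto
    ultimately show "\<exists>y. ((\<lambda>s. (Y s + 1) * exp (- C * s)) has_real_derivative y) (at s) \<and> y \<le> 0" by blast
  qed
  then have "(Y t + 1) * exp (- C * t) * exp (C * t) \<le> (Y 0 + 1) * exp (C * t)"
    by (intro mult_right_mono) auto
  then show ?thesis by (simp add: mult.assoc exp_add[symmetric])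
qed

text \<open>The hypothesis bounds |r|, so it survives the reversal of time that settles negative
  \<open>t\<close>.\<close>

lemma gronwall:
  fixes Y :: "real \<Rightarrow> real"
  assumes d: "\<And>s. s \<in> closed_segment 0 t \<Longrightarrow> \<exists>r. (Y has_real_derivative r) (at s) \<and> \<bar>r\<bar> \<le> C * (Y s + 1)"
  shows "Y t + 1 \<le> (Y 0 + 1) * exp (C * \<bar>t\<bar>)"
proof (cases "0 \<le> t")
  case True
  then show ?thesis using gronwall_forward[of t Y C] d by (simp add: closed_segment_eq_real_ivl)
next
  case False
  have "\<exists>r. ((\<lambda>s. Y (- s)) has_real_derivative r) (at s) \<and> \<bar>r\<bar> \<le> C * (Y (- s) + 1)" if "0 \<le> s" "s \<le> - t" for s
  proof -
    have "- s \<in> closed_segment 0 t" using that False by (simp add: closed_segment_eq_real_ivl)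
    then obtain r where r: "(Y has_real_derivative r) (at (- s))" "\<bar>r\<bar> \<le> C * (Y (- s) + 1)" using d by blast
    show ?thesis using r by (intro exI[of _ "- r"]) (simp add: DERIV_mirror)
  qed
  then show ?thesis using gronwall_forward[of "- t" "\<lambda>s. Y (- s)" C] False by simp
qed

section \<open>Removing the truncation of the weight\<close>

text \<open>For 0 < e \<le> 1 it is at most 1/e and at most 1 + x^2, and it converges to 1 + x^2 as
  e tends to 0.\<close>

definition cutoff_weight :: "real \<Rightarrow> real \<Rightarrow> real" where
  "cutoff_weight e x = (1 + x\<^sup>2) / (1 + e * x\<^sup>2)"

text \<open>The bound 2/e + 6 accommodates 1/e for the weight, 2/e for its first derivative and 6
  for its second.\<close>

lemma energy_weight_cutoff:
  assumes e: "0 < e" "e \<le> 1"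
  shows "energy_weight (cutoff_weight e) (\<lambda>x. 2 * x * (1 - e) / (1 + e * x\<^sup>2)\<^sup>2)
    (\<lambda>x. 2 * (1 - e) * (1 - 3 * e * x\<^sup>2) / (1 + e * x\<^sup>2) ^ 3) (2 / e + 6)"
proof
  have pos: "0 < 1 + e * x\<^sup>2" and ge1: "1 \<le> 1 + e * x\<^sup>2" for x :: real
    using e by (simp_all add: add_pos_nonneg)
  fix x :: real
  let ?d = "1 + e * x\<^sup>2"
  note nz = pos[of x, THEN less_imp_neq, symmetric]
  show "(cutoff_weight e has_real_derivative 2 * x * (1 - e) / ?d\<^sup>2) (at x)"
    unfolding cutoff_weight_def[abs_def] using nz
    by (auto intro!: derivative_eq_intros simp: power2_eq_square field_simps)
  show "((\<lambda>x. 2 * x * (1 - e) / (1 + e * x\<^sup>2)\<^sup>2) has_real_derivative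
     2 * (1 - e) * (1 - 3 * e * x\<^sup>2) / ?d ^ 3) (at x)"
  proof -
    have "((\<lambda>x. 2 * x * (1 - e) / (1 + e * x\<^sup>2)\<^sup>2) has_real_derivative
       (2 * (1 - e) * ?d\<^sup>2 - 2 * x * (1 - e) * (2 * ?d * (2 * e * x))) / (?d\<^sup>2 * ?d\<^sup>2)) (at x)"
      using nz by (auto intro!: derivative_eq_intros)
    moreover have "(2 * (1 - e) * ?d\<^sup>2 - 2 * x * (1 - e) * (2 * ?d * (2 * e * x))) / (?d\<^sup>2 * ?d\<^sup>2) =
       2 * (1 - e) * (1 - 3 * e * x\<^sup>2) / ?d ^ 3"
    proof -
      have "2 * (1 - e) * ?d\<^sup>2 - 2 * x * (1 - e) * (2 * ?d * (2 * e * x)) = ?d * (2 * (1 - e) * (1 - 3 * e * x\<^sup>2))"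
        by (simp add: algebra_simps power2_eq_square)
      moreover have "?d\<^sup>2 * ?d\<^sup>2 = ?d * ?d ^ 3" by (simp add: power2_eq_square power3_eq_cube)
      ultimately show ?thesis using nz by simp
    qed
    ultimately show ?thesis by simp
  qed
  show "0 \<le> cutoff_weight e x" using pos[of x] by (simp add: cutoff_weight_def)
  have "e * (1 + x\<^sup>2) \<le> ?d" using e by (simp add: algebra_simps)
  then have w_le: "cutoff_weight e x \<le> 1 / e"
    using e pos[of x] by (simp add: cutoff_weight_def field_simps)
  also have "1 / e \<le> 2 / e + 6" using e by (simp add: field_simps)
  finally show "cutoff_weight e x \<le> 2 / e + 6" .
  \<comment> \<open>Uniform in \<open>e\<close>: (1 - e)^2 \<le> 1 in the numerator, and d \<le> d^4
    in the denominator d = 1 + e x^2, as d \<ge> 1.\<close>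
  show sq: "(2 * x * (1 - e) / ?d\<^sup>2)\<^sup>2 \<le> 4 * cutoff_weight e x"
  proof -
    have "(2 * x * (1 - e) / ?d\<^sup>2)\<^sup>2 = (4 * (x\<^sup>2 * (1 - e)\<^sup>2)) / ?d ^ 4"
      by (simp add: power_divide power_mult_distrib)
    also have "\<dots> \<le> (4 * (1 + x\<^sup>2)) / ?d"
    proof (rule frac_le)
      have "(1 - e)\<^sup>2 \<le> 1" using e by (simp add: power_le_one)
      then have "x\<^sup>2 * (1 - e)\<^sup>2 \<le> x\<^sup>2 * 1" by (intro mult_left_mono) auto
      then show "4 * (x\<^sup>2 * (1 - e)\<^sup>2) \<le> 4 * (1 + x\<^sup>2)" by simp
      show "?d \<le> ?d ^ 4" using ge1[of x] by (rule self_le_power) simp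
    qed (use pos[of x] in auto)
    finally show ?thesis by (simp add: cutoff_weight_def)
  qed
  show "\<bar>2 * x * (1 - e) / ?d\<^sup>2\<bar> \<le> 2 / e + 6"
  proof (rule power2_le_imp_le)
    \<comment> \<open>The previous bound together with w \<le> 1/e; then e \<le> 1 gives 4/e \<le>
      (2/e)^2.\<close>
    have "(2 * x * (1 - e) / ?d\<^sup>2)\<^sup>2 \<le> 4 * (1 / e)" using sq w_le by simp
    also have "\<dots> \<le> (2 / e)\<^sup>2" using e by (simp add: power2_eq_square field_simps)
    also have "\<dots> \<le> (2 / e + 6)\<^sup>2" using e by (intro power_mono) auto
    finally show "\<bar>2 * x * (1 - e) / ?d\<^sup>2\<bar>\<^sup>2 \<le> (2 / e + 6)\<^sup>2" unfolding power2_abs .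
  qed (use e in auto)
  show "\<bar>2 * (1 - e) * (1 - 3 * e * x\<^sup>2) / ?d ^ 3\<bar> \<le> 2 / e + 6"
  proof -
    have "\<bar>1 - 3 * e * x\<^sup>2\<bar> \<le> 3 * ?d" using e by (auto simp: abs_le_iff)
    then have "\<bar>2 * (1 - e)\<bar> * \<bar>1 - 3 * e * x\<^sup>2\<bar> \<le> 2 * (3 * ?d)" using e by (intro mult_mono) auto
    also have "\<dots> \<le> 6 * ?d ^ 3" using self_le_power[OF ge1[of x], of 3] by simp
    finally have "\<bar>2 * (1 - e)\<bar> * \<bar>1 - 3 * e * x\<^sup>2\<bar> / ?d ^ 3 \<le> 6"
      using pos[of x] by (simp add: pos_divide_le_eq)
    then have "\<bar>2 * (1 - e) * (1 - 3 * e * x\<^sup>2) / ?d ^ 3\<bar> \<le> 6"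
      using pos[of x] by (simp add: abs_mult)
    also have "6 \<le> 2 / e + 6" using e by simp
    finally show ?thesis .
  qed
next
  show "continuous_on UNIV (\<lambda>x. 2 * (1 - e) * (1 - 3 * e * x\<^sup>2) / (1 + e * x\<^sup>2) ^ 3)"
  proof (intro continuous_intros ballI)
    fix x :: real
    have "0 < 1 + e * x\<^sup>2" using e by (simp add: add_pos_nonneg)
    then show "(1 + e * x\<^sup>2) ^ 3 \<noteq> 0" by simp
  qed
qed

abbreviation cutoff_energy :: "real \<Rightarrow> (real \<Rightarrow> complex) \<Rightarrow> real" where
  "cutoff_energy e \<equiv> energy_weight.energy (cutoff_weight e)"

lemma cutoff_energy_def:
  assumes "0 < e" "e \<le> 1"
  shows "cutoff_energy e f = (LINT x|lborel. (cmod (f x))\<^sup>2 * cutoff_weight e x)"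
  by (rule energy_weight.energy_def[OF energy_weight_cutoff[OF assms]])

lemma cutoff_energy_le:
  assumes e: "0 < e" "e \<le> 1" and f: "f \<in> L2" and i: "integrable lborel (\<lambda>x. (cmod (f x))\<^sup>2 * (1 + x\<^sup>2))"
  shows "cutoff_energy e f \<le> (LINT x|lborel. (cmod (f x))\<^sup>2 * (1 + x\<^sup>2))"
  unfolding cutoff_energy_def[OF e]
proof (rule integral_mono[OF energy_weight.energy_integrable[OF energy_weight_cutoff[OF e] f] i])
  fix x :: real
  have "cutoff_weight e x \<le> (1 + x\<^sup>2) / 1"
    unfolding cutoff_weight_def using e by (intro divide_left_mono) (auto simp: add_pos_nonneg)
  then show "(cmod (f x))\<^sup>2 * cutoff_weight e x \<le> (cmod (f x))\<^sup>2 * (1 + x\<^sup>2)" by (intro mult_left_mono) auto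
qed

text \<open>Fatou's lemma along e = 1/(n + 1).\<close>

lemma integrable_weight_if_cutoff_energy_bounded:
  assumes f: "f \<in> L2" and B: "\<And>e. 0 < e \<Longrightarrow> e \<le> 1 \<Longrightarrow> cutoff_energy e f \<le> B"
  shows "integrable lborel (\<lambda>x. (cmod (f x))\<^sup>2 * (1 + x\<^sup>2))"
proof (rule integrableI_bounded)
  note [measurable] = L2_measurable[OF f]
  show "(\<lambda>x. (cmod (f x))\<^sup>2 * (1 + x\<^sup>2)) \<in> borel_measurable lborel" by measurable
  define e where "e n = 1 / real (Suc n)" for n
  have e: "0 < e n" "e n \<le> 1" for n by (auto simp: e_def)
  have [measurable]: "cutoff_weight c \<in> borel_measurable borel" for c
    unfolding cutoff_weight_def[abs_def] by measurable
  have nn: "0 \<le> (cmod (f x))\<^sup>2 * cutoff_weight (e n) x" for n x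
    using e(1)[of n] by (simp add: cutoff_weight_def)
  have lim: "(\<lambda>n. ennreal ((cmod (f x))\<^sup>2 * cutoff_weight (e n) x)) \<longlonglongrightarrow> ennreal (norm ((cmod (f x))\<^sup>2 * (1 + x\<^sup>2)))" for x
  proof -
    have "e \<longlonglongrightarrow> 0" unfolding e_def[abs_def] by (rule LIMSEQ_Suc[OF lim_1_over_n])
    then have "(\<lambda>n. (cmod (f x))\<^sup>2 * ((1 + x\<^sup>2) / (1 + e n * x\<^sup>2))) \<longlonglongrightarrow> (cmod (f x))\<^sup>2 * ((1 + x\<^sup>2) / (1 + 0 * x\<^sup>2))"
      by (intro tendsto_intros) auto
    then show ?thesis by (intro tendsto_ennrealI) (simp add: cutoff_weight_def abs_mult)
  qed
  have "(\<integral>\<^sup>+x. ennreal (norm ((cmod (f x))\<^sup>2 * (1 + x\<^sup>2))) \<partial>lborel) =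
    (\<integral>\<^sup>+x. liminf (\<lambda>n. ennreal ((cmod (f x))\<^sup>2 * cutoff_weight (e n) x)) \<partial>lborel)"
    by (intro nn_integral_cong) (rule lim_imp_Liminf[symmetric, OF trivial_limit_sequentially lim])
  also have "\<dots> \<le> liminf (\<lambda>n. \<integral>\<^sup>+x. ennreal ((cmod (f x))\<^sup>2 * cutoff_weight (e n) x) \<partial>lborel)"
    by (rule nn_integral_liminf) measurable
  also have "\<dots> \<le> liminf (\<lambda>n. ennreal B)"
  proof (intro Liminf_mono always_eventually allI)
    fix n
    have "(\<integral>\<^sup>+x. ennreal ((cmod (f x))\<^sup>2 * cutoff_weight (e n) x) \<partial>lborel) = ennreal (cutoff_energy (e n) f)"
      unfolding cutoff_energy_def[OF e]
      by (intro nn_integral_eq_integral energy_weight.energy_integrable[OF energy_weight_cutoff[OF e] f] AE_I2 nn)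
    then show "(\<integral>\<^sup>+x. ennreal ((cmod (f x))\<^sup>2 * cutoff_weight (e n) x) \<partial>lborel) \<le> ennreal B"
      using B[OF e] by (simp add: ennreal_leI)
  qed
  also have "\<dots> = ennreal B" by (rule Liminf_const) simp
  also have "\<dots> < \<infinity>" by simp
  finally show "(\<integral>\<^sup>+x. ennreal (norm ((cmod (f x))\<^sup>2 * (1 + x\<^sup>2))) \<partial>lborel) < \<infinity>" .
qed

lemma (in CMDNLS_flow) weight_propagation:
  assumes seg: "closed_segment 0 t \<subseteq> I" and "j \<le> 2"
    and i0: "integrable lborel (\<lambda>x. (cmod (p 0 0 x))\<^sup>2 * (1 + x\<^sup>2))"
    and i2: "integrable lborel (\<lambda>x. (cmod (p 0 2 x))\<^sup>2 * (1 + x\<^sup>2))"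
  shows "integrable lborel (\<lambda>x. (cmod (p t j x))\<^sup>2 * (1 + x\<^sup>2))"
proof -
  have t: "t \<in> I" and z: "0 \<in> I" using seg by auto
  obtain M where M: "\<And>s. s \<in> closed_segment 0 t \<Longrightarrow> Sobolev_chain M (p s)"
    using uniform_chain[OF compact_segment seg] by blast
  define B0 where "B0 = (LINT x|lborel. (cmod (p 0 0 x))\<^sup>2 * (1 + x\<^sup>2)) + (LINT x|lborel. (cmod (p 0 2 x))\<^sup>2 * (1 + x\<^sup>2))"
  \<comment> \<open>Built from the untruncated initial energies, hence independent of the
    truncation.\<close>
  define B where "B = (B0 + 1) * exp (growth_rate M * \<bar>t\<bar>)"
  have B: "cutoff_energy e (p t 0) + cutoff_energy e (p t 2) \<le> B" if e: "0 < e" "e \<le> 1" for e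
  proof -
    have "cutoff_energy e (p t 0) + cutoff_energy e (p t 2) + 1 \<le>
      (cutoff_energy e (p 0 0) + cutoff_energy e (p 0 2) + 1) * exp (growth_rate M * \<bar>t\<bar>)"
    proof (rule gronwall)
      fix s assume s: "s \<in> closed_segment 0 t"
      then have "s \<in> I" using seg by blast
      from energy_rate_bound[OF energy_weight_cutoff[OF e] this M[OF s]]
      show "\<exists>r. ((\<lambda>s. cutoff_energy e (p s 0) + cutoff_energy e (p s 2)) has_real_derivative r) (at s) \<and>
        \<bar>r\<bar> \<le> growth_rate M * (cutoff_energy e (p s 0) + cutoff_energy e (p s 2) + 1)"
        by blast
    qed
    also have "\<dots> \<le> B"
      unfolding B_def B0_def
      using cutoff_energy_le[OF e p_L2[OF z] i0] cutoff_energy_le[OF e p_L2[OF z] i2]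
      by (intro mult_right_mono add_mono) auto
    finally show ?thesis by simp
  qed
  have nn: "0 \<le> cutoff_energy e f" if "0 < e" "e \<le> 1" for e f
    by (rule energy_weight.energy_nonneg[OF energy_weight_cutoff[OF that]])
  have Mt: "Sobolev_chain M (p t)" by (rule M) simp
  \<comment> \<open>For j = 1 interpolation gives 2 E_0 + E_2 + M^2; for j = 0 and j = 2 the bound
    holds since energies are nonnegative.\<close>
  have "cutoff_energy e (p t j) \<le> 2 * B + M\<^sup>2" if e: "0 < e" "e \<le> 1" for e
  proof -
    have "j = 0 \<or> j = 1 \<or> j = 2" using \<open>j \<le> 2\<close> by linarith
    then show ?thesis
      using B[OF e] nn[OF e, of "p t 0"] nn[OF e, of "p t 2"] zero_le_power2[of M]
        energy_weight.energy_interpolation[OF energy_weight_cutoff[OF e] Mt]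
      by (elim disjE) (hypsubst, linarith)+
  qed
  then show ?thesis using \<open>j \<le> 2\<close> by (intro integrable_weight_if_cutoff_energy_bounded p_L2 t) auto
qed

section \<open>Transfer to the given solution\<close>

lemma L2_1_cong_AE:
  assumes "integrable lborel (\<lambda>x. (cmod (f x))\<^sup>2 * (1 + x\<^sup>2))" "AE x in lborel. g x = f x"
    and [measurable]: "f \<in> borel_measurable borel" "g \<in> borel_measurable borel"
  shows "g \<in> L2_1"
proof -
  have "integrable lborel (\<lambda>x. (cmod (g x))\<^sup>2 * (1 + x\<^sup>2)) \<longleftrightarrow> integrable lborel (\<lambda>x. (cmod (f x))\<^sup>2 * (1 + x\<^sup>2))"
    by (rule integrable_cong_AE) (use assms(2) in auto)
  with assms show ?thesis by (simp add: L2_1_def)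
qed

lemma L2_norm_weak_deriv_le_Sobolev_norm:
  assumes "j \<le> k" shows "L2_norm (weak_deriv j f) \<le> Sobolev_norm k f"
proof -
  have "(L2_norm (weak_deriv j f))\<^sup>2 \<le> (\<Sum>j\<le>k. (L2_norm (weak_deriv j f))\<^sup>2)"
    by (rule member_le_sum) (use assms in auto)
  then show ?thesis unfolding Sobolev_norm_def by (rule real_le_rsqrt)
qed

theorem theorem1p7:
  fixes T_minus T_plus :: ereal
    and u :: "real \<Rightarrow> real \<Rightarrow> complex" and u0 :: "real \<Rightarrow> complex"
  defines "I \<equiv> {t::real. T_minus < ereal t \<and> ereal t < T_plus}"
  assumes "T_minus < 0" and "0 < T_plus"
    and "u0 \<in> Sobolev_plus 4"
    and "C0_Sobolev_plus 4 I u"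
    and "CMDNLS_equation I u"
    and "AE x in lborel. u 0 x = u0 x"
    and "u0 \<in> L2_1" and "weak_deriv 1 u0 \<in> L2_1" and "weak_deriv 2 u0 \<in> L2_1"
  shows "\<forall>t\<in>I. u t \<in> L2_1 \<and> weak_deriv 1 (u t) \<in> L2_1 \<and> weak_deriv 2 (u t) \<in> L2_1"
proof -
  have open_I: "open I" unfolding I_def
    by (intro open_Collect_conj open_Collect_less continuous_intros)
  have z: "0 \<in> I" using assms(2,3) by (simp add: I_def zero_ereal_def)
  have seg: "closed_segment 0 t \<subseteq> I" if "t \<in> I" for t
  proof
    fix s assume "s \<in> closed_segment 0 t"
    then have "min 0 t \<le> s" "s \<le> max 0 t" by (auto simp: closed_segment_eq_real_ivl split: if_splits)
    then have "ereal (min 0 t) \<le> ereal s" "ereal s \<le> ereal (max 0 t)" by (simp_all only: ereal_less_eq)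
    moreover have "T_minus < ereal (min 0 t)" "ereal (max 0 t) < T_plus"
      using that z by (simp_all add: I_def min_def max_def)
    ultimately have "T_minus < ereal s" "ereal s < T_plus" by (blast intro: less_le_trans le_less_trans)+
    then show "s \<in> I" by (simp add: I_def)
  qed
  have sob: "u t \<in> Sobolev 4" if "t \<in> I" for t
    using assms(5) that by (auto simp: C0_Sobolev_plus_def Sobolev_plus_def)
  have um: "u t \<in> borel_measurable borel" if "t \<in> I" for t
    using sob[OF that] by (auto simp: Sobolev_def L2_def)
  have "\<exists>q. (\<exists>M. Sobolev_chain M q) \<and> (\<forall>j\<le>4. has_weak_deriv j (u t) (q j)) \<and> (AE x in lborel. u t x = q 0 x)"
    if "t \<in> I" for t using Sobolev_chain_exists[OF sob[OF that]] by metis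
  then obtain p where chain: "\<And>t. t \<in> I \<Longrightarrow> \<exists>M. Sobolev_chain M (p t)"
    and wd: "\<And>t j. t \<in> I \<Longrightarrow> j \<le> 4 \<Longrightarrow> has_weak_deriv j (u t) (p t j)"
    and AE0: "\<And>t. t \<in> I \<Longrightarrow> AE x in lborel. u t x = p t 0 x"
    by metis
  have pL2: "p t j \<in> L2" if "t \<in> I" "j \<le> 4" for t j
    using chain[OF that(1)] Sobolev_chain_L2(1) that(2) by blast
  note pm = L2_measurable[OF pL2]
  have wm: "weak_deriv j (u t) \<in> borel_measurable borel" if "t \<in> I" "j \<le> 4" for t j
    using has_weak_deriv_weak_deriv[OF wd[OF that]] by (simp add: has_weak_deriv_def locally_integrable_measurable)
  \<comment> \<open>Stated for all \<open>t\<close> so that \<open>v\<close> can be chosen as a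
    total function; outside \<open>I\<close> its value is arbitrary.\<close>
  have "\<forall>t. \<exists>v. t \<in> I \<longrightarrow> has_time_deriv I u t v \<and>
    (AE x in lborel. v x = \<i> * p t 2 x + \<i> * (p t 0 x * potential (p t) 0 x))"
  proof
    fix t
    show "\<exists>v. t \<in> I \<longrightarrow> has_time_deriv I u t v \<and>
      (AE x in lborel. v x = \<i> * p t 2 x + \<i> * (p t 0 x * potential (p t) 0 x))"
    proof (cases "t \<in> I")
      case True
      define D where "D = weak_deriv 1 (\<lambda>x. of_real ((cmod (u t x))\<^sup>2))"
      obtain v where v: "has_time_deriv I u t v"
        "AE x in lborel. \<i> * v x + weak_deriv 2 (u t) x + u t x * (Hilbert_transform D x - \<i> * D x) = 0"
        using assms(6) True unfolding CMDNLS_equation_def Let_def D_def by blast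
      obtain M where M: "Sobolev_chain M (p t)" using chain[OF True] by blast
      have "AE x in lborel. v x = \<i> * p t 2 x + \<i> * (p t 0 x * potential (p t) 0 x)"
        using v(2) AE0[OF True] AE_weak_deriv[OF wd[OF True, of 2, simplified]]
          potential_eq_nonlinearity[OF M AE0[OF True] um[OF True], folded D_def]
      proof eventually_elim
        case (elim x)
        then have "\<i> * v x + (p t 2 x + p t 0 x * potential (p t) 0 x) = 0" by (simp add: add.assoc)
        \<comment> \<open>Multiplication by i turns i v into - v and so solves for
          \<open>v\<close>.\<close>
        then have "\<i> * (\<i> * v x) = - (\<i> * (p t 2 x + p t 0 x * potential (p t) 0 x))"
          by (metis add_eq_0_iff2 mult_minus_right)
        then have "v x = \<i> * (p t 2 x + p t 0 x * potential (p t) 0 x)"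
          by (simp add: mult.assoc[symmetric])
        then show ?case by (simp add: distrib_left)
      qed
      then show ?thesis using v(1) by blast
    qed simp
  qed
  then obtain v where v: "\<And>t. t \<in> I \<Longrightarrow> has_time_deriv I u t (v t)"
    "\<And>t. t \<in> I \<Longrightarrow> AE x in lborel. v t x = \<i> * p t 2 x + \<i> * (p t 0 x * potential (p t) 0 x)"
    by metis
  interpret CMDNLS_flow I p v
  proof
    show "open I" by (rule open_I)
    show "\<exists>M. Sobolev_chain M (p t)" if "t \<in> I" for t by (rule chain[OF that])
    show "v t \<in> L2" if "t \<in> I" for t using v(1)[OF that] by (simp add: has_time_deriv_def)
    show "AE x in lborel. v t x = \<i> * p t 2 x + \<i> * (p t 0 x * potential (p t) 0 x)" if "t \<in> I" for t
      by (rule v(2)[OF that])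
    fix t assume t: "t \<in> I"
    have ev: "\<forall>\<^sub>F s in at t within I. s \<in> I" by (simp add: eventually_at_filter)
    show "((\<lambda>s. L2_norm (\<lambda>x. p s j x - p t j x)) \<longlongrightarrow> 0) (at t within I)" if j: "j \<le> 4" for j
    \<comment> \<open>The Sobolev norm of the difference dominates the norm of each chosen weak
      derivative, which agrees almost everywhere with the difference of the representatives.\<close>
    proof (rule Lim_null_comparison)
      show "((\<lambda>s. Sobolev_norm 4 (\<lambda>x. u s x - u t x)) \<longlongrightarrow> 0) (at t within I)"
        using assms(5) t by (auto simp: C0_Sobolev_plus_def)
      show "\<forall>\<^sub>F s in at t within I. norm (L2_norm (\<lambda>x. p s j x - p t j x)) \<le> Sobolev_norm 4 (\<lambda>x. u s x - u t x)"
        using ev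
      proof eventually_elim
        case (elim s)
        have d: "has_weak_deriv j (\<lambda>x. u s x - u t x) (\<lambda>x. p s j x - p t j x)"
          by (intro has_weak_deriv_diff wd elim t j)
        have "L2_norm (weak_deriv j (\<lambda>x. u s x - u t x)) = L2_norm (\<lambda>x. p s j x - p t j x)"
        proof (rule L2_norm_cong_AE[OF _ _ AE_weak_deriv[OF d]])
          show "weak_deriv j (\<lambda>x. u s x - u t x) \<in> borel_measurable borel"
            using has_weak_deriv_weak_deriv[OF d] by (simp add: has_weak_deriv_def locally_integrable_measurable)
          show "(\<lambda>x. p s j x - p t j x) \<in> borel_measurable borel"
            using d by (simp add: has_weak_deriv_def locally_integrable_measurable)
        qed
        then show ?case using L2_norm_weak_deriv_le_Sobolev_norm[OF j, of "\<lambda>x. u s x - u t x"] by simp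
      qed
    qed
    have vL: "v t \<in> borel_measurable borel" using v(1)[OF t] by (simp add: has_time_deriv_def L2_def)
    show "((\<lambda>s. L2_norm (\<lambda>x. (p s 0 x - p t 0 x) / of_real (s - t) - v t x)) \<longlongrightarrow> 0) (at t within I)"
    proof (rule Lim_transform_eventually)
      show "((\<lambda>s. L2_norm (\<lambda>x. (u s x - u t x) / of_real (s - t) - v t x)) \<longlongrightarrow> 0) (at t within I)"
        using v(1)[OF t] by (simp add: has_time_deriv_def)
      show "\<forall>\<^sub>F s in at t within I. L2_norm (\<lambda>x. (u s x - u t x) / of_real (s - t) - v t x) =
        L2_norm (\<lambda>x. (p s 0 x - p t 0 x) / of_real (s - t) - v t x)"
        using ev
      proof eventually_elim
        case (elim s)
        note [measurable] = um[OF elim] um[OF t] pm[OF elim, of 0, simplified] pm[OF t, of 0, simplified] vL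
        show ?case
        proof (rule L2_norm_cong_AE)
          show "AE x in lborel. (u s x - u t x) / of_real (s - t) - v t x = (p s 0 x - p t 0 x) / of_real (s - t) - v t x"
            using AE0[OF elim] AE0[OF t] by eventually_elim simp
        qed measurable
      qed
    qed
  qed
  have u0m: "u0 \<in> borel_measurable borel" using assms(8) by (simp add: L2_1_def)
  \<comment> \<open>\<open>u 0\<close> and \<open>u0\<close> agree only almost everywhere, yet their
    chosen weak derivatives are the same function, so the hypothesis on \<open>u0\<close> applies to
    \<open>u 0\<close>.\<close>
  have wd0: "weak_deriv 2 (u 0) = weak_deriv 2 u0"
    by (rule weak_deriv_cong_AE[OF assms(7) um[OF z] u0m])
  have "p 0 0 \<in> L2_1"
  proof (rule L2_1_cong_AE[where f=u0])
    show "AE x in lborel. p 0 0 x = u0 x" using AE0[OF z] assms(7) by eventually_elim simp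
  qed (use assms(8) u0m pm[OF z] in \<open>auto simp: L2_1_def\<close>)
  moreover have "p 0 2 \<in> L2_1"
  proof (rule L2_1_cong_AE[where f="weak_deriv 2 u0"])
    show "AE x in lborel. p 0 2 x = weak_deriv 2 u0 x"
      using AE_weak_deriv[OF wd[OF z, of 2, simplified]] unfolding wd0 by eventually_elim simp
  qed (use assms(10) pm[OF z] in \<open>auto simp: L2_1_def\<close>)
  ultimately have int: "integrable lborel (\<lambda>x. (cmod (p t j x))\<^sup>2 * (1 + x\<^sup>2))" if "t \<in> I" "j \<le> 2" for t j
    using weight_propagation[OF seg[OF that(1)] that(2)] by (simp add: L2_1_def)
  show ?thesis
  proof (intro ballI conjI)
    fix t assume t: "t \<in> I"
    show "u t \<in> L2_1" by (rule L2_1_cong_AE[OF int[OF t, of 0] AE0[OF t] pm[OF t] um[OF t]]) auto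
    show "weak_deriv 1 (u t) \<in> L2_1"
      by (rule L2_1_cong_AE[OF int[OF t, of 1] AE_weak_deriv[OF wd[OF t]] pm[OF t] wm[OF t]]) auto
    show "weak_deriv 2 (u t) \<in> L2_1"
      by (rule L2_1_cong_AE[OF int[OF t, of 2] AE_weak_deriv[OF wd[OF t]] pm[OF t] wm[OF t]]) auto
  qed
qed

end
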